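(* Let $n,m\in\mathbb N$ and $\mathbf d\in\mathbb N^m$ with $\sum_{i=1}^m d_i\ge n$. Then the local minimizers of the fusion frame potential $\mathrm{FFP}$ in $\mathcal B^1_{m,n}(\mathbf d)$ with respect to the pseudo-distance $d_S$ lie in $\mathcal S^1_{m,n}(\mathbf d)$ and are also global minimizers of $\mathrm{FFP}$ in $\mathcal B^1_{m,n}(\mathbf d)$. Moreover, the spectra (with multiplicities) of the frame operators of these local minimizers coincide.
   Context: $P_W$ is the orthogonal projection onto $W$. $\mathcal B^1_{m,n}(\mathbf d)$ is the set of all $\mathcal W_w=(w_i,W_i)_{i=1}^m$ with weights $w\in\mathbb R_{>0}^m$ and subspaces $W_i\subseteq\mathbb C^n$, $\dim W_i=d_i$, such that $\operatorname{tr}S_{\mathcal W_w}=\sum_i w_i^2d_i=1$, where $S_{\mathcal W_w}=\sum_i w_i^2P_{W_i}$ is the frame operator. $\mathcal S^1_{m,n}(\mathbf d)$ is the subset of those $\mathcal W_w\in\mathcal B^1_{m,n}(\mathbf d)$ which are fusion frames, i.e. with $S_{\mathcal W_w}$ invertible. $\mathrm{FFP}(\mathcal W_w)=\operatorname{tr}(S_{\mathcal W_w}^2)$. The operatorial pseudo-distance is $d_S(\mathcal W_w,\mathcal W'_{w'})=\|S_{\mathcal W_w}-S_{\mathcal W'_{w'}}\|$ (spectral norm). *)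

theory Defs
  imports "HOL-Analysis.Analysis" "HOL-Computational_Algebra.Polynomial"
begin

definition cinner :: "complex ^ 'n \<Rightarrow> complex ^ 'n \<Rightarrow> complex"
  where "cinner x y = (\<Sum>i\<in>UNIV. x $ i * cnj (y $ i))"

(* Subspaces of C^n are complex-linear: vec.subspace and vec.dim, not the real notions
   subspace and dim. *)

definition is_orth_proj :: "(complex ^ 'n) set \<Rightarrow> complex ^ 'n ^ 'n \<Rightarrow> bool"
  where "is_orth_proj W P \<longleftrightarrow> (\<forall>x. P *v x \<in> W \<and> (\<forall>y\<in>W. cinner (x - P *v x) y = 0))"

definition orth_proj :: "(complex ^ 'n) set \<Rightarrow> complex ^ 'n ^ 'n"
  where "orth_proj W = (THE P. is_orth_proj W P)"

lemma Re_cinner: "Re (cinner x y) = x \<bullet> y"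
  by (simp add: cinner_def inner_vec_def inner_complex_def)

lemma cinner_diff_left: "cinner (x - y) z = cinner x z - cinner y z"
  by (simp add: cinner_def algebra_simps sum_subtractf)

lemma cinner_add_left: "cinner (x + y) z = cinner x z + cinner y z"
  by (simp add: cinner_def algebra_simps sum.distrib)

lemma cinner_scale_left: "cinner (c *s x) z = c * cinner x z"
  by (simp add: cinner_def sum_distrib_left algebra_simps)

lemma cinner_scale_right: "cinner x (c *s z) = cnj c * cinner x z"
  by (simp add: cinner_def sum_distrib_left algebra_simps)

lemma cinner_self_eq_0: "cinner x x = 0 \<Longrightarrow> x = 0"
  using Re_cinner[of x x] by simp

lemma vec_subspace_imp_subspace:
  assumes "vec.subspace (W :: (complex ^ 'n) set)"
  shows "subspace W"
proof -
  have "r *\<^sub>R x = complex_of_real r *s x" for r and x :: "complex ^ 'n"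
    by (simp add: vec_eq_iff scaleR_conv_of_real[where 'a=complex])
  then show ?thesis
    using assms by (simp add: subspace_def vec.subspace_def)
qed

lemma orth_decomp_unique:
  assumes W: "vec.subspace W" and "a \<in> W" "b \<in> W"
    and "\<forall>y\<in>W. cinner (x - a) y = 0" "\<forall>y\<in>W. cinner (x - b) y = 0"
  shows "a = b"
proof -
  have "a - b \<in> W"
    using assms by (simp add: vec.subspace_diff)
  then have "cinner (x - b) (a - b) - cinner (x - a) (a - b) = 0"
    using assms by simp
  then have "cinner (a - b) (a - b) = 0"
    by (simp add: cinner_diff_left[symmetric])
  then show ?thesis
    using cinner_self_eq_0 by fastforce
qed

lemma orth_decomp_exists:
  assumes W: "vec.subspace (W :: (complex ^ 'n) set)"
  shows "\<exists>a\<in>W. \<forall>y\<in>W. cinner (x - a) y = 0"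
proof -
  have s: "span W = W"
    using vec_subspace_imp_subspace[OF W] by (simp add: span_eq_iff)
  obtain a b where ab: "a \<in> span W" "\<And>w. w \<in> span W \<Longrightarrow> orthogonal b w" "x = a + b"
    using orthogonal_subspace_decomp_exists[of W x] by metis
  have "cinner b y = 0" if "y \<in> W" for y
  proof -
    have "\<i> *s y \<in> W"
      using W that by (rule vec.subspace_scale)
    then have "Re (cinner b (\<i> *s y)) = 0" "Re (cinner b y) = 0"
      using ab(2) that s unfolding Re_cinner orthogonal_def by auto
    then show ?thesis
      by (simp add: cinner_scale_right complex_eq_iff)
  qed
  then have "\<forall>y\<in>W. cinner (x - a) y = 0"
    using ab(3) by simp
  then show ?thesis
    using ab(1) s by blast
qed

lemma is_orth_proj_ex1:
  assumes W: "vec.subspace (W :: (complex ^ 'n) set)"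
  shows "\<exists>!P. is_orth_proj W P"
proof (rule ex_ex1I)
  obtain p where p: "\<And>x. p x \<in> W" "\<And>x y. y \<in> W \<Longrightarrow> cinner (x - p x) y = 0"
    using orth_decomp_exists[OF W] by metis
  have add: "p (x + y) = p x + p y" for x y
  proof (rule orth_decomp_unique[OF W])
    show "p x + p y \<in> W" "p (x + y) \<in> W"
      using p(1) vec.subspace_add[OF W] by blast+
    show "\<forall>z\<in>W. cinner (x + y - p (x + y)) z = 0"
      using p(2) by blast
    show "\<forall>z\<in>W. cinner (x + y - (p x + p y)) z = 0"
      using p(2) unfolding add_diff_add cinner_add_left by simp
  qed
  have scale: "p (c *s x) = c *s p x" for c x
  proof (rule orth_decomp_unique[OF W])
    show "c *s p x \<in> W" "p (c *s x) \<in> W"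
      using p(1) vec.subspace_scale[OF W] by blast+
    show "\<forall>z\<in>W. cinner (c *s x - p (c *s x)) z = 0"
      using p(2) by blast
    show "\<forall>z\<in>W. cinner (c *s x - c *s p x) z = 0"
      using p(2) unfolding vec.scale_right_diff_distrib[symmetric] cinner_scale_left by simp
  qed
  have "Vector_Spaces.linear (*s) (*s) p"
    by unfold_locales (rule add scale)+
  then have "is_orth_proj W (matrix p)"
    using p by (simp add: is_orth_proj_def matrix_works)
  then show "\<exists>P. is_orth_proj W P" ..
next
  fix P Q assume "is_orth_proj W P" "is_orth_proj W Q"
  then have "P *v x = Q *v x" for x
    using orth_decomp_unique[OF W, of "P *v x" "Q *v x" x] by (simp add: is_orth_proj_def)
  then show "P = Q"
    by (simp add: matrix_eq)
qed

lemma is_orth_proj_orth_proj: "vec.subspace W \<Longrightarrow> is_orth_proj W (orth_proj W)"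
  unfolding orth_proj_def by (rule theI'[OF is_orth_proj_ex1])

type_synonym ('m, 'n) weighted_family = "'m \<Rightarrow> real \<times> (complex ^ 'n) set"

definition frame_op :: "('m::finite, 'n::finite) weighted_family \<Rightarrow> complex ^ 'n ^ 'n"
  where "frame_op \<W> = (\<Sum>i\<in>UNIV. ((fst (\<W> i))\<^sup>2) *\<^sub>R orth_proj (snd (\<W> i)))"

definition bessel1 :: "('m::finite \<Rightarrow> nat) \<Rightarrow> ('m, 'n::finite) weighted_family set"
  where "bessel1 d = {\<W>. (\<forall>i. fst (\<W> i) > 0 \<and> vec.subspace (snd (\<W> i)) \<and> vec.dim (snd (\<W> i)) = d i)
     \<and> trace (frame_op \<W>) = 1}"

definition fusion_frames1 :: "('m::finite \<Rightarrow> nat) \<Rightarrow> ('m, 'n::finite) weighted_family set"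
  where "fusion_frames1 d = {\<W> \<in> bessel1 d. invertible (frame_op \<W>)}"

(* The frame operator is Hermitian, so this trace is real; Re only changes the type. *)
definition FFP :: "('m::finite, 'n::finite) weighted_family \<Rightarrow> real"
  where "FFP \<W> = Re (trace (frame_op \<W> ** frame_op \<W>))"

(* onorm with respect to the Euclidean norm on C^n is the spectral norm. *)
definition d_S :: "('m::finite, 'n::finite) weighted_family \<Rightarrow> ('m, 'n) weighted_family \<Rightarrow> real"
  where "d_S \<W> \<W>' = onorm ((*v) (frame_op \<W> - frame_op \<W>'))"

definition FFP_local_minimizer :: "('m::finite \<Rightarrow> nat) \<Rightarrow> ('m, 'n::finite) weighted_family \<Rightarrow> bool"
  where "FFP_local_minimizer d \<W> \<longleftrightarrow> \<W> \<in> bessel1 d \<and>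
    (\<exists>\<epsilon>>0. \<forall>\<V>\<in>bessel1 d. d_S \<W> \<V> < \<epsilon> \<longrightarrow> FFP \<W> \<le> FFP \<V>)"

definition FFP_global_minimizer :: "('m::finite \<Rightarrow> nat) \<Rightarrow> ('m, 'n::finite) weighted_family \<Rightarrow> bool"
  where "FFP_global_minimizer d \<W> \<longleftrightarrow> \<W> \<in> bessel1 d \<and> 
    (\<forall>\<V> \<in> (bessel1 d :: ('m, 'n) weighted_family set). FFP \<W> \<le> FFP \<V>)"

definition char_matrix_poly :: "complex ^ 'n ^ 'n \<Rightarrow> complex poly"
  where "char_matrix_poly A = det (mat [:0, 1:] - map_matrix (\<lambda>a. [:a:]) A)"

(* The multiset of eigenvalues, counted with algebraic multiplicity. *)
definition spectrum_mset :: "complex ^ 'n ^ 'n \<Rightarrow> complex multiset"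
  where "spectrum_mset A = proots (char_matrix_poly A)"

end

theory Submission
  imports Defs "HOL-Library.Function_Algebras"
begin

text \<open>Write the frame operator as \<open>S = \<Sum>\<^sub>i c\<^sub>i P\<^sub>i\<close> with \<open>c\<^sub>i = w\<^sub>i\<^sup>2\<close>; then FFP is \<open>\<parallel>S\<parallel>\<^sup>2\<close> in the
  Frobenius norm. At a local minimizer the first variation gives \<open>S P\<^sub>i = P\<^sub>i S\<close> and \<open>tr (S P\<^sub>i) = tr (S\<^sup>2) d\<^sub>i\<close>.
  Consequently every configuration \<open>T = \<Sum>\<^sub>i c'\<^sub>i Q\<^sub>i\<close> satisfies \<open>tr (S U T U\<^sup>*) \<ge> tr (S\<^sup>2)\<close> as soon as some
  unitary \<open>U\<close> achieves \<open>tr (S U Q\<^sub>i U\<^sup>*) \<ge> tr (S P\<^sub>i)\<close> for all \<open>i\<close>, and Cauchy-Schwarz yields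
  \<open>\<parallel>T\<parallel> \<ge> \<parallel>S\<parallel>\<close> with equality only if \<open>S = U T U\<^sup>*\<close>. Such a \<open>U\<close> exists if the range of \<open>Q\<^sub>i\<close> is
  \<open>g Y\<^sub>i (range P\<^sub>i)\<close> with \<open>g\<close> invertible and \<open>Y\<^sub>i\<close> preserving the spectral flag of \<open>S\<close>: take \<open>U\<close> from the QR
  decomposition of \<open>g\<close>.

  It remains to see that generic configurations have this form. The second variation shows
  that the polynomial map \<open>(g, Y\<^sub>i, C\<^sub>i) \<mapsto> (g Y\<^sub>i C\<^sub>i)\<close>, where \<open>C\<^sub>i\<close> stabilises the range of \<open>P\<^sub>i\<close>, has a
  surjective differential at the identity, since a family orthogonal to the image of the differential would be a
  direction of descent. A complex polynomial map with a surjective differential somewhere has dense range, and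
  compactness of the unitary group passes the inequality to the limit.\<close>

section \<open>Polynomial maps with dense range\<close>

text \<open>The potential is convex in \<open>S\<close>, but the set of attainable frame operators
  need not be convex, so two operators cannot simply be joined by a segment. Pairing with
  \<open>S\<close> replaces this: the conditions on \<open>tr (S P_i)\<close> are Lagrange
  conditions for the squared weights, and a competitor's weights, obeying the same normalisation,
  add them up to exactly \<open>tr (S^2)\<close>. The obstacle is that one unitary must serve all
  subspaces at once, whatever their relative position. Hence \<open>g\<close> is common to all
  indices, while \<open>Y_i\<close> and \<open>C_i\<close> may vary: \<open>Y_i\<close> can only
  push a subspace towards larger eigenvalues, and \<open>C_i\<close> does not move it at all. These
  factors range over linear spaces of matrices, so affine parametrisations suffice and the map is
  polynomial. Invertibility comes from the hypothesis on the dimensions: if \<open>S\<close> has a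
  kernel vector, the subspaces are linearly redundant, and the redundancy gives a second-order
  descent towards that vector.\<close>

inductive polyfun :: "(complex ^ 'k \<Rightarrow> complex) \<Rightarrow> bool" where
  const: "polyfun (\<lambda>x. c)"
| coord: "polyfun (\<lambda>x. x $ k)"
| add: "polyfun f \<Longrightarrow> polyfun g \<Longrightarrow> polyfun (\<lambda>x. f x + g x)"
| mult: "polyfun f \<Longrightarrow> polyfun g \<Longrightarrow> polyfun (\<lambda>x. f x * g x)"

lemma polyfun_sum: "(\<And>i. i \<in> I \<Longrightarrow> polyfun (f i)) \<Longrightarrow> polyfun (\<lambda>x. \<Sum>i\<in>I. f i x)"
  by (induction I rule: infinite_finite_induct) (auto intro: polyfun.intros)

lemma polyfun_prod: "(\<And>i. i \<in> I \<Longrightarrow> polyfun (f i)) \<Longrightarrow> polyfun (\<lambda>x. \<Prod>i\<in>I. f i x)"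
  by (induction I rule: infinite_finite_induct) (auto intro: polyfun.intros)

lemma polyfun_power: "polyfun f \<Longrightarrow> polyfun (\<lambda>x. f x ^ n)"
  by (induction n) (auto intro: polyfun.intros)

lemma polyfun_diff_const:
  assumes "polyfun f" shows "polyfun (\<lambda>x. f x - c)"
  using polyfun.add[OF assms polyfun.const[of "- c"]] by simp

lemma polyfun_comp:
  assumes "polyfun f" "\<And>k. polyfun (\<lambda>x. F x $ k)"
  shows "polyfun (\<lambda>x. f (F x))"
  using assms(1) by induction (auto intro: polyfun.intros assms(2))

lemma polyfun_det:
  assumes "\<And>i j. polyfun (\<lambda>x. A x $ i $ j)"
  shows "polyfun (\<lambda>x. det (A x))"
  unfolding det_def by (intro polyfun_sum polyfun.mult polyfun_prod polyfun.const assms)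

lemma polyfun_line:
  assumes "polyfun f"
  shows "\<exists>q. \<forall>z. f (a + z *s b) = poly q z"
  using assms
proof induction
  case (const c)
  then show ?case by (intro exI[of _ "[:c:]"]) simp
next
  case (coord k)
  then show ?case by (intro exI[of _ "[:a $ k, b $ k:]"]) simp
next
  case (add f g)
  then show ?case by (metis poly_add)
next
  case (mult f g)
  then show ?case by (metis poly_mult)
qed

lemma has_derivative_vec:
  fixes F :: "'a::real_normed_vector \<Rightarrow> complex ^ 'k"
  assumes "\<And>k. ((\<lambda>x. F x $ k) has_derivative (\<lambda>h. F' h $ k)) (at x)"
  shows "(F has_derivative F') (at x)"
  unfolding has_derivative_componentwise_within[of F]
proof
  fix b :: "complex ^ 'k" assume "b \<in> Basis"
  then obtain k u where "b = axis k u"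
    by (auto simp: Basis_vec_def)
  then show "((\<lambda>x. F x \<bullet> b) has_derivative (\<lambda>h. F' h \<bullet> b)) (at x)"
    using has_derivative_inner_left[OF assms[of k], of u] by (simp add: inner_axis)
qed

text \<open>The partial derivatives are asserted to be polynomial again, which makes the Jacobian
  determinant of a polynomial map a \<open>polyfun\<close>.\<close>

lemma polyfun_has_derivative:
  fixes f :: "complex ^ 'k \<Rightarrow> complex"
  assumes "polyfun f"
  shows "\<exists>D. (\<forall>k. polyfun (D k)) \<and> (\<forall>x. (f has_derivative (\<lambda>h. \<Sum>k\<in>UNIV. D k x * h $ k)) (at x))"
  using assms
proof induction
  case (const c)
  show ?case by (intro exI[of _ "\<lambda>_ _. 0"]) (auto intro: polyfun.intros)
next
  case (coord k)
  have "(\<lambda>h. \<Sum>j\<in>UNIV. (if j = k then 1 else 0) * h $ j) = (\<lambda>h::complex^'k. h $ k)"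
    by (auto simp: if_distrib if_distribR cong: if_cong)
  then show ?case
    by (intro exI[of _ "\<lambda>j _. if j = k then 1 else 0"])
       (auto intro!: polyfun.intros bounded_linear_imp_has_derivative bounded_linear_vec_nth)
next
  case (add f g)
  then obtain D E where "\<forall>k. polyfun (D k)" "\<forall>k. polyfun (E k)"
    and "\<forall>x. (f has_derivative (\<lambda>h. \<Sum>k\<in>UNIV. D k x * h $ k)) (at x)"
    and "\<forall>x. (g has_derivative (\<lambda>h. \<Sum>k\<in>UNIV. E k x * h $ k)) (at x)"
    by blast
  then show ?case
    by (intro exI[of _ "\<lambda>k x. D k x + E k x"])
       (auto intro!: polyfun.intros has_derivative_eq_rhs[OF has_derivative_add] simp: sum.distrib algebra_simps)
next
  case (mult f g)
  then obtain D E where "\<forall>k. polyfun (D k)" "\<forall>k. polyfun (E k)"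
    and "\<forall>x. (f has_derivative (\<lambda>h. \<Sum>k\<in>UNIV. D k x * h $ k)) (at x)"
    and "\<forall>x. (g has_derivative (\<lambda>h. \<Sum>k\<in>UNIV. E k x * h $ k)) (at x)"
    by blast
  with mult show ?case
    by (intro exI[of _ "\<lambda>k x. f x * E k x + D k x * g x"])
       (auto intro!: polyfun.intros has_derivative_eq_rhs[OF has_derivative_mult]
         simp: sum.distrib algebra_simps sum_distrib_left)
qed

lemma polyfun_continuous:
  assumes "polyfun f" shows "continuous_on S f"
  using polyfun_has_derivative[OF assms]
  by (meson has_derivative_continuous continuous_at_imp_continuous_on)

text \<open>On the line from \<open>a\<close> to \<open>y\<close> the function is a univariate
  polynomial that vanishes on a nonempty open, hence infinite, set of parameters; \<open>y\<close>
  is the parameter 1.\<close>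

lemma polyfun_zero_on_open:
  assumes f: "polyfun f" and U: "open U" "a \<in> U" and zero: "\<And>x. x \<in> U \<Longrightarrow> f x = 0"
  shows "f y = 0"
proof -
  obtain q where q: "\<And>z. f (a + z *s (y - a)) = poly q z"
    using polyfun_line[OF f] by metis
  have "continuous_on UNIV (\<lambda>z. a + z *s (y - a))"
    unfolding vector_scalar_mult_def by (intro continuous_intros)
  then have "open ((\<lambda>z. a + z *s (y - a)) -` U)"
    using U(1) by (simp add: continuous_on_open_vimage)
  moreover have "0 \<in> (\<lambda>z. a + z *s (y - a)) -` U"
    using U(2) by simp
  ultimately have "infinite ((\<lambda>z. a + z *s (y - a)) -` U)"
    by (metis empty_iff finite_imp_not_open)
  moreover have "(\<lambda>z. a + z *s (y - a)) -` U \<subseteq> {z. poly q z = 0}"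
    using zero by (auto simp flip: q)
  ultimately have "q = 0"
    using poly_roots_finite finite_subset by blast
  then show ?thesis
    using q[of 1] by simp
qed

section \<open>Polynomials of bounded degree and linear dependence\<close>

interpretation cfun: vector_space "\<lambda>(c::complex) (f::'a \<Rightarrow> complex) x. c * f x"
  by unfold_locales (auto simp: fun_eq_iff algebra_simps)

lemma sum_fun_eval: "(\<Sum>i\<in>I. f i) x = (\<Sum>i\<in>I. f i x)" for f :: "'i \<Rightarrow> 'a \<Rightarrow> complex"
  by (induction I rule: infinite_finite_induct) auto

text \<open>Dependence is formulated for an indexed family: coinciding members already give a
  relation with coefficients 1 and -1, and only the injective case uses the dimension bound.\<close>

lemma dependent_family:
  fixes \<psi> :: "'b \<Rightarrow> 'a \<Rightarrow> complex"
  assumes B: "finite B" and T: "finite T" "card T < card B" and span: "\<And>b. b \<in> B \<Longrightarrow> \<psi> b \<in> cfun.span T"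
  shows "\<exists>\<kappa>. (\<exists>b\<in>B. \<kappa> b \<noteq> 0) \<and> (\<forall>x. (\<Sum>b\<in>B. \<kappa> b * \<psi> b x) = 0)"
proof (cases "inj_on \<psi> B")
  case True
  have "cfun.dependent (\<psi> ` B)"
    using cfun.independent_span_bound[OF T(1), of "\<psi> ` B"] span T(2) card_image[OF True] by auto
  then obtain u where u: "\<exists>v\<in>\<psi> ` B. u v \<noteq> 0" "(\<Sum>v\<in>\<psi> ` B. (\<lambda>x. u v * v x)) = 0"
    using cfun.dependent_finite[of "\<psi> ` B"] B by auto
  have "(\<Sum>b\<in>B. u (\<psi> b) * \<psi> b x) = 0" for x
  proof -
    have "(\<Sum>v\<in>\<psi> ` B. u v * v x) = 0"
      using fun_cong[OF u(2), of x] by (simp add: sum_fun_eval)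
    then show ?thesis
      by (simp add: sum.reindex[OF True])
  qed
  with u(1) show ?thesis
    by (intro exI[of _ "\<lambda>b. u (\<psi> b)"]) auto
next
  case False
  then obtain b b' where b: "b \<in> B" "b' \<in> B" "b \<noteq> b'" "\<psi> b = \<psi> b'"
    by (auto simp: inj_on_def)
  let ?\<kappa> = "\<lambda>i. if i = b then 1 else if i = b' then - 1 else (0::complex)"
  have "(\<Sum>i\<in>B. ?\<kappa> i * \<psi> i x) = (\<Sum>i\<in>{b, b'}. ?\<kappa> i * \<psi> i x)" for x
    by (rule sum.mono_neutral_right) (use B b in auto)
  with b show ?thesis
    by (intro exI[of _ ?\<kappa>]) auto
qed

text \<open>Each exponent is bounded separately. Unlike a bound on the total degree this makes the
  count a plain power, and the bounds still add up under multiplication.\<close>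

definition monomials :: "nat \<Rightarrow> (complex ^ 'k \<Rightarrow> complex) set"
  where "monomials D = (\<lambda>\<alpha> x. \<Prod>k\<in>UNIV. x $ k ^ \<alpha> k) ` (UNIV \<rightarrow>\<^sub>E {..D})"

lemma finite_monomials: "finite (monomials D :: (complex ^ 'k \<Rightarrow> complex) set)"
  unfolding monomials_def by (intro finite_imageI finite_PiE) auto

lemma card_monomials: "card (monomials D :: (complex ^ 'k \<Rightarrow> complex) set) \<le> (D + 1) ^ CARD('k)"
  unfolding monomials_def by (rule order_trans[OF card_image_le]) (auto intro: finite_PiE simp: card_PiE)

definition deg_le :: "nat \<Rightarrow> (complex ^ 'k \<Rightarrow> complex) set"
  where "deg_le D = cfun.span (monomials D)"

lemma monomials_mono: "D \<le> E \<Longrightarrow> monomials D \<subseteq> monomials E"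
  unfolding monomials_def by (intro image_mono PiE_mono) auto

lemma deg_le_mono: "f \<in> deg_le D \<Longrightarrow> D \<le> E \<Longrightarrow> f \<in> deg_le E"
  unfolding deg_le_def using cfun.span_mono[OF monomials_mono] by blast

lemma deg_le_add: "f \<in> deg_le D \<Longrightarrow> g \<in> deg_le D \<Longrightarrow> (\<lambda>x. f x + g x) \<in> deg_le D"
  unfolding deg_le_def using cfun.span_add[of f _ g] by (simp add: plus_fun_def)

lemma deg_le_scale: "f \<in> deg_le D \<Longrightarrow> (\<lambda>x. c * f x) \<in> deg_le D"
  unfolding deg_le_def by (rule cfun.span_scale)

lemma deg_le_const: "(\<lambda>x. c) \<in> deg_le D"
proof -
  have "(\<lambda>x. 1) \<in> (monomials D :: (complex ^ 'k \<Rightarrow> complex) set)"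
    unfolding monomials_def by (rule image_eqI[of _ _ "\<lambda>_. 0"]) auto
  then have "(\<lambda>x::complex ^ 'k. c * 1) \<in> deg_le D"
    unfolding deg_le_def by (intro cfun.span_scale cfun.span_base)
  then show ?thesis by simp
qed

lemma deg_le_coord: "(\<lambda>x. x $ k) \<in> deg_le 1"
proof -
  have "(\<lambda>x. x $ k) \<in> monomials 1"
    unfolding monomials_def
    by (rule image_eqI[of _ _ "\<lambda>j. if j = k then 1 else 0"]) (auto simp: fun_eq_iff if_distrib cong: if_cong)
  then show ?thesis
    unfolding deg_le_def by (rule cfun.span_base)
qed

lemma deg_le_mult:
  assumes f: "f \<in> deg_le D" and g: "g \<in> deg_le E"
  shows "(\<lambda>x. f x * g x) \<in> deg_le (D + E)"
proof -
  have *: "(\<lambda>x. f x * g x) \<in> deg_le (D + E)" if f: "f \<in> monomials D" and g: "g \<in> deg_le E" for f g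
    using g unfolding deg_le_def[of E]
  proof (induction rule: cfun.span_induct_alt)
    case base
    show ?case using deg_le_const[of 0 "D + E"] by simp
  next
    case (step c h g)
    obtain \<alpha> where \<alpha>: "\<alpha> \<in> UNIV \<rightarrow>\<^sub>E {..D}" "f = (\<lambda>x. \<Prod>k\<in>UNIV. x $ k ^ \<alpha> k)"
      using f unfolding monomials_def by blast
    obtain \<beta> where \<beta>: "\<beta> \<in> UNIV \<rightarrow>\<^sub>E {..E}" "h = (\<lambda>x. \<Prod>k\<in>UNIV. x $ k ^ \<beta> k)"
      using step(1) unfolding monomials_def by blast
    from \<alpha> \<beta> have "(\<lambda>x. f x * h x) \<in> monomials (D + E)"
      unfolding monomials_def
      by (intro image_eqI[of _ _ "\<lambda>k. \<alpha> k + \<beta> k"])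
         (auto simp: fun_eq_iff power_add prod.distrib PiE_iff add_mono)
    then have "(\<lambda>x. c * (f x * h x) + f x * g x) \<in> deg_le (D + E)"
      using step(2) by (intro deg_le_add deg_le_scale) (auto simp: deg_le_def intro: cfun.span_base)
    then show ?case by (simp add: algebra_simps)
  qed
  show ?thesis
    using f unfolding deg_le_def[of D]
  proof (induction rule: cfun.span_induct_alt)
    case base
    show ?case using deg_le_const[of 0 "D + E"] by simp
  next
    case (step c h f)
    then have "(\<lambda>x. c * (h x * g x) + f x * g x) \<in> deg_le (D + E)"
      using * g by (intro deg_le_add deg_le_scale) auto
    then show ?case by (simp add: algebra_simps)
  qed
qed

lemma deg_le_prod:
  assumes "finite I" "\<And>i. i \<in> I \<Longrightarrow> f i \<in> deg_le D"
  shows "(\<lambda>x. \<Prod>i\<in>I. f i x) \<in> deg_le (card I * D)"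
  using assms
proof (induction I)
  case empty
  then show ?case using deg_le_const by simp
next
  case (insert i I)
  then show ?case using deg_le_mult[of "f i" D "\<lambda>x. \<Prod>i\<in>I. f i x" "card I * D"] by simp
qed

lemma polyfun_deg_le:
  assumes "polyfun f" shows "\<exists>D. f \<in> deg_le D"
  using assms
proof induction
  case (add f g)
  then obtain D E where "f \<in> deg_le D" "g \<in> deg_le E" by blast
  then have "f \<in> deg_le (max D E)" "g \<in> deg_le (max D E)"
    by (auto intro: deg_le_mono)
  then show ?case using deg_le_add by blast
qed (use deg_le_const deg_le_coord deg_le_mult in blast)+

lemma polyfun_common_deg_le:
  assumes "finite I" "\<And>i. i \<in> I \<Longrightarrow> polyfun (f i)"
  shows "\<exists>D. \<forall>i\<in>I. f i \<in> deg_le D"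
proof -
  obtain D where D: "\<And>i. i \<in> I \<Longrightarrow> f i \<in> deg_le (D i)"
    using bchoice[of I "\<lambda>i D. f i \<in> deg_le D"] polyfun_deg_le assms(2) by blast
  then have "f i \<in> deg_le (Max (D ` I))" if "i \<in> I" for i
    using deg_le_mono[OF D[OF that]] assms(1) that by simp
  then show ?thesis by blast
qed

text \<open>The products of the \<open>\<phi>\<^sup>a\<close> with \<open>G\<^sub>\<gamma> \<circ> F\<close>, where \<open>G\<^sub>\<gamma>\<close> are unnormalised Lagrange
  polynomials on the grid \<open>{0..s}\<^sup>k\<close>, outnumber the monomials of the degrees in which they live.\<close>

lemma polyfun_algebraic_relation:
  fixes F :: "complex ^ 'k \<Rightarrow> complex ^ 'k"
  assumes F: "\<And>k. polyfun (\<lambda>x. F x $ k)" and \<phi>: "polyfun \<phi>"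
  obtains s p where "\<And>a. polyfun (p a)" "\<exists>a\<le>s. \<exists>y. p a y \<noteq> 0"
    "\<And>x. (\<Sum>a\<le>s. p a (F x) * \<phi> x ^ a) = 0"
proof -
  let ?M = "CARD('k)"
  obtain e0 where e0: "\<And>k. (\<lambda>x. F x $ k) \<in> deg_le e0"
    using polyfun_common_deg_le[of UNIV "\<lambda>k x. F x $ k"] F by auto
  obtain e1 where e1: "\<phi> \<in> deg_le e1"
    using polyfun_deg_le[OF \<phi>] by blast
  define e where "e = max 1 (max e0 e1)"
  have e: "(\<lambda>x. F x $ k) \<in> deg_le e" "\<phi> \<in> deg_le e" "e \<ge> 1" for k
    using deg_le_mono[OF e0, of e] deg_le_mono[OF e1, of e] by (auto simp: e_def)
  \<comment> \<open>With \<open>M\<close> variables there are \<open>(s + 1)^(M + 1)\<close>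
    products, each of degree at most \<open>e * s + M * e * s = N * s\<close> in every variable,
    hence spanned by at most \<open>(N * s + 1)^M \<le> N^M * (s + 1)^M\<close> monomials; the
    estimate uses \<open>e \<ge> 1\<close>. For \<open>s = N^M\<close> this is
    \<open>s * (s + 1)^M\<close>, which is too few.\<close>
  define N where "N = e * (?M + 1)"
  define s where "s = N ^ ?M"
  define \<Gamma> where "\<Gamma> = ((UNIV :: 'k set) \<rightarrow>\<^sub>E {..s})"
  define G where "G \<gamma> y = (\<Prod>k\<in>UNIV. \<Prod>i\<in>{..s} - {\<gamma> k}. y $ k - of_nat i)" for \<gamma> :: "'k \<Rightarrow> nat" and y :: "complex ^ 'k"
  define \<psi> where "\<psi> b x = \<phi> x ^ fst b * G (snd b) (F x)" for b x
  have fin: "finite \<Gamma>"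
    unfolding \<Gamma>_def by (rule finite_PiE) auto
  have "\<psi> b \<in> deg_le (N * s)" if b: "b \<in> {..s} \<times> \<Gamma>" for b
  proof -
    have "(\<lambda>x. \<Prod>i\<in>{..s} - {snd b k}. F x $ k - of_nat i) \<in> deg_le (s * e)" for k
    proof -
      have "snd b k \<in> {..s}"
        using b unfolding \<Gamma>_def by (auto simp: PiE_iff)
      then have "card ({..s} - {snd b k}) = s" by simp
      moreover have "(\<lambda>x. F x $ k - of_nat i) \<in> deg_le e" for i
        using deg_le_add[OF e(1) deg_le_const[of "- of_nat i"]] by simp
      ultimately show ?thesis
        using deg_le_prod[of "{..s} - {snd b k}" "\<lambda>i x. F x $ k - of_nat i" e] by simp
    qed
    then have "(\<lambda>x. G (snd b) (F x)) \<in> deg_le (?M * (s * e))"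
      unfolding G_def
      using deg_le_prod[of UNIV "\<lambda>k x. \<Prod>i\<in>{..s} - {snd b k}. F x $ k - of_nat i" "s * e"] by simp
    moreover have "(\<lambda>x. \<phi> x ^ fst b) \<in> deg_le (fst b * e)"
      using deg_le_prod[of "{..<fst b}" "\<lambda>_. \<phi>" e] e(2) by simp
    ultimately have "\<psi> b \<in> deg_le (fst b * e + ?M * (s * e))"
      unfolding \<psi>_def using deg_le_mult by fast
    moreover have "fst b * e + ?M * (s * e) \<le> N * s"
    proof -
      have "fst b * e \<le> s * e" using b by auto
      then show ?thesis by (simp add: N_def algebra_simps)
    qed
    ultimately show ?thesis by (rule deg_le_mono)
  qed
  then have span: "\<psi> b \<in> cfun.span (monomials (N * s))" if "b \<in> {..s} \<times> \<Gamma>" for b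
    using that by (simp add: deg_le_def)
  have "card (monomials (N * s) :: (complex ^ 'k \<Rightarrow> complex) set) \<le> (N * s + 1) ^ ?M"
    by (rule card_monomials)
  also have "\<dots> \<le> (N * (s + 1)) ^ ?M"
    using e(3) by (intro power_mono) (auto simp: N_def)
  also have "\<dots> = s * (s + 1) ^ ?M"
    by (simp only: power_mult_distrib s_def)
  also have "\<dots> < (s + 1) * (s + 1) ^ ?M"
    by simp
  also have "\<dots> = card ({..s} \<times> \<Gamma>)"
    by (simp add: card_cartesian_product \<Gamma>_def card_PiE)
  finally have "card (monomials (N * s) :: (complex ^ 'k \<Rightarrow> complex) set) < card ({..s} \<times> \<Gamma>)" .
  then have "\<exists>\<kappa>. (\<exists>b\<in>{..s} \<times> \<Gamma>. \<kappa> b \<noteq> 0) \<and> (\<forall>x. (\<Sum>b\<in>{..s} \<times> \<Gamma>. \<kappa> b * \<psi> b x) = 0)"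
    using fin by (intro dependent_family[OF _ finite_monomials _ span]) simp_all
  then obtain \<kappa> b0 where b0: "b0 \<in> {..s} \<times> \<Gamma>" "\<kappa> b0 \<noteq> 0"
    and \<kappa>: "\<And>x. (\<Sum>b\<in>{..s} \<times> \<Gamma>. \<kappa> b * \<psi> b x) = 0"
    by (elim exE conjE bexE) blast
  define p where "p a y = (\<Sum>\<gamma>\<in>\<Gamma>. \<kappa> (a, \<gamma>) * G \<gamma> y)" for a y
  have G: "polyfun (G \<gamma>)" for \<gamma>
    unfolding G_def by (rule polyfun_prod, rule polyfun_prod, rule polyfun_diff_const, rule polyfun.coord)
  have "polyfun (p a)" for a
    unfolding p_def by (rule polyfun_sum, rule polyfun.mult, rule polyfun.const, rule G)
  moreover have "\<exists>a\<le>s. \<exists>y. p a y \<noteq> 0"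
  proof -
    obtain a \<gamma> where b0_eq: "b0 = (a, \<gamma>)" by fastforce
    then have \<gamma>: "\<gamma> \<in> \<Gamma>" and a: "a \<le> s" using b0 by auto
    \<comment> \<open>Evaluation at the grid point of the chosen index kills every other Lagrange
      polynomial, so the nonzero coefficient \<open>\<kappa> (a, \<gamma>)\<close> survives in
      \<open>p a y\<close>.\<close>
    define y where "y = (\<chi> k. (of_nat (\<gamma> k) :: complex))"
    have "G \<gamma>' y = 0" if \<gamma>': "\<gamma>' \<in> \<Gamma>" "\<gamma>' \<noteq> \<gamma>" for \<gamma>'
    proof -
      obtain k where "\<gamma>' k \<noteq> \<gamma> k" using \<gamma>'(2) by (auto simp: fun_eq_iff)
      moreover have "\<gamma> k \<in> {..s}" using \<gamma> by (auto simp: \<Gamma>_def PiE_iff)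
      ultimately have "(\<Prod>i\<in>{..s} - {\<gamma>' k}. y $ k - of_nat i) = 0"
        by (intro prod_zero) (auto simp: y_def intro!: bexI[of _ "\<gamma> k"])
      then show ?thesis
        unfolding G_def by (intro prod_zero) auto
    qed
    then have "p a y = \<kappa> (a, \<gamma>) * G \<gamma> y"
      unfolding p_def using fin \<gamma> by (subst sum.remove[of _ \<gamma>]) auto
    moreover have "G \<gamma> y \<noteq> 0"
      by (auto simp: G_def y_def)
    ultimately have "p a y \<noteq> 0"
      using b0(2) b0_eq by simp
    then show ?thesis
      using a by blast
  qed
  moreover have "(\<Sum>a\<le>s. p a (F x) * \<phi> x ^ a) = 0" for x
  proof -
    have "(\<Sum>a\<le>s. p a (F x) * \<phi> x ^ a) = (\<Sum>a\<le>s. \<Sum>\<gamma>\<in>\<Gamma>. \<kappa> (a, \<gamma>) * \<psi> (a, \<gamma>) x)"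
      by (simp add: p_def \<psi>_def sum_distrib_right sum_distrib_left mult_ac)
    also have "\<dots> = (\<Sum>b\<in>{..s} \<times> \<Gamma>. \<kappa> b * \<psi> b x)"
      by (simp add: sum.cartesian_product)
    finally show ?thesis using \<kappa> by simp
  qed
  ultimately show thesis by (rule that)
qed

text \<open>Cauchy's bound: for \<open>norm t > 1\<close> the lower terms are dominated by
  \<open>norm t ^ (s - 1)\<close>. It depends continuously on the coefficients while the leading one
  is nonzero, so it bounds preimages along convergent sequences of values.\<close>

lemma polynomial_root_bound:
  fixes c :: "nat \<Rightarrow> complex"
  assumes "(\<Sum>a\<le>s. c a * t ^ a) = 0" "c s \<noteq> 0"
  shows "norm t \<le> 1 + (\<Sum>a<s. norm (c a)) / norm (c s)"
proof (cases "norm t \<le> 1")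
  case True
  moreover have "0 \<le> (\<Sum>a<s. norm (c a)) / norm (c s)"
    by (intro divide_nonneg_nonneg sum_nonneg norm_ge_zero)
  ultimately show ?thesis by linarith
next
  case False
  have "s \<noteq> 0"
  proof
    assume "s = 0"
    with assms show False by simp
  qed
  then obtain r where s: "s = Suc r"
    using not0_implies_Suc by blast
  have "(\<Sum>a<s. c a * t ^ a) + c s * t ^ s = 0"
    using assms(1) by (simp flip: lessThan_Suc_atMost)
  then have "norm (c s * t ^ s) = norm (\<Sum>a<s. c a * t ^ a)"
    by (metis add.commute add_eq_0_iff norm_minus_cancel)
  then have "norm (c s) * norm t ^ s = norm (\<Sum>a<s. c a * t ^ a)"
    by (simp only: norm_mult norm_power)
  also have "\<dots> \<le> (\<Sum>a<s. norm (c a) * norm t ^ r)"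
  proof (rule sum_norm_le)
    fix a assume "a \<in> {..<s}"
    then have "norm t ^ a \<le> norm t ^ r"
      using False s by (intro power_increasing) auto
    then show "norm (c a * t ^ a) \<le> norm (c a) * norm t ^ r"
      unfolding norm_mult norm_power by (rule mult_left_mono) simp
  qed
  finally have "(norm (c s) * norm t) * norm t ^ r \<le> (\<Sum>a<s. norm (c a)) * norm t ^ r"
    unfolding s power_Suc sum_distrib_right by (simp only: mult.assoc)
  then have "norm (c s) * norm t \<le> (\<Sum>a<s. norm (c a))"
    by (rule mult_right_le_imp_le) (use False in \<open>intro zero_less_power, linarith\<close>)
  then have "norm t \<le> (\<Sum>a<s. norm (c a)) / norm (c s)"
    using assms(2) by (simp add: field_simps)
  then show ?thesis by simp
qed

lemma polyfun_nonzero_mult: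
  assumes "polyfun f" "polyfun g" "f y \<noteq> 0" "g z \<noteq> 0"
  shows "\<exists>x. f x * g x \<noteq> 0"
proof (rule ccontr)
  assume "\<not> (\<exists>x. f x * g x \<noteq> 0)"
  then have "g x = 0" if "x \<in> {x. f x \<noteq> 0}" for x
    using that by auto
  moreover have "open {x. f x \<noteq> 0}"
    by (intro open_Collect_neq polyfun_continuous assms continuous_on_const)
  ultimately have "g z = 0"
    using polyfun_zero_on_open[OF assms(2), of "{x. f x \<noteq> 0}" y] assms(3) by blast
  with assms(4) show False by simp
qed

lemma polyfun_nonzero_prod:
  assumes "finite I" "\<And>i. i \<in> I \<Longrightarrow> polyfun (f i)" "\<And>i. i \<in> I \<Longrightarrow> \<exists>y. f i y \<noteq> 0"
  shows "\<exists>x. (\<Prod>i\<in>I. f i x) \<noteq> 0"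
  using assms
proof (induction I)
  case (insert i I)
  then obtain x y where "(\<Prod>i\<in>I. f i x) \<noteq> 0" "f i y \<noteq> 0" by blast
  moreover have "polyfun (f i)" "polyfun (\<lambda>x. \<Prod>i\<in>I. f i x)"
    using insert.prems by (auto intro: polyfun_prod)
  ultimately show ?case
    using polyfun_nonzero_mult[of "f i" "\<lambda>x. \<Prod>i\<in>I. f i x" y x] insert.hyps by simp
qed simp

text \<open>Polynomiality matters: injective entire maps of \<open>\<complex>\<^sup>k\<close> (Fatou-Bieberbach maps) can omit open sets.
  Each coordinate function and the Jacobian are algebraic over the components of \<open>F\<close>; away from the zeros
  of the leading, respectively constant, coefficients this makes \<open>F\<close> proper, respectively open, so that
  its range meets a generic complex line in all but finitely many points.\<close>

theorem polynomial_map_dense_range: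
  fixes F :: "complex ^ 'k \<Rightarrow> complex ^ 'k"
  assumes F: "\<And>k. polyfun (\<lambda>x. F x $ k)" and F0: "(F has_derivative (\<lambda>h. h)) (at 0)"
  shows "closure (range F) = UNIV"
proof -
  have "\<exists>D. (\<forall>l. polyfun (D l)) \<and>
      (\<forall>x. ((\<lambda>x. F x $ k) has_derivative (\<lambda>h. \<Sum>l\<in>UNIV. D l x * h $ l)) (at x))" for k
    by (rule polyfun_has_derivative[OF F])
  then obtain D where D: "\<And>k l. polyfun (D k l)"
    and D': "\<And>k x. ((\<lambda>x. F x $ k) has_derivative (\<lambda>h. \<Sum>l\<in>UNIV. D k l x * h $ l)) (at x)"
    by metis
  define A where "A x = (\<chi> k l. D k l x)" for x
  have deriv: "(F has_derivative (*v) (A x)) (at x)" for x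
    by (rule has_derivative_vec) (use D' in \<open>simp add: A_def matrix_vector_mult_def\<close>)
  have cont: "continuous_on S F" for S
    by (intro continuous_at_imp_continuous_on ballI has_derivative_continuous[OF deriv])
  define J where "J x = det (A x)" for x
  have J: "polyfun J"
    unfolding J_def by (rule polyfun_det) (simp add: A_def D)
  have "(*v) (A 0) = (\<lambda>h. h)"
    by (rule has_derivative_unique[OF deriv F0])
  then have "A 0 = mat 1"
    by (simp add: matrix_eq fun_eq_iff)
  then have J0: "J 0 = 1"
    by (simp add: J_def)
  have openF: "F x \<in> interior (range F)" if "J x \<noteq> 0" for x
  proof -
    have "invertible (A x)"
      using that by (simp add: J_def invertible_det_nz)
    then obtain B where "A x ** B = mat 1"
      by (auto simp: invertible_def)
    then have "(*v) (A x) \<circ> (*v) B = id"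
      by (simp add: fun_eq_iff matrix_vector_mul_assoc)
    then show ?thesis
      using sussmann_open_mapping[OF open_UNIV cont UNIV_I deriv, of "(*v) B" x UNIV]
      by (simp add: matrix_vector_mul_bounded_linear)
  qed
  have rangeF: "F 0 \<in> interior (range F)"
    using openF J0 by simp
  have zero_on_range: "p y = 0" if "polyfun p" "\<And>x. p (F x) = 0" for p y
  proof (rule polyfun_zero_on_open[OF that(1) open_interior rangeF])
    fix x assume "x \<in> interior (range F)"
    then show "p x = 0"
      using that(2) interior_subset[of "range F"] by auto
  qed
  have "\<exists>s p. (\<forall>a. polyfun (p a)) \<and> (\<exists>y. p s y \<noteq> 0) \<and> (\<forall>x. (\<Sum>a\<le>s. p a (F x) * (x $ k) ^ a) = 0)" for k
  proof -
    obtain s p where p: "\<And>a. polyfun (p a)" "\<exists>a\<le>s. \<exists>y. p a y \<noteq> 0"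
      and rel: "\<And>x. (\<Sum>a\<le>s. p a (F x) * (x $ k) ^ a) = 0"
      by (rule polyfun_algebraic_relation[OF F polyfun.coord[of k]]) (rule that)
    \<comment> \<open>Top coefficients that vanish identically are cut off, so that the leading
      coefficient is a nonzero polynomial.\<close>
    define T where "T = {a. a \<le> s \<and> (\<exists>y. p a y \<noteq> 0)}"
    define t where "t = Max T"
    have T: "finite T" "T \<noteq> {}"
      using p(2) by (auto simp: T_def)
    then have t: "t \<le> s" "\<exists>y. p t y \<noteq> 0"
      using Max_in[of T] by (simp_all add: T_def t_def)
    have "p a y = 0" if "a \<le> s" "t < a" for a y
    proof -
      have "a \<notin> T"
        using Max_ge[OF T(1), of a] that(2) by (auto simp: t_def)
      then show ?thesis
        using that(1) by (simp add: T_def)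
    qed
    then have "(\<Sum>a\<le>t. p a (F x) * (x $ k) ^ a) = (\<Sum>a\<le>s. p a (F x) * (x $ k) ^ a)" for x
      using t by (intro sum.mono_neutral_left) auto
    then show ?thesis
      using p(1) t rel by auto
  qed
  then obtain s p where p: "\<And>k a. polyfun (p k a)" "\<And>k. \<exists>y. p k (s k) y \<noteq> 0"
    and p_rel: "\<And>k x. (\<Sum>a\<le>s k. p k a (F x) * (x $ k) ^ a) = 0"
    by metis
  \<comment> \<open>An algebraic substitute for Sard's theorem: the critical values lie in a proper
    hypersurface. In a relation for \<open>J\<close> of least degree the constant coefficient is not
    identically zero, since otherwise a factor \<open>J\<close> could be cancelled where
    \<open>J\<close> is nonzero and hence, by the identity principle, everywhere. At a critical
    point only the constant term remains.\<close>
  obtain r where r: "polyfun r" "\<exists>y. r y \<noteq> 0" "\<And>x. J x = 0 \<Longrightarrow> r (F x) = 0"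
  proof -
    define good where "good s \<longleftrightarrow> (\<exists>q. (\<forall>a. polyfun (q a)) \<and> (\<exists>a\<le>s. \<exists>y. q a y \<noteq> 0) \<and>
      (\<forall>x. (\<Sum>a\<le>s. q a (F x) * J x ^ a) = 0))" for s :: nat
    obtain s q where "\<And>a. polyfun (q a)" "\<exists>a\<le>s. \<exists>y. q a y \<noteq> 0"
      and "\<And>x. (\<Sum>a\<le>s. q a (F x) * J x ^ a) = 0"
      by (rule polyfun_algebraic_relation[OF F J]) (rule that)
    then have "\<exists>s. good s"
      unfolding good_def by blast
    then have least: "good (LEAST s. good s)" "\<And>t. good t \<Longrightarrow> (LEAST s. good s) \<le> t"
      by (auto intro: LeastI_ex Least_le)
    define s where "s = (LEAST s. good s)"
    obtain q where "(\<forall>a. polyfun (q a)) \<and> (\<exists>a\<le>s. \<exists>y. q a y \<noteq> 0) \<and>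
      (\<forall>x. (\<Sum>a\<le>s. q a (F x) * J x ^ a) = 0)"
      using least(1)[folded s_def] unfolding good_def by (elim exE) (rule that)
    then have q: "\<And>a. polyfun (q a)" "\<exists>a\<le>s. \<exists>y. q a y \<noteq> 0"
      and rel: "\<And>x. (\<Sum>a\<le>s. q a (F x) * J x ^ a) = 0"
      by simp_all
    have "\<exists>y. q 0 y \<noteq> 0"
    proof (rule ccontr)
      assume q0: "\<not> (\<exists>y. q 0 y \<noteq> 0)"
      then obtain t where s: "s = Suc t"
        using q(2) by (cases s) auto
      let ?g = "\<lambda>x. \<Sum>a\<le>t. q (Suc a) (F x) * J x ^ a"
      have g: "polyfun ?g"
        by (rule polyfun_sum, rule polyfun.mult)
           (rule polyfun_comp[OF q(1)], rule F, rule polyfun_power[OF J])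
      have Jg: "J x * ?g x = 0" for x
        using rel[of x] q0 unfolding s sum.atMost_Suc_shift by (simp add: sum_distrib_left algebra_simps)
      have "open {x. J x \<noteq> 0}"
        by (intro open_Collect_neq polyfun_continuous J continuous_on_const)
      then have "?g x = 0" for x
        by (rule polyfun_zero_on_open[OF g, of _ 0]) (use J0 Jg in auto)
      moreover have "\<exists>a\<le>t. \<exists>y. q (Suc a) y \<noteq> 0"
        using q(2) q0 s by (metis Suc_le_mono not0_implies_Suc)
      ultimately have "good t"
        unfolding good_def using q(1) by (intro exI[of _ "\<lambda>a. q (Suc a)"]) auto
      then show False
        using least(2)[of t] s s_def by simp
    qed
    moreover have "q 0 (F x) = 0" if "J x = 0" for x
      using rel[of x] that by (simp add: sum.atMost_shift)
    ultimately show ?thesis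
      using q(1) that by blast
  qed
  \<comment> \<open>Off the zero set of \<open>H\<close> the values of \<open>F\<close> are regular,
    and the coordinates of their preimages are locally bounded.\<close>
  define H where "H y = r y * (\<Prod>k\<in>UNIV. p k (s k) y)" for y
  have H: "polyfun H"
    unfolding H_def by (intro polyfun.mult polyfun_prod p r)
  have "\<exists>y. H y \<noteq> 0"
  proof -
    have "\<exists>y. (\<Prod>k\<in>UNIV. p k (s k) y) \<noteq> 0"
      by (rule polyfun_nonzero_prod) (auto intro: p)
    moreover have "polyfun (\<lambda>y. \<Prod>k\<in>UNIV. p k (s k) y)"
      by (intro polyfun_prod p)
    ultimately show ?thesis
      unfolding H_def using polyfun_nonzero_mult r(1,2) by blast
  qed
  then have "\<exists>y0 \<in> interior (range F). H y0 \<noteq> 0"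
    using polyfun_zero_on_open[OF H open_interior rangeF] by blast
  then obtain y0 where y0: "y0 \<in> range F" "H y0 \<noteq> 0"
    using interior_subset by blast
  show ?thesis
  proof (intro equalityI subset_UNIV subsetI)
    fix y1 :: "complex ^ 'k"
    \<comment> \<open>A complex line serves here because removing finitely many points leaves the
      complex plane connected. On the remaining set \<open>V\<close>, the parameters that hit the
      range form a set that is open by regularity, closed by boundedness of preimages, and contains
      0.\<close>
    define l where "l z = y0 + z *s (y1 - y0)" for z
    have l_cont: "continuous_on S l" for S
      unfolding l_def vector_scalar_mult_def by (intro continuous_intros)
    obtain h where h: "\<And>z. H (l z) = poly h z"
      unfolding l_def using polyfun_line[OF H] by metis
    have "h \<noteq> 0"
      using h[of 0] y0(2) by (auto simp: l_def)
    then have bad: "finite {z. poly h z = 0}"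
      by (rule poly_roots_finite)
    define V where "V = UNIV - {z. poly h z = 0}"
    have V: "connected V" "open V"
      unfolding V_def using bad by (auto intro!: connected_open_delete_finite finite_imp_closed)
    define Z where "Z = {z \<in> V. l z \<in> range F}"
    have "Z = V \<inter> l -` interior (range F)"
    proof -
      have "l z \<in> interior (range F)" if "z \<in> V" "l z = F x" for z x
      proof -
        have "H (F x) \<noteq> 0"
          using h[of z] that by (simp add: V_def)
        then have "J x \<noteq> 0"
          using r(3)[of x] by (auto simp: H_def)
        then show ?thesis
          using openF that(2) by simp
      qed
      then show ?thesis
        unfolding Z_def using interior_subset by blast
    qed
    moreover have "open (l -` interior (range F))"
      using l_cont[of UNIV] by (simp add: open_vimage)
    ultimately have "openin (top_of_set V) Z"
      by (simp add: openin_open_Int)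
    moreover have "z \<in> Z" if z: "z \<in> V" "z \<in> closure Z" for z
    proof -
      obtain \<zeta> where \<zeta>: "\<And>n. \<zeta> n \<in> Z" "\<zeta> \<longlonglongrightarrow> z"
        using z(2) unfolding closure_sequential by blast
      obtain x where x: "\<And>n. F (x n) = l (\<zeta> n)"
        using \<zeta>(1) unfolding Z_def image_def by simp metis
      have l_lim: "(\<lambda>n. l (\<zeta> n)) \<longlonglongrightarrow> l z"
        by (rule continuous_on_tendsto_compose[OF l_cont[of UNIV] \<zeta>(2)]) auto
      have nz: "p k (s k) (l z) \<noteq> 0" if "z \<in> V" for k z
      proof -
        have "H (l z) \<noteq> 0"
          using h[of z] that by (simp add: V_def)
        then show ?thesis
          by (simp add: H_def)
      qed
      have "\<exists>K. \<forall>n. norm (x n $ k) \<le> K" for k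
      proof -
        have p_lim: "(\<lambda>n. p k a (l (\<zeta> n))) \<longlonglongrightarrow> p k a (l z)" for a
          by (rule continuous_on_tendsto_compose[OF polyfun_continuous[OF p(1), of UNIV] l_lim]) auto
        let ?b = "\<lambda>n. 1 + (\<Sum>a<s k. norm (p k a (l (\<zeta> n)))) / norm (p k (s k) (l (\<zeta> n)))"
        have "?b \<longlonglongrightarrow> 1 + (\<Sum>a<s k. norm (p k a (l z))) / norm (p k (s k) (l z))"
          by (intro tendsto_intros p_lim) (simp add: nz[OF z(1)])
        then have "Bseq ?b"
          by (intro convergent_imp_Bseq convergentI)
        then obtain K where K: "\<forall>n. norm (?b n) \<le> K"
          by (rule BseqE)
        have "norm (x n $ k) \<le> K" for n
        proof -
          have "norm (x n $ k) \<le> ?b n"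
            using polynomial_root_bound[OF p_rel[of k "x n"]] nz[of "\<zeta> n"] \<zeta>(1) by (auto simp: x Z_def)
          also have "\<dots> \<le> norm (?b n)" by simp
          also have "\<dots> \<le> K" using K ..
          finally show ?thesis .
        qed
        then show ?thesis by blast
      qed
      then obtain K where K: "\<And>k n. norm (x n $ k) \<le> K k"
        by metis
      have "norm (x n) \<le> (\<Sum>k\<in>UNIV. K k)" for n
        unfolding norm_vec_def by (rule order_trans[OF L2_set_le_sum]) (auto intro: sum_mono K)
      then have "bounded (range x)"
        by (auto simp: bounded_iff)
      then obtain \<xi> \<sigma> where \<sigma>: "strict_mono \<sigma>" "(x \<circ> \<sigma>) \<longlonglongrightarrow> \<xi>"
        using bounded_imp_convergent_subsequence by blast
      have "(\<lambda>n. F ((x \<circ> \<sigma>) n)) \<longlonglongrightarrow> F \<xi>"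
        by (rule continuous_on_tendsto_compose[OF cont[of UNIV] \<sigma>(2)]) auto
      moreover have "(\<lambda>n. F ((x \<circ> \<sigma>) n)) \<longlonglongrightarrow> l z"
        using LIMSEQ_subseq_LIMSEQ[OF l_lim \<sigma>(1)] by (simp add: x o_def)
      ultimately have "l z = F \<xi>"
        by (metis LIMSEQ_unique)
      then show "z \<in> Z"
        using z(1) by (auto simp: Z_def)
    qed
    then have "Z = V \<inter> closure Z"
      using closure_subset[of Z] by (auto simp: Z_def)
    then have "closedin (top_of_set V) Z"
      by (metis closed_closure closedin_closed_Int)
    moreover have "0 \<in> Z"
      using y0 h[of 0] by (simp add: Z_def V_def l_def)
    ultimately have "Z = V"
      using V(1) unfolding connected_clopen by blast
    \<comment> \<open>The parameter 1 of the target \<open>y1\<close> may itself be a root of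
      \<open>h\<close>, so \<open>y1\<close> is reached only as a limit.\<close>
    have "closure V = UNIV"
    proof -
      have "interior {z. poly h z = 0} = {}"
        using bad by (rule empty_interior_finite)
      then show ?thesis
        unfolding V_def by (simp add: Compl_eq_Diff_UNIV[symmetric] closure_complement)
    qed
    then have "1 \<in> closure V" by simp
    then have "l 1 \<in> closure (l ` V)"
      by (metis image_closure_subset l_cont closure_subset closed_closure image_eqI subsetD)
    also have "\<dots> \<subseteq> closure (range F)"
      using \<open>Z = V\<close> by (intro closure_mono) (auto simp: Z_def)
    finally show "y1 \<in> closure (range F)"
      by (simp add: l_def)
  qed
qed

section \<open>Complex matrices\<close>

definition adj :: "complex ^ 'n ^ 'm \<Rightarrow> complex ^ 'm ^ 'n"
  where "adj A = (\<chi> i j. cnj (A $ j $ i))"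

definition unitary :: "complex ^ 'n ^ 'n \<Rightarrow> bool"
  where "unitary U \<longleftrightarrow> adj U ** U = mat 1"

definition hproj :: "complex ^ 'n ^ 'n \<Rightarrow> bool"
  where "hproj P \<longleftrightarrow> adj P = P \<and> P ** P = P"

definition diagm :: "('n \<Rightarrow> complex) \<Rightarrow> complex ^ 'n ^ 'n"
  where "diagm l = (\<chi> i j. if i = j then l i else 0)"

text \<open>Through the interpretation \<open>mm\<close> this one fact supplies distributivity and
  scaling laws as well as limits and derivatives of matrix products.\<close>

lemma bounded_bilinear_matrix_mult:
  "bounded_bilinear ((**) :: complex ^ 'n ^ 'm \<Rightarrow> complex ^ 'k ^ 'n \<Rightarrow> complex ^ 'k ^ 'm)"
  unfolding bilinear_conv_bounded_bilinear[symmetric] bilinear_def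
proof (intro conjI allI linearI)
  fix A A' :: "complex ^ 'n ^ 'm" and B B' :: "complex ^ 'k ^ 'n" and r :: real
  show "A ** (B + B') = A ** B + A ** B'" "(A + A') ** B = A ** B + A' ** B"
    by (simp_all add: vec_eq_iff matrix_matrix_mult_def distrib_left distrib_right sum.distrib)
  show "A ** (r *\<^sub>R B) = r *\<^sub>R (A ** B)" "(r *\<^sub>R A) ** B = r *\<^sub>R (A ** B)"
    by (simp_all add: vec_eq_iff matrix_matrix_mult_def scaleR_sum_right)
qed

interpretation mm: bounded_bilinear "(**) :: complex ^ 'n ^ 'm \<Rightarrow> complex ^ 'k ^ 'n \<Rightarrow> complex ^ 'k ^ 'm"
  by (rule bounded_bilinear_matrix_mult)

lemma linear_adj: "linear adj"
  by (rule linearI) (simp_all add: adj_def vec_eq_iff)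

lemmas adj_add = linear_add[OF linear_adj]
  and adj_diff = linear_diff[OF linear_adj]
  and adj_scaleR = linear_cmul[OF linear_adj]
  and adj_sum = linear_sum[OF linear_adj]
  and adj_zero [simp] = linear_0[OF linear_adj]

lemmas tendsto_adj = bounded_linear.tendsto[OF linear_adj[unfolded linear_conv_bounded_linear]]

lemma adj_adj [simp]: "adj (adj A) = A"
  by (simp add: adj_def vec_eq_iff)

lemma adj_mult: "adj (A ** B) = adj B ** adj A"
  by (simp add: adj_def vec_eq_iff matrix_matrix_mult_def mult.commute)

lemma adj_mat [simp]: "adj (mat 1) = mat 1"
  by (auto simp: adj_def vec_eq_iff mat_def)

lemma cinner_adj: "cinner (A *v x) y = cinner x (adj A *v y)"
  unfolding cinner_def adj_def matrix_vector_mult_def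
  by (simp add: sum_distrib_left sum_distrib_right cnj_sum algebra_simps) (rule sum.swap)

lemma inner_adj: "(A *v x) \<bullet> y = x \<bullet> (adj A *v y)" for A :: "complex ^ 'n ^ 'm"
  by (metis Re_cinner cinner_adj)

lemma matrix_vector_mul_scaleR: "A *v (r *\<^sub>R x) = r *\<^sub>R (A *v x)" for A :: "complex ^ 'n ^ 'm"
  by (simp add: vec_eq_iff matrix_vector_mult_def scaleR_sum_right)

lemma trace_add: "trace (A + B) = trace A + trace B"
  by (simp add: trace_def sum.distrib)

lemma trace_scaleR: "trace (r *\<^sub>R A) = r *\<^sub>R trace A" for A :: "complex ^ 'n ^ 'n"
  by (simp add: trace_def scaleR_sum_right)

lemma trace_sum: "trace (\<Sum>i\<in>I. A i) = (\<Sum>i\<in>I. trace (A i))" for A :: "_ \<Rightarrow> complex ^ 'n ^ 'n"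
  by (induction I rule: infinite_finite_induct) (simp_all add: trace_add, simp_all add: trace_def)

text \<open>The componentwise inner product is the real part of the Hilbert-Schmidt product, so
  \<open>norm\<close> on matrices is the Frobenius norm throughout.\<close>

lemma inner_matrix: "A \<bullet> B = Re (trace (A ** adj B))" for A :: "complex ^ 'n ^ 'm"
  by (simp add: inner_vec_def trace_def matrix_matrix_mult_def adj_def inner_complex_def)

lemma inner_mult_left: "(A ** X) \<bullet> Y = X \<bullet> (adj A ** Y)" for X :: "complex ^ 'n ^ 'm"
  using trace_mul_sym[of A "X ** adj Y"] by (simp add: inner_matrix adj_mult matrix_mul_assoc)

lemma inner_mult_right: "(X ** A) \<bullet> Y = X \<bullet> (Y ** adj A)" for X :: "complex ^ 'n ^ 'm"
  by (simp add: inner_matrix adj_mult matrix_mul_assoc)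

lemma inner_adj_adj: "adj X \<bullet> adj Y = X \<bullet> Y" for X :: "complex ^ 'n ^ 'm"
  by (simp add: adj_def inner_vec_def inner_complex_def) (rule sum.swap)

lemma unitary_simps:
  assumes "unitary U" shows "adj U ** U = mat 1" "U ** adj U = mat 1"
    "adj U ** (U ** X) = X" "U ** (adj U ** X) = X"
  using assms matrix_left_right_inverse[of U "adj U"]
  by (simp_all add: unitary_def matrix_mul_assoc)

lemma unitary_adj: "unitary U \<Longrightarrow> unitary (adj U)"
  using unitary_simps(2) by (simp add: unitary_def)

lemma unitary_mult: "unitary U \<Longrightarrow> unitary V \<Longrightarrow> unitary (U ** V)"
  by (simp add: unitary_def adj_mult matrix_mul_assoc[symmetric] unitary_simps)

lemma inner_unitary_conj: "unitary U \<Longrightarrow> (U ** X ** adj U) \<bullet> (U ** Y ** adj U) = X \<bullet> Y"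
proof -
  assume U: "unitary U"
  have "(U ** X ** adj U) \<bullet> (U ** Y ** adj U) = (U ** X) \<bullet> (U ** Y)"
    unfolding inner_mult_right[of "U ** X" "adj U"] by (simp add: matrix_mul_assoc[symmetric] unitary_simps[OF U])
  also have "\<dots> = X \<bullet> Y"
    unfolding inner_mult_left[of U X] by (simp add: unitary_simps[OF U])
  finally show ?thesis .
qed

lemma norm_unitary_conj: "unitary U \<Longrightarrow> norm (U ** X ** adj U) = norm X"
  by (simp add: norm_eq_sqrt_inner inner_unitary_conj)

lemma hproj_simps:
  assumes "hproj P" shows "adj P = P" "P ** P = P" "P ** (P ** X) = P ** X"
  using assms by (simp_all add: hproj_def matrix_mul_assoc)

lemma hproj_unitary_conj: "unitary U \<Longrightarrow> hproj P \<Longrightarrow> hproj (U ** P ** adj U)"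
proof -
  assume U: "unitary U" and P: "hproj P"
  show ?thesis
    unfolding hproj_def
    by (simp add: adj_mult matrix_mul_assoc[symmetric] unitary_simps[OF U] hproj_simps[OF P])
qed

lemma trace_unitary_conj: "unitary U \<Longrightarrow> trace (U ** P ** adj U) = trace P"
  using trace_mul_sym[of "U ** P" "adj U"] by (simp add: matrix_mul_assoc[symmetric] unitary_simps)

lemma hproj_compl: "hproj P \<Longrightarrow> hproj (mat 1 - P)"
  by (simp add: hproj_def mm.diff_left mm.diff_right adj_diff)

lemma orthonormal_unitary:
  fixes u :: "'n \<Rightarrow> complex ^ 'n"
  assumes "\<And>k l. cinner (u k) (u l) = (if k = l then 1 else 0)"
  shows "unitary (\<chi> i k. u k $ i)"
proof -
  have "(\<Sum>i\<in>UNIV. cnj (u k $ i) * u l $ i) = (if k = l then 1 else 0)" for k l :: 'n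
    using assms[of l k] by (simp add: cinner_def mult.commute eq_commute)
  then show ?thesis
    by (simp add: unitary_def adj_def matrix_matrix_mult_def vec_eq_iff mat_def)
qed

section \<open>The spectral theorem\<close>

lemma cinner_diff_right: "cinner x (y - z) = cinner x y - cinner x z"
  by (simp add: cinner_def algebra_simps sum_subtractf)

lemma cinner_commute: "cinner y x = cnj (cinner x y)"
  by (simp add: cinner_def cnj_sum mult.commute)

lemma cinner_scaleR_right: "cinner x (r *\<^sub>R y) = r *\<^sub>R cinner x y"
  by (simp add: cinner_def scaleR_sum_right)

lemma cinner_self: "cinner x x = of_real ((norm x)\<^sup>2)"
  by (simp add: complex_eq_iff Re_cinner power2_norm_eq_inner) (simp add: cinner_def)

text \<open>A maximiser of the Rayleigh quotient on an invariant subspace is an eigenvector.\<close>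

lemma hermitian_eigenvector:
  fixes S :: "complex ^ 'n ^ 'n"
  assumes S: "adj S = S" and V: "vec.subspace V" "\<And>x. x \<in> V \<Longrightarrow> S *v x \<in> V" and x0: "x0 \<in> V" "x0 \<noteq> 0"
  shows "\<exists>v\<in>V. \<exists>\<mu>::real. norm v = 1 \<and> S *v v = \<mu> *\<^sub>R v"
proof -
  have V_real: "subspace V" by (rule vec_subspace_imp_subspace[OF V(1)])
  have symm: "(S *v x) \<bullet> y = x \<bullet> (S *v y)" for x y
    using inner_adj[of S x y] S by simp
  let ?K = "V \<inter> sphere 0 1"
  have "compact ?K"
    by (intro closed_Int_compact closed_subspace V_real compact_sphere)
  moreover have "?K \<noteq> {}"
  proof -
    have "x0 /\<^sub>R norm x0 \<in> ?K"
      using x0 subspace_scale[OF V_real] by auto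
    then show ?thesis by blast
  qed
  moreover have "continuous_on ?K (\<lambda>x. x \<bullet> (S *v x))"
    by (intro continuous_intros matrix_vector_mult_linear_continuous_on)
  ultimately obtain v where "v \<in> ?K" and "\<forall>y\<in>?K. y \<bullet> (S *v y) \<le> v \<bullet> (S *v v)"
    using continuous_attains_sup by blast
  then have v: "v \<in> V" "norm v = 1"
    and max: "\<And>y. y \<in> V \<Longrightarrow> norm y = 1 \<Longrightarrow> y \<bullet> (S *v y) \<le> v \<bullet> (S *v v)"
    by simp_all
  define \<mu> where "\<mu> = v \<bullet> (S *v v)"
  have max': "y \<bullet> (S *v y) \<le> \<mu> * (y \<bullet> y)" if "y \<in> V" for y
  proof (cases "y = 0")
    case False
    have "(y /\<^sub>R norm y) \<bullet> (S *v (y /\<^sub>R norm y)) \<le> \<mu>"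
      unfolding \<mu>_def using that False by (intro max subspace_scale[OF V_real]) auto
    moreover have "(y /\<^sub>R norm y) \<bullet> (S *v (y /\<^sub>R norm y)) = (y \<bullet> (S *v y)) / (y \<bullet> y)"
      by (simp add: matrix_vector_mul_scaleR dot_square_norm power2_eq_square divide_inverse)
    moreover have "y \<bullet> y > 0" using False by simp
    ultimately show ?thesis
      by (simp add: pos_divide_le_eq)
  qed simp
  \<comment> \<open>The defect of the eigenvalue equation lies in \<open>V\<close> and is orthogonal
    to \<open>v\<close>. Moving from \<open>v\<close> towards \<open>w\<close> raises the quadratic
    form at first order, while the norm changes only at second order.\<close>
  define w where "w = S *v v - \<mu> *\<^sub>R v"
  have wV: "w \<in> V"
    unfolding w_def using V v by (intro subspace_diff subspace_scale V_real) auto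
  have vv: "v \<bullet> v = 1"
    using v(2) by (simp add: norm_eq_1)
  have wv: "w \<bullet> v = 0"
    by (simp add: w_def inner_diff_left \<mu>_def vv inner_commute[of "S *v v" v])
  have wSv: "w \<bullet> (S *v v) = w \<bullet> w"
    using wv by (simp add: w_def inner_diff_right inner_diff_left)
  have vSw: "v \<bullet> (S *v w) = w \<bullet> w"
    using symm[of v w] wSv by (simp add: inner_commute)
  have ineq: "2 * t * (w \<bullet> w) \<le> t\<^sup>2 * (\<mu> * (w \<bullet> w) - w \<bullet> (S *v w))" for t :: real
  proof -
    have "v + t *\<^sub>R w \<in> V"
      using v wV by (intro subspace_add subspace_scale V_real)
    moreover have "(v + t *\<^sub>R w) \<bullet> (S *v (v + t *\<^sub>R w)) = \<mu> + 2 * t * (w \<bullet> w) + t\<^sup>2 * (w \<bullet> (S *v w))"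
      using wSv vSw
      by (simp add: matrix_vector_right_distrib matrix_vector_mul_scaleR inner_add_left inner_add_right
          \<mu>_def power2_eq_square distrib_left mult.assoc)
    moreover have "(v + t *\<^sub>R w) \<bullet> (v + t *\<^sub>R w) = 1 + t\<^sup>2 * (w \<bullet> w)"
      using wv vv by (simp add: inner_add_left inner_add_right inner_commute[of v w] power2_eq_square)
    ultimately show ?thesis
      using max'[of "v + t *\<^sub>R w"] by (simp add: algebra_simps)
  qed
  have "w \<bullet> w \<le> 0"
  proof (rule ccontr)
    assume "\<not> w \<bullet> w \<le> 0"
    then have pos: "w \<bullet> w > 0" by linarith
    let ?c = "\<mu> * (w \<bullet> w) - w \<bullet> (S *v w)"
    \<comment> \<open>Small enough that the quadratic term is at most \<open>w \<bullet> w\<close>,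
      whereas the inequality demands \<open>2 * (w \<bullet> w)\<close>.\<close>
    define t where "t = (w \<bullet> w) / (\<bar>?c\<bar> + 1)"
    have t: "t > 0" "t * \<bar>?c\<bar> \<le> w \<bullet> w"
      using pos by (auto simp: t_def divide_simps mult_left_mono)
    have "2 * (w \<bullet> w) \<le> t * ?c"
      using ineq[of t] t(1) by (simp add: power2_eq_square mult.assoc)
    also have "\<dots> \<le> t * \<bar>?c\<bar>"
      using t(1) by (intro mult_left_mono) auto
    also have "\<dots> \<le> w \<bullet> w" by (rule t)
    finally show False using pos by simp
  qed
  then have "w = 0"
    using inner_ge_zero[of w] by (metis inner_eq_zero_iff order_antisym)
  then have "S *v v = \<mu> *\<^sub>R v"
    by (simp add: w_def)
  then show ?thesis
    using v by blast
qed

lemma exists_orthogonal: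
  fixes u :: "'n \<Rightarrow> complex ^ 'n"
  assumes "x \<notin> A"
  shows "\<exists>y. y \<noteq> 0 \<and> (\<forall>a\<in>A. cinner y (u a) = 0)"
proof -
  let ?W = "vec.span (u ` A)"
  have "vec.dim ?W \<le> card (u ` A)"
    by (simp add: vec.dim_le_card')
  also have "\<dots> \<le> card A"
    by (rule card_image_le) simp
  also have "\<dots> < CARD('n)"
    using assms by (intro psubset_card_mono) auto
  finally have "?W \<noteq> UNIV"
    by (metis less_irrefl vec_dim_card)
  then obtain z where z: "z \<notin> ?W" by blast
  obtain a where a: "a \<in> ?W" "\<And>y. y \<in> ?W \<Longrightarrow> cinner (z - a) y = 0"
    using orth_decomp_exists[of ?W z] by auto
  then show ?thesis
    using z by (intro exI[of _ "z - a"]) (auto intro: vec.span_base)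
qed

text \<open>Eigenvectors are collected by induction on a set of indices of type \<open>'n\<close>;
  the orthogonal complement of those already found is invariant because \<open>S\<close> is
  Hermitian. Indexed in this way, they are directly the columns of \<open>U\<close>.\<close>

theorem hermitian_spectral:
  fixes S :: "complex ^ 'n ^ 'n"
  assumes S: "adj S = S"
  obtains U \<mu> where "unitary U" "S = U ** diagm (\<lambda>i. of_real (\<mu> i)) ** adj U"
proof -
  define ok where "ok A u \<mu> \<longleftrightarrow> (\<forall>k\<in>A. \<forall>l\<in>A. cinner (u k) (u l) = (if k = l then 1 else 0)) \<and>
    (\<forall>k\<in>A. S *v u k = \<mu> k *\<^sub>R u k)" for A and u :: "'n \<Rightarrow> complex ^ 'n" and \<mu> :: "'n \<Rightarrow> real"
  have "\<exists>u \<mu>. ok A u \<mu>" for A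
    using finite[of A]
  proof (induction A)
    case empty
    show ?case by (simp add: ok_def)
  next
    case (insert x A)
    then obtain u \<mu> where "ok A u \<mu>" by blast
    then have u: "\<And>k l. k \<in> A \<Longrightarrow> l \<in> A \<Longrightarrow> cinner (u k) (u l) = (if k = l then 1 else 0)"
      and ev: "\<And>k. k \<in> A \<Longrightarrow> S *v u k = \<mu> k *\<^sub>R u k"
      by (simp_all add: ok_def)
    let ?V = "{y. \<forall>a\<in>A. cinner y (u a) = 0}"
    obtain y where y: "y \<in> ?V" "y \<noteq> 0"
      using exists_orthogonal[OF insert.hyps(2)] by blast
    have "vec.subspace ?V"
      by (auto simp: vec.subspace_def cinner_add_left cinner_scale_left) (simp add: cinner_def)
    moreover have "S *v y \<in> ?V" if "y \<in> ?V" for y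
      using that ev cinner_adj[of S y] S by (simp add: cinner_scaleR_right)
    ultimately obtain v \<nu> where v: "v \<in> ?V" "norm v = 1" "S *v v = (\<nu>::real) *\<^sub>R v"
      using hermitian_eigenvector[OF S _ _ y] by blast
    have "cinner v v = 1"
      using v(2) by (simp add: cinner_self)
    moreover have "cinner v (u a) = 0" "cinner (u a) v = 0" if "a \<in> A" for a
      using v(1) that cinner_commute[of "u a" v] by auto
    ultimately show ?case
      using insert.hyps u ev v(3)
      by (intro exI[of _ "u(x := v)"] exI[of _ "\<mu>(x := \<nu>)"]) (auto simp: ok_def)
  qed
  then obtain u \<mu> where "ok UNIV u \<mu>" by blast
  then have u: "\<And>k l. cinner (u k) (u l) = (if k = l then 1 else 0)"
    and ev: "\<And>k. S *v u k = \<mu> k *\<^sub>R u k"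
    by (simp_all add: ok_def)
  define U where "U = (\<chi> i k. u k $ i)"
  have U: "unitary U"
    unfolding U_def using u by (rule orthonormal_unitary)
  have "(S ** U) $ i $ k = (U ** diagm (\<lambda>i. of_real (\<mu> i))) $ i $ k" for i k
  proof -
    have "(S ** U) $ i $ k = (S *v u k) $ i"
      by (simp add: U_def matrix_matrix_mult_def matrix_vector_mult_def)
    also have "\<dots> = of_real (\<mu> k) * u k $ i"
      unfolding ev vector_scaleR_component by (rule scaleR_conv_of_real)
    also have "\<dots> = (U ** diagm (\<lambda>i. of_real (\<mu> i))) $ i $ k"
      by (simp add: U_def matrix_matrix_mult_def diagm_def if_distrib cong: if_cong)
    finally show ?thesis .
  qed
  then have "S ** U = U ** diagm (\<lambda>i. of_real (\<mu> i))"
    by (simp add: vec_eq_iff)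
  then have "S = U ** diagm (\<lambda>i. of_real (\<mu> i)) ** adj U"
    by (metis U matrix_mul_assoc matrix_mul_rid unitary_simps(2))
  with U show thesis
    by (rule that)
qed

lemma matrix_mult_column: "(A ** B) $ i $ k = (A *v (\<chi> j. B $ j $ k)) $ i"
  by (simp add: matrix_matrix_mult_def matrix_vector_mult_def)

lemma matrix_mult_axis: "(A *v axis k 1) $ i = A $ i $ k" for A :: "complex ^ 'n ^ 'm"
  by (simp add: matrix_vector_mult_def axis_def if_distrib cong: if_cong)

text \<open>The columns of \<open>g\<close> are orthogonalised in the order of decreasing
  \<open>\<mu>\<close>. Column \<open>l\<close> is orthogonal to the \<open>k\<close>-th new vector
  whenever \<open>l\<close> precedes \<open>k\<close>, so \<open>U ** g\<close> preserves the
  spectral flag.\<close>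

lemma Gram_Schmidt:
  fixes g :: "complex ^ 'n ^ 'n" and \<mu> :: "'n \<Rightarrow> real"
  assumes g: "invertible g"
  obtains U where "unitary U" "\<And>k l. (U ** g) $ k $ l \<noteq> 0 \<Longrightarrow> \<mu> l \<le> \<mu> k"
proof -
  obtain \<tau> :: "'n \<Rightarrow> nat" where \<tau>: "inj \<tau>"
    using finite_imp_inj_to_nat_seg[OF finite[of UNIV]] by blast
  \<comment> \<open>Equal values of \<open>\<mu>\<close> are separated by an injection into the
    naturals, which makes the order total.\<close>
  define lt where "lt l k \<longleftrightarrow> \<mu> l > \<mu> k \<or> (\<mu> l = \<mu> k \<and> \<tau> l < \<tau> k)" for l k
  have trans: "lt i k" if "lt i j" "lt j k" for i j k
    using that by (auto simp: lt_def)
  have total: "lt k l \<or> k = l \<or> lt l k" for k l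
    using injD[OF \<tau>, of k l] linorder_less_linear[of "\<tau> k" "\<tau> l"] linorder_less_linear[of "\<mu> k" "\<mu> l"]
    by (auto simp: lt_def)
  define e where "e l = (axis l 1 :: complex ^ 'n)" for l
  define V where "V k = vec.span ((\<lambda>l. g *v e l) ` {l. lt l k})" for k
  have V_mono: "V l \<subseteq> V k" if "lt l k" for k l
    unfolding V_def using that trans by (intro vec.span_mono image_mono) auto
  have eV: "g *v e l \<in> V k" if "lt l k" for k l
    unfolding V_def using that by (intro vec.span_base) auto
  have "\<exists>w. g *v e k - w \<in> V k \<and> (\<forall>y\<in>V k. cinner w y = 0)" for k
  proof -
    obtain a where "a \<in> V k" "\<forall>y\<in>V k. cinner (g *v e k - a) y = 0"
      using orth_decomp_exists[of "V k" "g *v e k"] by (auto simp: V_def)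
    then show ?thesis
      by (intro exI[of _ "g *v e k - a"]) simp
  qed
  then obtain w where w: "\<And>k. g *v e k - w k \<in> V k" "\<And>k y. y \<in> V k \<Longrightarrow> cinner (w k) y = 0"
    by metis
  have w0: "w k \<noteq> 0" for k
  proof
    assume "w k = 0"
    then have "g *v e k \<in> V k" using w(1)[of k] by simp
    also have "V k = (*v) g ` vec.span (e ` {l. lt l k})"
      unfolding V_def vec.linear_span_image[OF matrix_vector_mul_linear_gen, symmetric] by (simp only: image_image)
    finally obtain x where x: "x \<in> vec.span (e ` {l. lt l k})" "g *v e k = g *v x" by blast
    have "vec.subspace {x :: complex ^ 'n. x $ k = 0}"
      by (simp add: vec.subspace_def)
    moreover have "e ` {l. lt l k} \<subseteq> {x. x $ k = 0}"
      by (auto simp: e_def axis_def lt_def)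
    ultimately have "x $ k = 0"
      using x(1) vec.span_minimal by blast
    moreover have "e k = x"
    proof -
      obtain g' where "g' ** g = mat 1" using g by (auto simp: invertible_def)
      then show ?thesis
        by (metis matrix_vector_mul_assoc matrix_vector_mul_lid x(2))
    qed
    ultimately show False by (auto simp: e_def)
  qed
  define u where "u k = w k /\<^sub>R norm (w k)" for k
  have u_orth: "cinner (u k) y = 0" if "y \<in> V k" for k y
    using w(2)[OF that] by (simp add: u_def cinner_def scaleR_sum_right[symmetric])
  have uV: "u l \<in> V k" if "lt l k" for k l
  proof -
    have "g *v e l - (g *v e l - w l) \<in> vec.span ((\<lambda>l. g *v e l) ` {l. lt l k})"
      by (rule vec.span_diff) (use eV[OF that] w(1)[of l] V_mono[OF that] in \<open>auto simp: V_def\<close>)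
    then have "w l \<in> V k" by (simp add: V_def)
    then show ?thesis
      unfolding u_def V_def by (intro subspace_scale vec_subspace_imp_subspace vec.subspace_span)
  qed
  have "cinner (u k) (u l) = (if k = l then 1 else 0)" for k l
  proof -
    consider "k = l" | "lt l k" | "lt k l" using total by blast
    then show ?thesis
    proof cases
      case 1
      then show ?thesis using w0[of k] by (simp add: cinner_self u_def)
    next
      case 2
      then show ?thesis using u_orth[OF uV[OF 2]] by (auto simp: lt_def)
    next
      case 3
      then show ?thesis using u_orth[OF uV[OF 3]] cinner_commute[of "u k" "u l"] by (auto simp: lt_def)
    qed
  qed
  then have U: "unitary (adj (\<chi> i k. u k $ i))"
    by (intro unitary_adj orthonormal_unitary)
  moreover have "\<mu> l \<le> \<mu> k" if nz: "(adj (\<chi> i k. u k $ i) ** g) $ k $ l \<noteq> 0" for k l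
  proof -
    have "(adj (\<chi> i k. u k $ i) ** g) $ k $ l = cinner (g *v e l) (u k)"
      by (simp add: adj_def matrix_matrix_mult_def cinner_def e_def matrix_mult_axis mult.commute)
    then have "\<not> lt l k"
      using nz u_orth[OF eV] cinner_commute[of "g *v e l" "u k"] by auto
    then show ?thesis by (auto simp: lt_def)
  qed
  ultimately show thesis by (rule that)
qed

section \<open>Orthogonal projections as matrices\<close>

lemma range_matrix_subspace: "vec.subspace (range ((*v) A))" for A :: "complex ^ 'n ^ 'm"
  by (intro vec.linear_subspace_image matrix_vector_mul_linear_gen vec.subspace_UNIV)

lemma is_orth_proj_hproj:
  assumes W: "vec.subspace W" and P: "is_orth_proj W P"
  shows "hproj P" "range ((*v) P) = W"
proof -
  have P1: "P *v x \<in> W" and P2: "y \<in> W \<Longrightarrow> cinner (x - P *v x) y = 0" for x y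
    using P by (auto simp: is_orth_proj_def)
  have fix_W: "P *v x = x" if "x \<in> W" for x
    using orth_decomp_unique[OF W P1[of x] that, of x] P2 by (simp add: cinner_def)
  show "range ((*v) P) = W"
    using P1 fix_W by (metis (no_types, lifting) image_subset_iff rangeI subsetI subset_antisym)
  have "P ** P = P"
    unfolding matrix_eq matrix_vector_mul_assoc[symmetric] using fix_W P1 by simp
  moreover have "adj P = P"
  proof -
    have *: "cinner (P *v x) y = cinner (P *v x) (P *v y)" for x y
      using P2[of "P *v x" y] P1[of x] cinner_commute[of "y - P *v y" "P *v x"] by (simp add: cinner_diff_right)
    have **: "cinner x (P *v y) = cinner (P *v x) (P *v y)" for x y
      by (metis * cinner_commute)
    have "cinner x (adj P *v y - P *v y) = 0" for x y
      using *[of x y] **[of x y] by (simp add: cinner_diff_right cinner_adj[symmetric])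
    then show ?thesis
      unfolding matrix_eq using cinner_self_eq_0 by (metis eq_iff_diff_eq_0)
  qed
  ultimately show "hproj P" by (simp add: hproj_def)
qed

lemma hproj_orth_proj: "vec.subspace W \<Longrightarrow> hproj (orth_proj W)"
  by (rule is_orth_proj_hproj(1)[OF _ is_orth_proj_orth_proj])

lemma range_orth_proj: "vec.subspace W \<Longrightarrow> range ((*v) (orth_proj W)) = W"
  by (rule is_orth_proj_hproj(2)[OF _ is_orth_proj_orth_proj])

lemma orth_proj_range:
  assumes P: "hproj P" shows "orth_proj (range ((*v) P)) = P"
proof -
  have "cinner (x - P *v x) (P *v y) = 0" for x y
    using hproj_simps(1,2)[OF P] cinner_adj[of P "x - P *v x" y]
    by (simp add: matrix_vector_mult_diff_distrib matrix_vector_mul_assoc cinner_adj[symmetric]) (simp add: cinner_def)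
  then have "is_orth_proj (range ((*v) P)) P"
    by (auto simp: is_orth_proj_def)
  then show ?thesis
    using is_orth_proj_ex1[OF range_matrix_subspace] is_orth_proj_orth_proj[OF range_matrix_subspace] by blast
qed

text \<open>\<open>R ** X = X\<close> says that the range of \<open>X\<close> lies in that of
  \<open>R\<close>, and the factorisation \<open>R = X ** K\<close> gives the converse. Later
  arguments can then work with matrix equations in place of ranges.\<close>

lemma range_hproj_exists:
  fixes X :: "complex ^ 'n ^ 'n"
  obtains R K where "hproj R" "R ** X = X" "R = X ** K"
proof -
  define R where "R = orth_proj (range ((*v) X))"
  have R: "hproj R" "range ((*v) R) = range ((*v) X)"
    unfolding R_def by (simp_all add: hproj_orth_proj range_orth_proj range_matrix_subspace)
  have "R *v (X *v x) = X *v x" for x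
  proof -
    obtain y where "X *v x = R *v y" using R(2) by (metis rangeE rangeI)
    then show ?thesis
      using hproj_simps(2)[OF R(1)] by (simp add: matrix_vector_mul_assoc)
  qed
  then have "R ** X = X"
    by (simp add: matrix_eq matrix_vector_mul_assoc)
  moreover have "\<exists>y. R *v axis k 1 = X *v y" for k
    using R(2) by (metis rangeE rangeI)
  then obtain y where y: "\<And>k. R *v axis k 1 = X *v y k" by metis
  have "R $ i $ k = (X ** (\<chi> j k. y k $ j)) $ i $ k" for i k
    using arg_cong[OF y[of k], of "\<lambda>v. v $ i"]
    by (simp add: matrix_mult_column matrix_mult_axis)
  then have "R = X ** (\<chi> j k. y k $ j)"
    by (simp add: vec_eq_iff)
  ultimately show thesis
    using R(1) that by blast
qed

lemma inner_hproj: "hproj P \<Longrightarrow> P \<bullet> P = Re (trace P)"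
  by (simp add: inner_matrix hproj_def)

lemma hproj_eqI:
  assumes P: "hproj P" and Q: "hproj Q" and QP: "Q ** P = P" and tr: "trace P = trace Q"
  shows "P = Q"
proof -
  have "P \<bullet> Q = P \<bullet> P"
    using arg_cong[OF QP, of adj] hproj_simps[OF P] hproj_simps[OF Q] by (simp add: inner_matrix adj_mult)
  then have "(P - Q) \<bullet> (P - Q) = 0"
    using tr by (simp add: inner_diff_left inner_diff_right inner_commute[of Q P] inner_hproj P Q)
  then show ?thesis by simp
qed

text \<open>\<open>R\<close> projects onto the image under \<open>h\<close> of the range of
  \<open>P\<close>. The conjugate \<open>h' ** R ** h\<close> need not be Hermitian, but it has the
  same range as \<open>P\<close> and fixes it, and cyclicity of the trace does the rest.\<close>

lemma trace_hproj_transport: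
  assumes P: "hproj P" and h: "h' ** h = mat 1" "h ** h' = mat 1"
    and R: "hproj R" "R ** (h ** P) = h ** P" "R = h ** P ** K"
  shows "trace R = trace P"
proof -
  define R' where "R' = h' ** R ** h"
  have "R' ** P = h' ** (R ** (h ** P))"
    by (simp add: R'_def matrix_mul_assoc[symmetric])
  also have "\<dots> = (h' ** h) ** P"
    unfolding R(2) by (rule matrix_mul_assoc)
  finally have "R' ** P = P"
    by (simp add: h)
  have R'_eq: "R' = P ** (K ** h)"
    unfolding R'_def R(3) by (simp add: matrix_mul_assoc h)
  have "P ** R' = R'"
    unfolding R'_eq by (rule hproj_simps(3)[OF P])
  have "trace R = trace R'"
    using trace_mul_sym[of "h' ** R" h] by (simp add: R'_def matrix_mul_assoc h)
  also have "\<dots> = trace P"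
    using trace_mul_sym[of R' P] \<open>P ** R' = R'\<close> \<open>R' ** P = P\<close> by simp
  finally show ?thesis .
qed

lemma diagm_mult: "diagm a ** diagm b = diagm (\<lambda>i. a i * b i)"
  by (simp add: diagm_def matrix_matrix_mult_def vec_eq_iff mult_delta_left)

lemma trace_diagm: "trace (diagm a) = (\<Sum>i\<in>UNIV. a i)"
  by (simp add: diagm_def trace_def)

lemma hproj_spectral:
  assumes P: "hproj P"
  obtains U A where "unitary U" "P = U ** diagm (\<lambda>i. of_bool (i \<in> A)) ** adj U"
proof -
  obtain U \<mu> where U: "unitary U" and P_eq: "P = U ** diagm (\<lambda>i. of_real (\<mu> i)) ** adj U"
    by (rule hermitian_spectral[OF hproj_simps(1)[OF P]])
  let ?D = "diagm (\<lambda>i. complex_of_real (\<mu> i))"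
  have D: "?D = adj U ** P ** U"
    unfolding P_eq by (simp add: matrix_mul_assoc[symmetric] unitary_simps[OF U])
  have "?D ** ?D = adj U ** (P ** (P ** U))"
    unfolding D by (simp add: matrix_mul_assoc[symmetric] unitary_simps[OF U])
  also have "\<dots> = ?D"
    unfolding D by (simp add: hproj_simps[OF P] matrix_mul_assoc[symmetric])
  finally have "?D $ i $ i = (?D ** ?D) $ i $ i" for i
    by simp
  then have "of_real (\<mu> i) = (of_real (\<mu> i * \<mu> i) :: complex)" for i
    by (simp add: diagm_mult) (simp add: diagm_def)
  then have "\<mu> i = \<mu> i * \<mu> i" for i
    unfolding of_real_eq_iff .
  then have "\<mu> i = 0 \<or> \<mu> i = 1" for i
    by (metis mult_cancel_right2)
  then have "complex_of_real (\<mu> i) = of_bool (i \<in> {i. \<mu> i = 1})" for i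
    by (cases "\<mu> i = 1") auto
  then have "P = U ** diagm (\<lambda>i. of_bool (i \<in> {i. \<mu> i = 1})) ** adj U"
    unfolding P_eq by presburger
  with U show thesis
    by (rule that)
qed

text \<open>A projection is unitarily conjugate to a coordinate projection. Dimension constraints
  thereby become trace equations, which survive limits and conjugation.\<close>

lemma dim_range_hproj:
  fixes P :: "complex ^ 'n ^ 'n"
  assumes P: "hproj P"
  shows "of_nat (vec.dim (range ((*v) P))) = trace P"
proof -
  obtain U A where U: "unitary U" and P_eq: "P = U ** diagm (\<lambda>i. of_bool (i \<in> A)) ** adj U"
    by (rule hproj_spectral[OF P])
  let ?D = "diagm (\<lambda>i. of_bool (i \<in> A)) :: complex ^ 'n ^ 'n"
  have D: "(?D *v x) $ i = (if i \<in> A then x $ i else 0)" for x i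
    by (simp add: diagm_def matrix_vector_mult_def mult_delta_left)
  have "range ((*v) P) = (*v) U ` range ((*v) ?D)"
  proof -
    have "range ((*v) (adj U)) = UNIV"
      using unitary_simps(1)[OF U] by (metis matrix_vector_mul_assoc matrix_vector_mul_lid surjI)
    then have "(*v) U ` (*v) ?D ` range ((*v) (adj U)) = (*v) U ` range ((*v) ?D)"
      by simp
    then show ?thesis
      by (simp add: P_eq image_image matrix_vector_mul_assoc matrix_mul_assoc)
  qed
  also have "vec.dim \<dots> = vec.dim (range ((*v) ?D))"
  proof (rule vec.dim_image_eq)
    show "Vector_Spaces.linear (*s) (*s) ((*v) U)"
      by (rule matrix_vector_mul_linear_gen)
    have "inj ((*v) U)"
      using unitary_simps(1)[OF U] by (metis injI matrix_vector_mul_assoc matrix_vector_mul_lid)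
    then show "inj_on ((*v) U) (vec.span (range ((*v) ?D)))"
      by (rule inj_on_subset) simp
  qed
  also have "range ((*v) ?D) = {x. \<forall>i. i \<notin> A \<longrightarrow> x $ i = 0}"
  proof (intro equalityI subsetI)
    fix x :: "complex ^ 'n" assume "x \<in> {x. \<forall>i. i \<notin> A \<longrightarrow> x $ i = 0}"
    then have "?D *v x = x"
      by (simp add: vec_eq_iff D)
    then show "x \<in> range ((*v) ?D)"
      by (metis rangeI)
  qed (auto simp: D)
  also have "vec.dim \<dots> = card A"
    by (rule dim_substandard_cart)
  finally show ?thesis
    by (simp add: P_eq trace_unitary_conj[OF U] trace_diagm sum.If_cases of_bool_def)
qed

lemma hproj_unitary_equiv:
  assumes P: "hproj P" and Q: "hproj Q" and tr: "trace P = trace Q"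
  obtains h where "unitary h" "Q = h ** P ** adj h"
proof -
  obtain U A where U: "unitary U" and P_eq: "P = U ** diagm (\<lambda>i. of_bool (i \<in> A)) ** adj U"
    by (rule hproj_spectral[OF P])
  obtain V B where V: "unitary V" and Q_eq: "Q = V ** diagm (\<lambda>i. of_bool (i \<in> B)) ** adj V"
    by (rule hproj_spectral[OF Q])
  have "(of_nat (card A) :: complex) = of_nat (card B)"
    using tr by (simp add: P_eq Q_eq trace_unitary_conj U V trace_diagm of_bool_def sum.If_cases)
  then have "card A = card B"
    by (simp only: of_nat_eq_iff)
  moreover then have "card (- A) = card (- B)"
    by (simp add: Compl_eq_Diff_UNIV card_Diff_subset)
  ultimately obtain f1 f2 where f: "bij_betw f1 A B" "bij_betw f2 (- A) (- B)"
    using finite_same_card_bij[of A B] finite_same_card_bij[of "- A" "- B"] by auto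
  \<comment> \<open>A permutation of the indices carrying \<open>A\<close> to \<open>B\<close>; its
    permutation matrix \<open>M\<close> conjugates one coordinate projection into the other.\<close>
  define p where "p x = (if x \<in> A then f1 x else f2 x)" for x
  have pA: "bij_betw p A B"
    by (rule bij_betw_cong[THEN iffD2, OF _ f(1)]) (simp add: p_def)
  have pcA: "bij_betw p (- A) (- B)"
    by (rule bij_betw_cong[THEN iffD2, OF _ f(2)]) (simp add: p_def)
  have "bij_betw p (A \<union> - A) (B \<union> - B)"
    using pA pcA by (rule bij_betw_combine) simp
  then have p: "bij p" by simp
  have pB: "p x \<in> B \<longleftrightarrow> x \<in> A" for x
    using bij_betwE[OF pA] bij_betwE[OF pcA] by (cases "x \<in> A") auto
  define M where "M = (\<chi> i j. if i = p j then (1 :: complex) else 0)"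
  have cnj_if: "cnj (if b then 1 else 0) = (if b then 1 else 0)" for b
    by simp
  have "adj M ** M = mat 1"
    using bij_is_inj[OF p]
    by (auto simp: vec_eq_iff M_def adj_def matrix_matrix_mult_def mat_def cnj_if mult_delta_left inj_eq)
  then have M: "unitary M"
    by (simp add: unitary_def)
  have "diagm (\<lambda>i. of_bool (i \<in> B)) ** M = M ** diagm (\<lambda>i. of_bool (i \<in> A))"
    by (auto simp: vec_eq_iff M_def diagm_def matrix_matrix_mult_def mult_delta_left[of "_ = _" "of_bool _"]
        mult_delta_right pB)
  then have "diagm (\<lambda>i. of_bool (i \<in> B)) = M ** diagm (\<lambda>i. of_bool (i \<in> A)) ** adj M"
    by (metis M matrix_mul_assoc matrix_mul_rid unitary_simps(2))
  then have "Q = (V ** M ** adj U) ** P ** adj (V ** M ** adj U)"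
    by (simp add: Q_eq P_eq adj_mult matrix_mul_assoc[symmetric] unitary_simps U)
  moreover have "unitary (V ** M ** adj U)"
    by (intro unitary_mult unitary_adj U V M)
  ultimately show thesis using that by blast
qed

section \<open>First and second variation\<close>

lemma norm_le_entries:
  fixes M :: "complex ^ 'n ^ 'n"
  assumes "\<And>i k. norm (M $ i $ k) \<le> B"
  shows "norm M \<le> of_nat (CARD('n) * CARD('n)) * B"
proof -
  have "norm (M $ i) \<le> of_nat CARD('n) * B" for i
    unfolding norm_vec_def[of "M $ i"]
    by (intro order_trans[OF L2_set_le_sum]) (auto intro: sum_bounded_above assms)
  then show ?thesis
    unfolding norm_vec_def[of M]
    by (intro order_trans[OF L2_set_le_sum])
       (auto intro!: sum_bounded_above[where K = "of_nat CARD('n) * B", THEN order_trans])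
qed

lemma norm_le_card:
  fixes M :: "complex ^ 'n ^ 'n"
  assumes "\<And>x. norm (M *v x) \<le> norm x"
  shows "norm M \<le> of_nat (CARD('n) * CARD('n))"
proof -
  have "norm (M $ i $ k) \<le> 1" for i k
  proof -
    have "norm ((M *v axis k 1) $ i) \<le> norm (M *v axis k 1)"
      by (rule Finite_Cartesian_Product.norm_nth_le)
    also have "\<dots> \<le> norm (axis k (1::complex))"
      by (rule assms)
    finally show ?thesis by (simp add: matrix_mult_axis)
  qed
  from norm_le_entries[OF this] show ?thesis by simp
qed

lemma norm_matrix_vector_mult_le: "norm (M *v x) \<le> norm M * norm x" for M :: "complex ^ 'n ^ 'm"
proof -
  have "norm ((M *v x) $ i) \<le> norm (M $ i) * norm x" for i
  proof -
    have "norm ((M *v x) $ i) \<le> (\<Sum>j\<in>UNIV. norm (M $ i $ j) * norm (x $ j))"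
      by (simp add: matrix_vector_mult_def) (intro sum_norm_le, simp add: norm_mult)
    also have "\<dots> \<le> norm (M $ i) * norm x"
      using L2_set_mult_ineq[of "\<lambda>j. norm (M $ i $ j)" "\<lambda>j. norm (x $ j)" UNIV] by (simp add: norm_vec_def)
    finally show ?thesis .
  qed
  then have "norm (M *v x) \<le> L2_set (\<lambda>i. norm (M $ i) * norm x) UNIV"
    unfolding norm_vec_def[of "M *v x"] by (intro L2_set_mono) auto
  also have "\<dots> = norm M * norm x"
    by (simp add: L2_set_left_distrib[symmetric] norm_vec_def[of M])
  finally show ?thesis .
qed

text \<open>\<open>Q t\<close> is the orthogonal projection onto the graph of \<open>t A\<close> over the range of \<open>P\<close>.\<close>

lemma graph_curve:
  fixes P A :: "complex ^ 'n ^ 'n"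
  assumes P: "hproj P" and AP: "A ** P = A" and PA: "P ** A = 0"
  obtains Q R where "\<And>t. hproj (Q t)" "\<And>t. trace (Q t) = trace P"
    "\<And>t. Q t = P + t *\<^sub>R (A + adj A) + t\<^sup>2 *\<^sub>R R t"
    "(R \<longlongrightarrow> A ** adj A - adj A ** A) (at (0::real))"
proof -
  note [simp] = hproj_simps(1,2)[OF P]
  have PA': "P ** adj A = adj A" and AP': "adj A ** P = 0"
    using arg_cong[OF AP, of adj] arg_cong[OF PA, of adj] by (simp_all add: adj_mult)
  define D where "D = adj A ** A"
  have D: "adj D = D" "P ** D = D" "D ** P = D"
    by (simp_all add: D_def adj_mult matrix_mul_assoc PA') (simp add: matrix_mul_assoc[symmetric] AP)
  \<comment> \<open>\<open>P ** N t\<close> is the Gram matrix of the graph map \<open>H t\<close>;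
    \<open>N t\<close> completes it by the identity off the range of \<open>P\<close>, which makes
    it invertible. \<open>Q t\<close> is then the usual projection formula with the inverse Gram
    matrix in the middle.\<close>
  define N where "N t = mat 1 + t\<^sup>2 *\<^sub>R D" for t :: real
  have N_ge: "x \<bullet> x \<le> x \<bullet> (N t *v x)" for t x
  proof -
    have "x \<bullet> (D *v x) = (A *v x) \<bullet> (A *v x)"
      by (simp add: D_def inner_adj matrix_vector_mul_assoc[symmetric])
    moreover have "N t *v x = x + t\<^sup>2 *\<^sub>R (D *v x)"
      by (simp add: N_def matrix_vector_mult_add_rdistrib)
         (simp add: vec_eq_iff matrix_vector_mult_def scaleR_sum_right)
    ultimately show ?thesis
      by (simp add: inner_add_right)
  qed
  have "\<exists>B. B ** N t = mat 1" for t
    unfolding matrix_left_invertible_ker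
  proof (intro allI impI)
    fix x assume "N t *v x = 0"
    then have "x \<bullet> x \<le> 0" using N_ge[of x t] by simp
    then show "x = 0"
      using inner_ge_zero[of x] by (metis inner_eq_zero_iff order_antisym)
  qed
  then obtain M where MN: "\<And>t. M t ** N t = mat 1" by metis
  then have NM: "N t ** M t = mat 1" for t
    using matrix_left_right_inverse by blast
  have "adj (N t) = N t" for t
    by (simp add: N_def adj_add adj_scaleR D)
  then have "N t ** adj (M t) = mat 1" for t
    using arg_cong[OF MN[of t], of adj] by (simp add: adj_mult)
  then have M_adj: "adj (M t) = M t" for t
    by (metis MN matrix_mul_assoc matrix_mul_lid matrix_mul_rid)
  have PN: "P ** N t = N t ** P" for t
    by (simp add: N_def mm.add_left mm.add_right mm.scaleR_left mm.scaleR_right D)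
  have PM: "P ** M t = M t ** P" for t
    by (metis PN MN NM matrix_mul_assoc matrix_mul_lid matrix_mul_rid)
  have M_eq: "M t = mat 1 - t\<^sup>2 *\<^sub>R (D ** M t)" for t
    using NM[of t] by (simp add: N_def mm.add_left mm.scaleR_left algebra_simps)
  define H where "H t = P + t *\<^sub>R A" for t
  have adjH: "adj (H t) = P + t *\<^sub>R adj A" for t
    by (simp add: H_def adj_add adj_scaleR)
  have HP: "H t ** P = H t" for t
    by (simp add: H_def mm.add_left mm.scaleR_left AP)
  have HH: "adj (H t) ** H t = P ** N t" for t
    unfolding adjH by (simp add: H_def N_def mm.add_left mm.add_right mm.scaleR_left mm.scaleR_right PA AP' D
        D_def[symmetric] power2_eq_square)
  have HH': "H t ** adj (H t) = P + t *\<^sub>R (A + adj A) + t\<^sup>2 *\<^sub>R (A ** adj A)" for t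
    unfolding adjH by (simp add: H_def mm.add_left mm.add_right mm.scaleR_left mm.scaleR_right AP PA'
        power2_eq_square scaleR_add_right)
  define Q where "Q t = H t ** M t ** adj (H t)" for t
  define R where "R t = A ** adj A - H t ** D ** M t ** adj (H t)" for t
  have "hproj (Q t)" for t
  proof -
    have "Q t ** Q t = H t ** (M t ** (P ** N t) ** M t) ** adj (H t)"
      by (simp add: Q_def HH[symmetric] matrix_mul_assoc)
    also have "M t ** (P ** N t) ** M t = P ** M t"
      by (metis PM MN NM matrix_mul_assoc matrix_mul_rid)
    also have "H t ** (P ** M t) ** adj (H t) = Q t"
      by (simp add: Q_def matrix_mul_assoc HP)
    finally show ?thesis
      by (simp add: hproj_def) (simp add: Q_def adj_mult M_adj matrix_mul_assoc)
  qed
  moreover have "trace (Q t) = trace P" for t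
  proof -
    have "trace (Q t) = trace (adj (H t) ** (H t ** M t))"
      unfolding Q_def by (rule trace_mul_sym)
    also have "adj (H t) ** (H t ** M t) = P ** (N t ** M t)"
      by (simp add: matrix_mul_assoc HH)
    finally show ?thesis by (simp add: NM)
  qed
  moreover have "Q t = P + t *\<^sub>R (A + adj A) + t\<^sup>2 *\<^sub>R R t" for t
  proof -
    have "Q t = H t ** (mat 1 - t\<^sup>2 *\<^sub>R (D ** M t)) ** adj (H t)"
      unfolding Q_def using M_eq[of t] by simp
    also have "\<dots> = H t ** adj (H t) - t\<^sup>2 *\<^sub>R (H t ** D ** M t ** adj (H t))"
      by (simp add: mm.diff_left mm.diff_right mm.scaleR_left mm.scaleR_right matrix_mul_assoc)
    finally show ?thesis
      by (simp add: HH' R_def scaleR_diff_right)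
  qed
  moreover have "(R \<longlongrightarrow> A ** adj A - adj A ** A) (at 0)"
  proof -
    \<comment> \<open>\<open>N t\<close> is at least the identity, so its inverse is a contraction.
      The bound is uniform in \<open>t\<close>, which makes the correction vanish with
      \<open>t^2\<close>.\<close>
    have "norm (M t *v x) \<le> norm x" for t x
    proof -
      have "norm (M t *v x) * norm (M t *v x) \<le> (M t *v x) \<bullet> (N t *v (M t *v x))"
        using N_ge[of "M t *v x" t] by (simp add: power2_norm_eq_inner[symmetric] power2_eq_square)
      also have "\<dots> = (M t *v x) \<bullet> x"
        by (simp add: matrix_vector_mul_assoc NM)
      also have "\<dots> \<le> norm (M t *v x) * norm x"
        by (rule norm_cauchy_schwarz)
      finally show ?thesis
        by (cases "norm (M t *v x) = 0") auto
    qed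
    then have M_bound: "norm (M t) \<le> of_nat (CARD('n) * CARD('n))" for t
      by (rule norm_le_card)
    obtain K where K: "\<And>(a :: complex ^ 'n ^ 'n) (b :: complex ^ 'n ^ 'n). norm (a ** b) \<le> norm a * norm b * K" "K > 0"
      using mm.pos_bounded by blast
    let ?C = "norm D * of_nat (CARD('n) * CARD('n)) * K"
    have "((\<lambda>t. t\<^sup>2 *\<^sub>R (D ** M t)) \<longlongrightarrow> 0) (at 0)"
    proof (rule Lim_null_comparison)
      have "norm (D ** M t) \<le> ?C" for t
        using K(2) by (intro order_trans[OF K(1)] mult_right_mono mult_left_mono M_bound) auto
      then show "\<forall>\<^sub>F t in at 0. norm (t\<^sup>2 *\<^sub>R (D ** M t)) \<le> t\<^sup>2 * ?C"
        by (intro always_eventually allI) (simp add: mult_left_mono)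
      have "((\<lambda>t::real. t\<^sup>2 * ?C) \<longlongrightarrow> 0\<^sup>2 * ?C) (at 0)"
        by (intro tendsto_intros)
      then show "((\<lambda>t::real. t\<^sup>2 * ?C) \<longlongrightarrow> 0) (at 0)" by simp
    qed
    then have "((\<lambda>t. mat 1 - t\<^sup>2 *\<^sub>R (D ** M t)) \<longlongrightarrow> mat 1 - 0) (at 0)"
      by (intro tendsto_diff tendsto_const)
    then have M_lim: "(M \<longlongrightarrow> mat 1) (at 0)"
      using M_eq by (simp flip: M_eq)
    have "(H \<longlongrightarrow> P + 0 *\<^sub>R A) (at 0)"
      unfolding H_def by (intro tendsto_intros)
    then have H_lim: "(H \<longlongrightarrow> P) (at 0)" by simp
    have "(R \<longlongrightarrow> A ** adj A - P ** D ** mat 1 ** adj P) (at 0)"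
      unfolding R_def by (intro tendsto_diff tendsto_const mm.tendsto H_lim M_lim tendsto_adj)
    then show ?thesis
      by (simp add: D) (simp add: D_def)
  qed
  ultimately show thesis by (rule that)
qed

text \<open>First and second derivative tests for the squared norm, phrased through an expansion
  whose remainder \<open>R t\<close> merely converges.\<close>

lemma local_min_along_curve:
  fixes S L :: "'a :: euclidean_space"
  assumes min: "\<forall>\<^sub>F t in at 0. norm S \<le> norm (S + t *\<^sub>R L + t\<^sup>2 *\<^sub>R R t)" and R: "(R \<longlongrightarrow> R0) (at 0)"
  shows "S \<bullet> L = 0" "L = 0 \<Longrightarrow> S \<bullet> R0 \<ge> 0"
proof -
  \<comment> \<open>The squared norm changes by \<open>t * G t\<close>. Its nonnegativity on both
    sides of 0 forces the limit of \<open>G\<close> to vanish; for \<open>L = 0\<close> a further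
    factor \<open>t\<close> splits off.\<close>
  define G where "G t = 2 * (S \<bullet> L) + t * (2 * (S \<bullet> R t) + (L + t *\<^sub>R R t) \<bullet> (L + t *\<^sub>R R t))" for t
  have G: "(S + t *\<^sub>R L + t\<^sup>2 *\<^sub>R R t) \<bullet> (S + t *\<^sub>R L + t\<^sup>2 *\<^sub>R R t) = S \<bullet> S + t * G t" for t
  proof -
    define X where "X = L + t *\<^sub>R R t"
    have "S + t *\<^sub>R L + t\<^sup>2 *\<^sub>R R t = S + t *\<^sub>R X"
      by (simp add: X_def scaleR_add_right power2_eq_square)
    moreover have "(S + t *\<^sub>R X) \<bullet> (S + t *\<^sub>R X) = S \<bullet> S + t * (2 * (S \<bullet> X) + t * (X \<bullet> X))"
      by (simp add: inner_add_left inner_add_right inner_commute[of X S] algebra_simps)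
    moreover have "2 * (S \<bullet> X) + t * (X \<bullet> X) = G t"
      by (simp add: G_def X_def[symmetric] distrib_left) (simp add: X_def inner_add_right)
    ultimately show ?thesis by (simp only:)
  qed
  have ev: "\<forall>\<^sub>F t in at 0. 0 \<le> t * G t"
    using min
  proof eventually_elim
    case (elim t)
    then have "S \<bullet> S \<le> (S + t *\<^sub>R L + t\<^sup>2 *\<^sub>R R t) \<bullet> (S + t *\<^sub>R L + t\<^sup>2 *\<^sub>R R t)"
      by (simp add: norm_le)
    then show ?case unfolding G by simp
  qed
  have "(G \<longlongrightarrow> 2 * (S \<bullet> L) + 0 * (2 * (S \<bullet> R0) + (L + 0 *\<^sub>R R0) \<bullet> (L + 0 *\<^sub>R R0))) (at 0)"
    unfolding G_def by (intro tendsto_intros R)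
  then have G_lim: "(G \<longlongrightarrow> 2 * (S \<bullet> L)) (at 0)" by simp
  have "\<forall>\<^sub>F t in at_right 0. 0 \<le> t * G t" "\<forall>\<^sub>F t in at_left 0. 0 \<le> t * G t"
    using ev by (simp_all add: eventually_at_split)
  then have "\<forall>\<^sub>F t in at_right 0. 0 \<le> G t" "\<forall>\<^sub>F t in at_left 0. G t \<le> 0"
    by (auto simp: eventually_at_filter zero_le_mult_iff elim!: eventually_mono)
  moreover have "(G \<longlongrightarrow> 2 * (S \<bullet> L)) (at_right 0)" "(G \<longlongrightarrow> 2 * (S \<bullet> L)) (at_left 0)"
    using G_lim by (simp_all add: filterlim_at_split)
  ultimately have "0 \<le> 2 * (S \<bullet> L)" "2 * (S \<bullet> L) \<le> 0"
    using tendsto_lowerbound[of G "2 * (S \<bullet> L)" "at_right 0" 0] tendsto_upperbound[of G "2 * (S \<bullet> L)" "at_left 0" 0]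
    by simp_all
  then show "S \<bullet> L = 0" by simp
  assume L: "L = 0"
  have "((\<lambda>t. 2 * (S \<bullet> R t) + t\<^sup>2 * (R t \<bullet> R t)) \<longlongrightarrow> 2 * (S \<bullet> R0) + 0\<^sup>2 * (R0 \<bullet> R0)) (at 0)"
    by (intro tendsto_intros R)
  moreover have "\<forall>\<^sub>F t in at 0. 0 \<le> 2 * (S \<bullet> R t) + t\<^sup>2 * (R t \<bullet> R t)"
    using ev eventually_neq_at_within[of 0 0 UNIV]
  proof eventually_elim
    case (elim t)
    have "t * G t = t\<^sup>2 * (2 * (S \<bullet> R t) + t\<^sup>2 * (R t \<bullet> R t))"
      by (simp add: G_def L power2_eq_square)
    with elim show ?case
      by (simp add: zero_le_mult_iff)
  qed
  ultimately have "0 \<le> 2 * (S \<bullet> R0) + 0\<^sup>2 * (R0 \<bullet> R0)"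
    by (rule tendsto_lowerbound) simp
  then show "S \<bullet> R0 \<ge> 0" by simp
qed

text \<open>The coefficient \<open>c i\<close> is the squared weight, and \<open>P i\<close> the projection onto the \<open>i\<close>-th subspace.\<close>

definition fop :: "('m::finite \<Rightarrow> real) \<Rightarrow> ('m \<Rightarrow> complex ^ 'n ^ 'n) \<Rightarrow> complex ^ 'n ^ 'n"
  where "fop c P = (\<Sum>i\<in>UNIV. c i *\<^sub>R P i)"

definition config :: "('m::finite \<Rightarrow> nat) \<Rightarrow> ('m \<Rightarrow> real) \<Rightarrow> ('m \<Rightarrow> complex ^ 'n ^ 'n) \<Rightarrow> bool"
  where "config d c P \<longleftrightarrow> (\<forall>i. c i > 0 \<and> hproj (P i) \<and> trace (P i) = of_nat (d i)) \<and> (\<Sum>i\<in>UNIV. c i * d i) = 1"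

text \<open>Closeness is measured between frame operators only, in the Frobenius norm. Minimising
  this norm amounts to minimising the potential, its square.\<close>

definition loc_min :: "('m::finite \<Rightarrow> nat) \<Rightarrow> ('m \<Rightarrow> real) \<Rightarrow> ('m \<Rightarrow> complex ^ 'n ^ 'n) \<Rightarrow> bool"
  where "loc_min d c P \<longleftrightarrow> config d c P \<and>
    (\<exists>\<epsilon>>0. \<forall>c' P'. config d c' P' \<longrightarrow> norm (fop c P - fop c' P') < \<epsilon> \<longrightarrow> norm (fop c P) \<le> norm (fop c' P'))"

lemma configD:
  assumes "config d c P"
  shows "c i > 0" "hproj (P i)" "trace (P i) = of_nat (d i)" "(\<Sum>i\<in>UNIV. c i * d i) = 1"
  using assms by (simp_all add: config_def)

lemma loc_min_config: "loc_min d c P \<Longrightarrow> config d c P"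
  by (simp add: loc_min_def)

lemma fop_hermitian: "config d c P \<Longrightarrow> adj (fop c P) = fop c P"
  by (simp add: fop_def adj_sum adj_scaleR hproj_simps(1) configD(2))

lemma loc_min_along_curve:
  assumes min: "loc_min d c P"
    and conf: "\<forall>\<^sub>F t in at 0. config d (c' t) (P' t)"
    and eq: "\<And>t. fop (c' t) (P' t) = fop c P + t *\<^sub>R L + t\<^sup>2 *\<^sub>R R t"
    and R: "(R \<longlongrightarrow> R0) (at (0::real))"
  shows "fop c P \<bullet> L = 0" "L = 0 \<Longrightarrow> fop c P \<bullet> R0 \<ge> 0"
proof -
  obtain \<epsilon> where \<epsilon>: "\<epsilon> > 0"
    "\<And>c' P'. config d c' P' \<Longrightarrow> norm (fop c P - fop c' P') < \<epsilon> \<Longrightarrow> norm (fop c P) \<le> norm (fop c' P')"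
    using min unfolding loc_min_def by blast
  have "((\<lambda>t. fop (c' t) (P' t)) \<longlongrightarrow> fop c P + 0 *\<^sub>R L + 0\<^sup>2 *\<^sub>R R0) (at 0)"
    unfolding eq by (intro tendsto_intros R)
  then have "\<forall>\<^sub>F t in at 0. dist (fop (c' t) (P' t)) (fop c P) < \<epsilon>"
    using \<epsilon>(1) by (simp add: tendsto_iff)
  with conf have "\<forall>\<^sub>F t in at 0. norm (fop c P) \<le> norm (fop c P + t *\<^sub>R L + t\<^sup>2 *\<^sub>R R t)"
  proof eventually_elim
    case (elim t)
    then have "norm (fop c P - fop (c' t) (P' t)) < \<epsilon>"
      by (simp only: dist_norm norm_minus_commute)
    from \<epsilon>(2)[OF elim(1) this] show ?case
      by (simp only: eq)
  qed
  from local_min_along_curve[OF this R] show "fop c P \<bullet> L = 0" "L = 0 \<Longrightarrow> fop c P \<bullet> R0 \<ge> 0"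
    by auto
qed

text \<open>The weights are kept and all subspaces move along graphs simultaneously. The
  second-order condition is available when the first-order motions cancel in the frame operator
  itself.\<close>

lemma loc_min_graph_variation:
  assumes min: "loc_min d c P"
    and A: "\<And>i. A i ** P i = A i" "\<And>i. P i ** A i = 0"
  shows "fop c P \<bullet> (\<Sum>i\<in>UNIV. c i *\<^sub>R (A i + adj (A i))) = 0"
    and "(\<Sum>i\<in>UNIV. c i *\<^sub>R (A i + adj (A i))) = 0 \<Longrightarrow>
      fop c P \<bullet> (\<Sum>i\<in>UNIV. c i *\<^sub>R (A i ** adj (A i) - adj (A i) ** A i)) \<ge> 0"
proof -
  note conf = configD[OF loc_min_config[OF min]]
  have "\<exists>Q R. (\<forall>t. hproj (Q t) \<and> trace (Q t) = trace (P i) \<and>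
      Q t = P i + t *\<^sub>R (A i + adj (A i)) + t\<^sup>2 *\<^sub>R R t) \<and>
      (R \<longlongrightarrow> A i ** adj (A i) - adj (A i) ** A i) (at 0)" for i
    by (rule graph_curve[OF conf(2) A, of i]) blast
  then obtain Q R where Q: "\<And>i t. hproj (Q i t)" "\<And>i t. trace (Q i t) = trace (P i)"
    "\<And>i t. Q i t = P i + t *\<^sub>R (A i + adj (A i)) + t\<^sup>2 *\<^sub>R R i t"
    and R: "\<And>i. (R i \<longlongrightarrow> A i ** adj (A i) - adj (A i) ** A i) (at 0)"
    by metis
  have 1: "\<forall>\<^sub>F t in at 0. config d c (\<lambda>i. Q i t)"
    by (simp add: config_def Q(1,2) conf)
  have 2: "fop c (\<lambda>i. Q i t) = fop c P + t *\<^sub>R (\<Sum>i\<in>UNIV. c i *\<^sub>R (A i + adj (A i))) + t\<^sup>2 *\<^sub>R (\<Sum>i\<in>UNIV. c i *\<^sub>R R i t)" for t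
    unfolding fop_def Q(3)[of _ t] scaleR_add_right[of "c _"] sum.distrib scaleR_sum_right
    by (simp add: scaleR_add_right sum.distrib scaleR_sum_right mult.commute)
  have 3: "((\<lambda>t. \<Sum>i\<in>UNIV. c i *\<^sub>R R i t) \<longlongrightarrow> (\<Sum>i\<in>UNIV. c i *\<^sub>R (A i ** adj (A i) - adj (A i) ** A i))) (at 0)"
    by (intro tendsto_sum tendsto_scaleR tendsto_const R)
  show "fop c P \<bullet> (\<Sum>i\<in>UNIV. c i *\<^sub>R (A i + adj (A i))) = 0"
    by (rule loc_min_along_curve(1)[OF min 1 2 3])
  show "(\<Sum>i\<in>UNIV. c i *\<^sub>R (A i + adj (A i))) = 0 \<Longrightarrow>
      fop c P \<bullet> (\<Sum>i\<in>UNIV. c i *\<^sub>R (A i ** adj (A i) - adj (A i) ** A i)) \<ge> 0"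
    by (rule loc_min_along_curve(2)[OF min 1 2 3])
qed

text \<open>The offending block of \<open>S\<close> is itself an admissible direction for the
  \<open>i\<close>-th subspace, and the first derivative along it is a positive multiple of its
  squared norm.\<close>

lemma loc_min_invariant:
  assumes min: "loc_min d c P"
  shows "(mat 1 - P i) ** fop c P ** P i = 0"
proof -
  note conf = configD[OF loc_min_config[OF min]]
  let ?S = "fop c P" and ?B = "(mat 1 - P i) ** fop c P ** P i"
  note P = hproj_simps[OF conf(2)[of i]] and P' = hproj_simps[OF hproj_compl[OF conf(2)[of i]]]
  have S: "adj ?S = ?S"
    by (rule fop_hermitian[OF loc_min_config[OF min]])
  define A where "A j = (if j = i then ?B else 0)" for j
  have "A j ** P j = A j" "P j ** A j = 0" for j
    by (simp_all add: A_def matrix_mul_assoc[symmetric] mm.diff_left mm.diff_right hproj_simps[OF conf(2)])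
  then have "?S \<bullet> (\<Sum>j\<in>UNIV. c j *\<^sub>R (A j + adj (A j))) = 0"
    by (rule loc_min_graph_variation(1)[OF min])
  also have "(\<Sum>j\<in>UNIV. c j *\<^sub>R (A j + adj (A j))) = c i *\<^sub>R (?B + adj ?B)"
    by (subst sum.remove[of _ i]) (simp_all add: A_def)
  finally have "?S \<bullet> ?B + ?S \<bullet> adj ?B = 0"
    using conf(1)[of i] by (simp add: inner_add_right)
  moreover have "?S \<bullet> adj ?B = ?S \<bullet> ?B"
    using inner_adj_adj[of ?S ?B] S by simp
  moreover have "?B \<bullet> ?B = ?S \<bullet> ?B"
  proof -
    have "?B \<bullet> ?B = (?S ** P i) \<bullet> (adj (mat 1 - P i) ** ?B)"
      using inner_mult_left[of "mat 1 - P i" "?S ** P i" ?B] by (simp add: matrix_mul_assoc)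
    also have "adj (mat 1 - P i) ** ?B = ?B"
      using P' by (simp add: matrix_mul_assoc)
    also have "(?S ** P i) \<bullet> ?B = ?S \<bullet> (?B ** adj (P i))"
      by (rule inner_mult_right)
    also have "?B ** adj (P i) = ?B"
      using P by (simp add: matrix_mul_assoc[symmetric])
    finally show ?thesis .
  qed
  ultimately show ?thesis by simp
qed

lemma loc_min_commute:
  assumes min: "loc_min d c P"
  shows "fop c P ** P i = P i ** fop c P"
proof -
  note conf = configD[OF loc_min_config[OF min]]
  have "fop c P ** P i - P i ** (fop c P ** P i) = 0"
    using loc_min_invariant[OF min, of i] by (simp only: mm.diff_left matrix_mul_lid matrix_mul_assoc)
  then have 1: "fop c P ** P i = P i ** (fop c P ** P i)"
    by (rule eq_iff_diff_eq_0[THEN iffD2])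
  have "adj (fop c P ** P i) = adj (P i ** (fop c P ** P i))"
    by (rule arg_cong[OF 1])
  then have "P i ** fop c P = P i ** (fop c P ** P i)"
    by (simp add: adj_mult hproj_simps(1)[OF conf(2)] fop_hermitian[OF loc_min_config[OF min]] matrix_mul_assoc)
  with 1 show ?thesis by simp
qed

text \<open>Here the subspaces stay fixed and the squared weights move within the hyperplane of
  constant trace. This is the Lagrange condition, its multiplier being identified by pairing with
  \<open>c\<close>.\<close>

lemma loc_min_weights:
  assumes min: "loc_min d c P"
  shows "fop c P \<bullet> P i = (fop c P \<bullet> fop c P) * d i"
proof -
  note conf = configD[OF loc_min_config[OF min]]
  let ?S = "fop c P"
  define a where "a j = ?S \<bullet> P j" for j
  define s where "s = (\<Sum>j\<in>UNIV. (real (d j))\<^sup>2)"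
  \<comment> \<open>Chosen so that \<open>\<epsilon>\<close>, the part of \<open>a\<close>
    orthogonal to \<open>d\<close>, is tangent to the trace condition. The derivative along
    \<open>\<epsilon>\<close> is then a multiple of its squared length.\<close>
  define \<kappa> where "\<kappa> = (\<Sum>j\<in>UNIV. a j * d j) / s"
  define \<epsilon> where "\<epsilon> j = a j - \<kappa> * d j" for j
  have "\<exists>j. d j \<noteq> 0"
    using conf(4) by (metis (no_types, lifting) mult_eq_0_iff of_nat_0 sum.neutral zero_neq_one)
  then have "s > 0"
    unfolding s_def by (auto intro!: sum_pos2)
  have \<epsilon>d: "(\<Sum>j\<in>UNIV. \<epsilon> j * d j) = 0"
  proof -
    have "(\<Sum>j\<in>UNIV. \<epsilon> j * d j) = (\<Sum>j\<in>UNIV. a j * d j) - \<kappa> * s"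
      by (simp add: \<epsilon>_def s_def left_diff_distrib sum_subtractf sum_distrib_left power2_eq_square mult.assoc)
    then show ?thesis using \<open>s > 0\<close> by (simp add: \<kappa>_def)
  qed
  have "?S \<bullet> (\<Sum>j\<in>UNIV. \<epsilon> j *\<^sub>R P j) = 0"
  proof (rule loc_min_along_curve(1)[OF min _ _ tendsto_const[of 0], where c' = "\<lambda>t j. c j + t * \<epsilon> j" and P' = "\<lambda>t. P"])
    have "((\<lambda>t. c j + t * \<epsilon> j) \<longlongrightarrow> c j + 0 * \<epsilon> j) (at 0)" for j
      by (intro tendsto_intros)
    then have "\<forall>\<^sub>F t in at 0. c j + t * \<epsilon> j > 0" for j
      using conf(1)[of j] by (intro order_tendstoD(1)[of _ "c j"]) simp_all
    then have "\<forall>\<^sub>F t in at 0. \<forall>j. c j + t * \<epsilon> j > 0"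
      by (simp add: eventually_all_finite)
    then show "\<forall>\<^sub>F t in at 0. config d (\<lambda>j. c j + t * \<epsilon> j) P"
    proof eventually_elim
      case (elim t)
      have "(\<Sum>j\<in>UNIV. (c j + t * \<epsilon> j) * d j) = (\<Sum>j\<in>UNIV. c j * d j) + t * (\<Sum>j\<in>UNIV. \<epsilon> j * d j)"
        by (simp add: distrib_right sum.distrib sum_distrib_left mult.assoc)
      then show ?case
        using elim conf \<epsilon>d by (simp add: config_def)
    qed
    show "fop (\<lambda>j. c j + t * \<epsilon> j) P = ?S + t *\<^sub>R (\<Sum>j\<in>UNIV. \<epsilon> j *\<^sub>R P j) + t\<^sup>2 *\<^sub>R 0" for t
      by (simp add: fop_def scaleR_add_left sum.distrib scaleR_sum_right)
  qed
  then have "(\<Sum>j\<in>UNIV. \<epsilon> j * a j) = 0"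
    by (simp add: inner_sum_right a_def)
  moreover have "(\<Sum>j\<in>UNIV. \<epsilon> j * a j) = (\<Sum>j\<in>UNIV. (\<epsilon> j)\<^sup>2) + \<kappa> * (\<Sum>j\<in>UNIV. \<epsilon> j * d j)"
    unfolding sum_distrib_left sum.distrib[symmetric]
    by (rule sum.cong) (simp_all add: \<epsilon>_def power2_eq_square algebra_simps)
  ultimately have "(\<Sum>j\<in>UNIV. (\<epsilon> j)\<^sup>2) = 0"
    using \<epsilon>d by simp
  then have "(\<epsilon> j)\<^sup>2 = 0" for j
    by (subst (asm) sum_nonneg_eq_0_iff) simp_all
  then have a_eq: "a j = \<kappa> * d j" for j
    by (simp add: \<epsilon>_def)
  have "?S \<bullet> ?S = (\<Sum>j\<in>UNIV. c j * a j)"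
    by (subst (2) fop_def) (simp add: inner_sum_right a_def)
  also have "\<dots> = \<kappa> * (\<Sum>j\<in>UNIV. c j * d j)"
    by (simp add: a_eq sum_distrib_left mult.left_commute)
  finally have "?S \<bullet> ?S = \<kappa>"
    using conf(4) by simp
  then show ?thesis
    using a_eq[of i] by (simp add: a_def)
qed

lemma fop_conj: "fop c (\<lambda>i. U ** P i ** V) = U ** fop c P ** V"
  by (simp add: fop_def mm.sum_right mm.sum_left mm.scaleR_left mm.scaleR_right)

lemma config_unitary_conj:
  assumes "unitary U" "config d c P"
  shows "config d c (\<lambda>i. U ** P i ** adj U)"
  using assms by (simp add: config_def hproj_unitary_conj trace_unitary_conj)

lemma loc_min_unitary_conj:
  assumes U: "unitary U" and min: "loc_min d c P"
  shows "loc_min d c (\<lambda>i. U ** P i ** adj U)"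
proof -
  obtain \<epsilon> where \<epsilon>: "\<epsilon> > 0"
    "\<And>c' P'. config d c' P' \<Longrightarrow> norm (fop c P - fop c' P') < \<epsilon> \<Longrightarrow> norm (fop c P) \<le> norm (fop c' P')"
    using min unfolding loc_min_def by blast
  have "norm (U ** fop c P ** adj U) \<le> norm (fop c' P')"
    if conf: "config d c' P'" and close: "norm (U ** fop c P ** adj U - fop c' P') < \<epsilon>" for c' P'
  proof -
    let ?T = "fop c' (\<lambda>i. adj U ** P' i ** adj (adj U))"
    have T: "?T = adj U ** fop c' P' ** U"
      by (simp add: fop_conj)
    have "fop c' P' = U ** ?T ** adj U"
      unfolding T by (simp add: matrix_mul_assoc[symmetric] unitary_simps[OF U])
    then have "norm (fop c P - ?T) < \<epsilon>" "norm ?T = norm (fop c' P')"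
      using close norm_unitary_conj[OF U, of "fop c P - ?T"] norm_unitary_conj[OF U, of ?T]
      by (simp_all add: mm.diff_left mm.diff_right)
    then show ?thesis
      using \<epsilon>(2)[OF config_unitary_conj[OF unitary_adj[OF U] conf]] norm_unitary_conj[OF U] by simp
  qed
  then show ?thesis
    unfolding loc_min_def fop_conj
    using config_unitary_conj[OF U loc_min_config[OF min]] \<epsilon>(1) by blast
qed

section \<open>Local minimizers with diagonal frame operator\<close>

abbreviation rdiag :: "('n \<Rightarrow> real) \<Rightarrow> complex ^ 'n ^ 'n"
  where "rdiag \<mu> \<equiv> diagm (\<lambda>k. of_real (\<mu> k))"

lemma inner_rdiag: "rdiag \<mu> \<bullet> X = (\<Sum>k\<in>UNIV. \<mu> k * Re (X $ k $ k))"
proof -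
  have "rdiag \<mu> $ k \<bullet> X $ k = \<mu> k * Re (X $ k $ k)" for k
  proof -
    have "rdiag \<mu> $ k \<bullet> X $ k = (\<Sum>l\<in>UNIV. if k = l then \<mu> k * Re (X $ k $ l) else 0)"
      unfolding inner_vec_def by (rule sum.cong) (auto simp: diagm_def inner_complex_def)
    then show ?thesis by simp
  qed
  then show ?thesis by (simp add: inner_vec_def[of "rdiag \<mu>"])
qed

lemma mult_adj_diag: "Re ((A ** adj A) $ k $ k) = (\<Sum>l\<in>UNIV. (norm (A $ k $ l))\<^sup>2)"
  by (simp add: matrix_matrix_mult_def adj_def cmod_power2) (simp add: power2_eq_square)

lemma adj_mult_diag: "Re ((adj A ** A) $ l $ l) = (\<Sum>k\<in>UNIV. (norm (A $ k $ l))\<^sup>2)"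
  by (simp add: matrix_matrix_mult_def adj_def cmod_power2) (simp add: power2_eq_square)

text \<open>The second variation in an eigenbasis of \<open>S\<close>: the entry
  \<open>A $ k $ l\<close> tilts a subspace from eigenvector \<open>l\<close> towards eigenvector
  \<open>k\<close>, at a cost proportional to the difference of the eigenvalues.\<close>

lemma inner_rdiag_commutator:
  "rdiag \<mu> \<bullet> (A ** adj A - adj A ** A) = (\<Sum>k\<in>UNIV. \<Sum>l\<in>UNIV. (\<mu> k - \<mu> l) * (norm (A $ k $ l))\<^sup>2)"
proof -
  have "rdiag \<mu> \<bullet> (adj A ** A) = (\<Sum>l\<in>UNIV. \<Sum>k\<in>UNIV. \<mu> l * (norm (A $ k $ l))\<^sup>2)"
    unfolding inner_rdiag adj_mult_diag by (simp add: sum_distrib_left)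
  also have "\<dots> = (\<Sum>k\<in>UNIV. \<Sum>l\<in>UNIV. \<mu> l * (norm (A $ k $ l))\<^sup>2)"
    by (rule sum.swap)
  finally show ?thesis
    unfolding inner_diff_right inner_rdiag[of _ "A ** adj A"] mult_adj_diag
    by (simp add: sum_distrib_left left_diff_distrib sum_subtractf)
qed

text \<open>A family of graph directions pointing to smaller eigenvalues, along which the frame operator is
  stationary to first order, would decrease the potential to second order.\<close>

lemma loc_min_no_descent:
  assumes min: "loc_min d c P" and S: "fop c P = rdiag \<mu>"
    and A: "\<And>i. A i ** P i = A i" "\<And>i. P i ** A i = 0"
    and low: "\<And>i k l. A i $ k $ l \<noteq> 0 \<Longrightarrow> \<mu> k < \<mu> l"
    and sum0: "(\<Sum>i\<in>UNIV. c i *\<^sub>R A i) = 0"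
  shows "A i = 0"
proof -
  note conf = configD[OF loc_min_config[OF min]]
  \<comment> \<open>All these terms are nonpositive, whereas the second variation makes their
    weighted total nonnegative. So each vanishes, and the strict inequality in \<open>low\<close>
    kills the entry.\<close>
  define q where "q i k l = (\<mu> k - \<mu> l) * (norm (A i $ k $ l))\<^sup>2" for i k l
  have q: "q i k l \<le> 0" for i k l
    using low[of i k l] by (cases "A i $ k $ l = 0") (auto simp: q_def mult_le_0_iff)
  have "(\<Sum>i\<in>UNIV. c i *\<^sub>R adj (A i)) = adj (\<Sum>i\<in>UNIV. c i *\<^sub>R A i)"
    by (simp add: adj_sum adj_scaleR)
  then have "(\<Sum>i\<in>UNIV. c i *\<^sub>R (A i + adj (A i))) = 0"
    by (simp add: scaleR_add_right sum.distrib sum0)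
  then have "0 \<le> fop c P \<bullet> (\<Sum>i\<in>UNIV. c i *\<^sub>R (A i ** adj (A i) - adj (A i) ** A i))"
    by (rule loc_min_graph_variation(2)[OF min A])
  also have "\<dots> = (\<Sum>i\<in>UNIV. c i * (\<Sum>k\<in>UNIV. \<Sum>l\<in>UNIV. q i k l))"
    by (simp add: S inner_sum_right inner_rdiag_commutator q_def)
  finally have "(\<Sum>i\<in>UNIV. c i * (- (\<Sum>k\<in>UNIV. \<Sum>l\<in>UNIV. q i k l))) \<le> 0"
    by (simp add: sum_negf)
  moreover have nn: "c i * (- (\<Sum>k\<in>UNIV. \<Sum>l\<in>UNIV. q i k l)) \<ge> 0" for i
    using conf(1)[of i] q by (intro mult_nonneg_nonneg) (auto intro!: sum_nonpos)
  ultimately have "(\<Sum>i\<in>UNIV. c i * (- (\<Sum>k\<in>UNIV. \<Sum>l\<in>UNIV. q i k l))) = 0"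
    by (intro antisym sum_nonneg) auto
  then have "c i * (- (\<Sum>k\<in>UNIV. \<Sum>l\<in>UNIV. q i k l)) = 0"
    using nn by (subst (asm) sum_nonneg_eq_0_iff) auto
  then have "(\<Sum>k\<in>UNIV. \<Sum>l\<in>UNIV. - q i k l) = 0"
    using conf(1)[of i] by (simp add: sum_negf)
  then have "(\<Sum>l\<in>UNIV. - q i k l) = 0" for k
    using q by (subst (asm) sum_nonneg_eq_0_iff) (auto intro!: sum_nonneg)
  then have q0: "- q i k l = 0" for k l
    using q by (subst (asm) sum_nonneg_eq_0_iff) auto
  have "A i $ k $ l = 0" for k l
    using low[of i k l] q0[of k l] by (cases "A i $ k $ l = 0") (simp_all add: q_def)
  then show ?thesis
    by (simp add: vec_eq_iff)
qed

text \<open>A kernel vector of \<open>S\<close> is orthogonal to all the subspaces. Their dimensions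
  sum to at least \<open>n\<close>, so they satisfy a nontrivial linear relation; tilting them
  towards the kernel vector along this relation leaves \<open>S\<close> stationary to first order,
  which contradicts \<open>loc_min_no_descent\<close>.\<close>

lemma loc_min_eigenvalues_pos:
  fixes P :: "'m::finite \<Rightarrow> complex ^ 'n ^ 'n"
  assumes min: "loc_min d c P" and S: "fop c P = rdiag \<mu>" and dims: "(\<Sum>i\<in>UNIV. d i) \<ge> CARD('n)"
  shows "\<mu> k > 0"
proof -
  note conf = configD[OF loc_min_config[OF min]]
  have diag_P: "(P j ** adj (P j)) = P j" "adj (P j) ** P j = P j" for j
    using hproj_simps[OF conf(2)[of j]] by simp_all
  have \<mu>_eq: "\<mu> k = (\<Sum>j\<in>UNIV. c j * (\<Sum>l\<in>UNIV. (norm (P j $ l $ k))\<^sup>2))" for k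
  proof -
    have "\<mu> k = Re (fop c P $ k $ k)"
      by (simp add: S diagm_def)
    also have "\<dots> = (\<Sum>j\<in>UNIV. c j * Re (P j $ k $ k))"
      by (simp add: fop_def sum_component)
    also have "\<dots> = (\<Sum>j\<in>UNIV. c j * (\<Sum>l\<in>UNIV. (norm (P j $ l $ k))\<^sup>2))"
      by (simp add: adj_mult_diag[symmetric] diag_P)
    finally show ?thesis .
  qed
  have nonneg: "\<mu> k \<ge> 0" for k
    unfolding \<mu>_eq by (intro sum_nonneg mult_nonneg_nonneg less_imp_le[OF conf(1)]) auto
  have P_col: "P j $ l $ k = 0" if "\<mu> k = 0" for j k l
  proof -
    have "c j * (\<Sum>l\<in>UNIV. (norm (P j $ l $ k))\<^sup>2) = 0"
      using that unfolding \<mu>_eq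
      by (subst (asm) sum_nonneg_eq_0_iff) (auto intro!: mult_nonneg_nonneg sum_nonneg less_imp_le[OF conf(1)])
    then have "(\<Sum>l\<in>UNIV. (norm (P j $ l $ k))\<^sup>2) = 0"
      using conf(1)[of j] by simp
    then have "(norm (P j $ l $ k))\<^sup>2 = 0"
      by (subst (asm) sum_nonneg_eq_0_iff) auto
    then show ?thesis by simp
  qed
  show ?thesis
  proof (rule ccontr)
    assume "\<not> \<mu> k > 0"
    then have k: "\<mu> k = 0" using nonneg[of k] by simp
    \<comment> \<open>The convention \<open>inverse 0 = 0\<close> makes this the pseudo-inverse, so
      that \<open>S' ** S\<close> is the projection off the kernel.\<close>
    define S' where "S' = (rdiag (\<lambda>k. inverse (\<mu> k)) :: complex ^ 'n ^ 'n)"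
    have S'S: "S' ** rdiag \<mu> = rdiag (\<lambda>k. of_bool (\<mu> k \<noteq> 0))"
      unfolding S'_def diagm_mult of_real_mult[symmetric] by (rule arg_cong[of _ _ diagm]) auto
    have PS'S: "P i ** S' ** rdiag \<mu> = P i" for i
    proof -
      have "(P i ** rdiag (\<lambda>k. of_bool (\<mu> k \<noteq> 0))) $ a $ b = P i $ a $ b" for a b
        using P_col[of b i a]
        by (auto simp: matrix_matrix_mult_def diagm_def mult_delta_right)
      then show ?thesis
        by (simp add: matrix_mul_assoc[symmetric] S'S vec_eq_iff)
    qed
    \<comment> \<open>Otherwise taking traces identifies the sum of the dimensions with the trace of
      \<open>S' ** S\<close>, that is, with the rank of \<open>S\<close>, which is less than
      \<open>n\<close>.\<close>
    have "\<exists>i. P i - c i *\<^sub>R (P i ** S' ** P i) \<noteq> 0"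
    proof (rule ccontr)
      assume "\<not> ?thesis"
      then have eq: "P i = c i *\<^sub>R (P i ** S' ** P i)" for i by simp
      have "of_nat (d i) = c i *\<^sub>R trace (S' ** P i)" for i
      proof -
        have "of_nat (d i) = trace (c i *\<^sub>R (P i ** S' ** P i))"
          using eq[of i] conf(3)[of i] by simp
        also have "\<dots> = c i *\<^sub>R trace (S' ** P i)"
          unfolding trace_scaleR trace_mul_sym[of "P i ** S'"] using hproj_simps[OF conf(2)[of i]]
          by (simp add: matrix_mul_assoc trace_mul_sym[of S' "P i"])
        finally show ?thesis .
      qed
      then have "of_nat (\<Sum>i\<in>UNIV. d i) = trace (S' ** fop c P)"
        by (simp add: fop_def mm.sum_right mm.scaleR_right trace_sum trace_scaleR)
      also have "\<dots> = of_nat (card {k. \<mu> k \<noteq> 0})"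
        by (simp add: S S'S trace_diagm of_bool_def sum.If_cases if_distrib[of complex_of_real])
      finally have "(\<Sum>i\<in>UNIV. d i) = card {k. \<mu> k \<noteq> 0}"
        by (simp only: of_nat_eq_iff)
      also have "\<dots> < CARD('n)"
        using k by (intro psubset_card_mono) auto
      finally show False using dims by simp
    qed
    then obtain i0 where i0: "P i0 - c i0 *\<^sub>R (P i0 ** S' ** P i0) \<noteq> 0" by blast
    \<comment> \<open>The difference of two representations of \<open>P i0\<close> through the
      \<open>P j\<close>: the trivial one and the one given by the pseudo-inverse. Hence its
      weighted sum is zero.\<close>
    define M where "M j = (if j = i0 then P i0 else 0) - c i0 *\<^sub>R (P i0 ** S' ** P j)" for j
    have MP: "M j ** P j = M j" for j
      by (simp add: M_def mm.diff_left mm.scaleR_left matrix_mul_assoc[symmetric] hproj_simps[OF conf(2)])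
    have M0: "(\<Sum>j\<in>UNIV. c j *\<^sub>R M j) = 0"
    proof -
      have "(\<Sum>j\<in>UNIV. c j *\<^sub>R M j) = (\<Sum>j\<in>UNIV. c j *\<^sub>R (if j = i0 then P i0 else 0)) - c i0 *\<^sub>R (P i0 ** S' ** fop c P)"
        by (simp add: M_def scaleR_diff_right sum_subtractf fop_def mm.sum_right mm.scaleR_right scaleR_sum_right mult.commute)
      also have "(\<Sum>j\<in>UNIV. c j *\<^sub>R (if j = i0 then P i0 else 0)) = c i0 *\<^sub>R P i0"
        by (subst sum.remove[of _ i0]) simp_all
      finally show ?thesis
        by (simp add: S PS'S)
    qed
    have "M i0 \<noteq> 0" using i0 by (simp add: M_def)
    then obtain r b where rb: "M i0 $ r $ b \<noteq> 0"
      by (auto simp: vec_eq_iff)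
    \<comment> \<open>One nonzero row of the relation is placed in row \<open>k\<close>, so that all
      directions point to the kernel vector.\<close>
    define A where "A j = (\<chi> p q. if p = k then M j $ r $ q else 0)" for j
    have "A i0 = 0"
    proof (rule loc_min_no_descent[OF min S])
      show "A j ** P j = A j" for j
      proof -
        have "(A j ** P j) $ p $ q = A j $ p $ q" for p q
          using arg_cong[OF MP[of j], of "\<lambda>X. X $ r $ q"]
          by (simp add: A_def matrix_matrix_mult_def mult_delta_left)
        then show ?thesis by (simp add: vec_eq_iff)
      qed
      show "P j ** A j = 0" for j
        using P_col[OF k] by (simp add: vec_eq_iff A_def matrix_matrix_mult_def mult_delta_right)
      show "\<mu> p < \<mu> q" if "A j $ p $ q \<noteq> 0" for j p q
      proof -
        have p: "p = k" "M j $ r $ q \<noteq> 0"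
          using that by (auto simp: A_def split: if_splits)
        have "\<mu> q \<noteq> 0"
        proof
          assume "\<mu> q = 0"
          then have "(M j ** P j) $ r $ q = 0"
            by (simp add: matrix_matrix_mult_def P_col)
          with MP p show False by simp
        qed
        then show ?thesis
          using nonneg[of q] k p by simp
      qed
      show "(\<Sum>j\<in>UNIV. c j *\<^sub>R A j) = 0"
      proof -
        have "(\<Sum>j\<in>UNIV. c j *\<^sub>R M j) $ r $ q = 0" for q
          by (simp add: M0)
        then have "(\<Sum>j\<in>UNIV. c j *\<^sub>R A j) $ p $ q = 0" for p q
          by (cases "p = k") (simp_all add: sum_component A_def)
        then show ?thesis by (simp add: vec_eq_iff)
      qed
    qed
    then have "A i0 $ k $ b = 0" by simp
    with rb show False by (simp add: A_def)
  qed
qed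

section \<open>The inequality for block triangular transformations\<close>

text \<open>Abel summation, removing one level set of \<open>\<nu>\<close> at a time.\<close>

lemma sum_mult_level_sets_nonneg:
  fixes \<nu> q :: "'k \<Rightarrow> real"
  assumes "finite K" "\<And>k. k \<in> K \<Longrightarrow> 0 \<le> \<nu> k"
    and "\<And>\<tau>. \<tau> > 0 \<Longrightarrow> 0 \<le> (\<Sum>k | k \<in> K \<and> \<tau> \<le> \<nu> k. q k)"
  shows "0 \<le> (\<Sum>k\<in>K. \<nu> k * q k)"
  using assms
proof (induction "card {k \<in> K. \<nu> k > 0}" arbitrary: \<nu> rule: less_induct)
  case less
  let ?P = "{k \<in> K. \<nu> k > 0}"
  show ?case
  proof (cases "?P = {}")
    case True
    then have "\<nu> k = 0" if "k \<in> K" for k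
      using less.prems(2)[OF that] that by force
    then show ?thesis by simp
  next
    case False
    have fin: "finite ?P" using less.prems(1) by simp
    define m where "m = Min (\<nu> ` ?P)"
    have m_in: "m \<in> \<nu> ` ?P"
      unfolding m_def using fin False by (intro Min_in) auto
    then have "m > 0" by auto
    have m_le: "m \<le> \<nu> k" if "k \<in> ?P" for k
      unfolding m_def using fin that by (intro Min_le) auto
    define \<nu>' where "\<nu>' k = (if \<nu> k > 0 then \<nu> k - m else 0)" for k
    have P_eq: "?P = {k. k \<in> K \<and> m \<le> \<nu> k}"
      using m_le \<open>m > 0\<close> by force
    have "0 \<le> (\<Sum>k\<in>K. \<nu>' k * q k)"
    proof (rule less.hyps)
      obtain k0 where k0: "k0 \<in> ?P" "\<nu> k0 = m" using m_in by auto
      have "{k \<in> K. \<nu>' k > 0} \<subseteq> ?P - {k0}"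
        using k0 by (auto simp: \<nu>'_def split: if_splits)
      then have "{k \<in> K. \<nu>' k > 0} \<subset> ?P"
        using k0 by blast
      then show "card {k \<in> K. \<nu>' k > 0} < card ?P"
        by (rule psubset_card_mono[OF fin])
      show "finite K" by (rule less.prems)
      show "0 \<le> \<nu>' k" if "k \<in> K" for k
        using m_le that by (auto simp: \<nu>'_def)
      show "0 \<le> (\<Sum>k | k \<in> K \<and> \<tau> \<le> \<nu>' k. q k)" if "\<tau> > 0" for \<tau>
      proof -
        have "{k. k \<in> K \<and> \<tau> \<le> \<nu>' k} = {k. k \<in> K \<and> \<tau> + m \<le> \<nu> k}"
          using that \<open>m > 0\<close> by (auto simp: \<nu>'_def)
        then show ?thesis
          using less.prems(3)[of "\<tau> + m"] that \<open>m > 0\<close> by simp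
      qed
    qed
    moreover have "(\<Sum>k\<in>K. \<nu> k * q k) = (\<Sum>k\<in>K. \<nu>' k * q k) + m * (\<Sum>k\<in>?P. q k)"
    proof -
      have "(\<Sum>k\<in>?P. m * q k) = (\<Sum>k\<in>K. if \<nu> k > 0 then m * q k else 0)"
        using less.prems(1) by (simp add: sum.inter_filter)
      moreover have "\<nu> k * q k = \<nu>' k * q k + (if \<nu> k > 0 then m * q k else 0)" if "k \<in> K" for k
        using less.prems(2)[OF that] by (auto simp: \<nu>'_def algebra_simps)
      ultimately show ?thesis
        by (simp add: sum.distrib sum_distrib_left)
    qed
    moreover have "0 \<le> (\<Sum>k\<in>?P. q k)"
      unfolding P_eq using less.prems(3)[OF \<open>m > 0\<close>] .
    ultimately show ?thesis
      using \<open>m > 0\<close> by simp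
  qed
qed

text \<open>These matrices preserve every span of the coordinate vectors with
  \<open>\<mu> k \<ge> \<tau>\<close>, that is, the spectral flag; they are block upper triangular
  once coordinates are sorted by decreasing \<open>\<mu>\<close>.\<close>

definition block_upper :: "('n \<Rightarrow> real) \<Rightarrow> complex ^ 'n ^ 'n \<Rightarrow> bool"
  where "block_upper \<mu> Y \<longleftrightarrow> (\<forall>k l. Y $ k $ l \<noteq> 0 \<longrightarrow> \<mu> l \<le> \<mu> k)"

lemma block_upper_mult:
  assumes "block_upper \<mu> X" "block_upper \<mu> Y" shows "block_upper \<mu> (X ** Y)"
  unfolding block_upper_def
proof (intro allI impI)
  fix k l assume "(X ** Y) $ k $ l \<noteq> 0"
  then obtain j where "X $ k $ j * Y $ j $ l \<noteq> 0"
    unfolding matrix_matrix_mult_def by (auto elim!: sum.not_neutral_contains_not_neutral)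
  then have "X $ k $ j \<noteq> 0" "Y $ j $ l \<noteq> 0" by auto
  then show "\<mu> l \<le> \<mu> k"
    using assms order_trans unfolding block_upper_def by blast
qed

lemma trace_mult_hproj_nonneg:
  assumes "hproj P" "hproj Q" shows "Re (trace (P ** Q)) \<ge> 0"
proof -
  have "(P ** Q) \<bullet> (P ** Q) = P \<bullet> (P ** Q)"
    unfolding inner_mult_right[of P Q] by (simp add: matrix_mul_assoc[symmetric] hproj_simps[OF assms(2)])
  also have "\<dots> = Re (trace (P ** Q))"
    unfolding inner_commute[of P] inner_mult_left using hproj_simps[OF assms(1)] hproj_simps[OF assms(2)]
    by (simp add: inner_matrix adj_mult matrix_mul_assoc[symmetric] trace_mul_sym[of P Q])
  finally show ?thesis by (metis inner_ge_zero)
qed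

text \<open>For every threshold, \<open>Y\<close> maps the part of the range of \<open>P\<close> in
  the upper spectral subspace into the intersection of that subspace with the range of
  \<open>R\<close>. So \<open>R\<close> carries at least as much trace above each threshold, and
  Abel summation combines the thresholds.\<close>

lemma block_upper_trace_ge:
  fixes P Y R :: "complex ^ 'n ^ 'n"
  assumes P: "hproj P" and comm: "rdiag \<mu> ** P = P ** rdiag \<mu>"
    and Y: "block_upper \<mu> Y" "invertible Y"
    and R: "hproj R" "R ** (Y ** P) = Y ** P" "trace R = trace P"
  shows "rdiag \<mu> \<bullet> P \<le> rdiag \<mu> \<bullet> R"
proof -
  have P_block: "P $ k $ l = 0" if "\<mu> k \<noteq> \<mu> l" for k l
  proof -
    have "(rdiag \<mu> ** P) $ k $ l = (P ** rdiag \<mu>) $ k $ l"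
      by (simp add: comm)
    then have "of_real (\<mu> k) * P $ k $ l = P $ k $ l * of_real (\<mu> l)"
      by (simp add: matrix_matrix_mult_def diagm_def mult_delta_left mult_delta_right)
    with that show ?thesis by (simp add: mult.commute)
  qed
  have level: "0 \<le> (\<Sum>k | \<tau> \<le> \<mu> k. Re (R $ k $ k) - Re (P $ k $ k))" for \<tau>
  proof -
    define F where "F = (diagm (\<lambda>k. of_bool (\<tau> \<le> \<mu> k)) :: complex ^ 'n ^ 'n)"
    have F_mult: "(F ** X) $ k $ l = (if \<tau> \<le> \<mu> k then X $ k $ l else 0)"
      "(X ** F) $ k $ l = (if \<tau> \<le> \<mu> l then X $ k $ l else 0)" for X k l
      by (simp_all add: F_def matrix_matrix_mult_def diagm_def mult_delta_left mult_delta_right)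
    have trF: "Re (trace (F ** X)) = (\<Sum>k | \<tau> \<le> \<mu> k. Re (X $ k $ k))" for X
      by (simp add: trace_def F_mult sum.If_cases)
    have F: "hproj F"
      unfolding hproj_def by (auto simp: vec_eq_iff F_mult) (auto simp: F_def adj_def diagm_def vec_eq_iff)
    have FP: "F ** P = P ** F"
      using P_block by (auto simp: vec_eq_iff F_mult)
    have FYF: "F ** (Y ** F) = Y ** F"
    proof -
      have "Y $ k $ l = 0" if "\<not> \<tau> \<le> \<mu> k" "\<tau> \<le> \<mu> l" for k l
        using Y(1) that order_trans[of \<tau> "\<mu> l" "\<mu> k"] unfolding block_upper_def by blast
      then show ?thesis by (auto simp: vec_eq_iff F_mult)
    qed
    have hFP: "hproj (F ** P)"
    proof -
      have "adj (F ** P) = F ** P"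
        by (simp add: adj_mult FP hproj_simps(1)[OF P] hproj_simps(1)[OF F])
      moreover have "(F ** P) ** (F ** P) = F ** (P ** F) ** P"
        by (simp add: matrix_mul_assoc)
      then have "(F ** P) ** (F ** P) = F ** P"
        unfolding FP[symmetric] by (simp add: matrix_mul_assoc[symmetric] hproj_simps[OF P] hproj_simps[OF F])
      ultimately show ?thesis by (simp add: hproj_def)
    qed
    \<comment> \<open>\<open>Z\<close> projects onto the image of the upper part of
      \<open>P\<close>. It lies below both \<open>F\<close> and \<open>R\<close> and has the trace
      of \<open>F ** P\<close>, so positivity of the trace of \<open>F ** (R - Z)\<close> gives the
      comparison.\<close>
    obtain Z K where Z: "hproj Z" "Z ** (Y ** (F ** P)) = Y ** (F ** P)" "Z = Y ** (F ** P) ** K"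
      by (rule range_hproj_exists)
    obtain Y' where Y': "Y' ** Y = mat 1" "Y ** Y' = mat 1"
      using Y(2) by (auto simp: invertible_def)
    have "trace Z = trace (F ** P)"
      by (rule trace_hproj_transport[OF hFP Y' Z])
    have "Y ** (F ** P) = Y ** P ** F"
      by (simp add: FP matrix_mul_assoc)
    then have RZ: "R ** Z = Z"
      unfolding Z(3) using R(2) by (simp add: matrix_mul_assoc)
    have FZ: "F ** Z = Z"
      unfolding Z(3) using arg_cong[OF FYF, of "\<lambda>X. X ** P ** K"] by (simp add: matrix_mul_assoc)
    have ZR: "Z ** R = Z"
      using arg_cong[OF RZ, of adj] by (simp add: adj_mult hproj_simps(1)[OF R(1)] hproj_simps(1)[OF Z(1)])
    have "hproj (R - Z)"
      unfolding hproj_def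
      by (simp add: adj_diff mm.diff_left mm.diff_right RZ ZR hproj_simps(1,2)[OF R(1)] hproj_simps(1,2)[OF Z(1)])
    then have "0 \<le> Re (trace (F ** (R - Z)))"
      by (rule trace_mult_hproj_nonneg[OF F])
    also have "\<dots> = Re (trace (F ** R)) - Re (trace Z)"
      by (simp add: mm.diff_right FZ) (simp add: trace_def sum_subtractf)
    also have "\<dots> = (\<Sum>k | \<tau> \<le> \<mu> k. Re (R $ k $ k) - Re (P $ k $ k))"
      by (simp add: \<open>trace Z = trace (F ** P)\<close> trF sum_subtractf)
    finally show ?thesis .
  qed
  \<comment> \<open>Equal traces make the claim invariant under shifting \<open>\<mu>\<close>; this
    shift makes all coefficients nonnegative.\<close>
  define m where "m = Min (range \<mu>)"
  have "0 \<le> (\<Sum>k\<in>UNIV. (\<mu> k - m) * (Re (R $ k $ k) - Re (P $ k $ k)))"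
  proof (rule sum_mult_level_sets_nonneg)
    show "0 \<le> (\<Sum>k | k \<in> UNIV \<and> \<tau> \<le> \<mu> k - m. Re (R $ k $ k) - Re (P $ k $ k))" for \<tau>
      using level[of "\<tau> + m"] by (simp add: le_diff_eq)
  qed (simp_all add: m_def)
  also have "\<dots> = (\<Sum>k\<in>UNIV. \<mu> k * (Re (R $ k $ k) - Re (P $ k $ k))) - m * (Re (trace R) - Re (trace P))"
    by (simp add: left_diff_distrib sum_subtractf sum_distrib_left trace_def right_diff_distrib)
  finally show ?thesis
    by (simp add: R(3) inner_rdiag right_diff_distrib sum_subtractf)
qed

section \<open>Generic configurations\<close>

text \<open>Surjectivity of the differential of \<open>(g, Y, C) \<mapsto> (g Y\<^sub>i C\<^sub>i)\<^sub>i\<close> at the identity.\<close>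

lemma loc_min_spanning:
  fixes P :: "'m::finite \<Rightarrow> complex ^ 'n ^ 'n"
  assumes min: "loc_min d c P" and S: "fop c P = rdiag \<mu>"
  shows "\<exists>g Y C. (\<forall>i. T i = g + Y i + C i \<and> block_upper \<mu> (Y i) \<and> C i ** P i = P i ** (C i ** P i))"
proof -
  note conf = configD[OF loc_min_config[OF min]]
  define stab where "stab i C \<longleftrightarrow> C ** P i = P i ** (C ** P i)" for i C
  define W where "W = {x :: complex ^ 'n ^ 'n ^ 'm. \<exists>g Y C. \<forall>i. x $ i = g + Y i + C i \<and> block_upper \<mu> (Y i) \<and> stab i (C i)}"
  have WI: "x \<in> W" if "\<And>i. x $ i = g + Y i + C i" "\<And>i. block_upper \<mu> (Y i)" "\<And>i. stab i (C i)" for x g Y C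
    unfolding W_def using that by blast
  have WE: thesis if "x \<in> W" "\<And>g Y C. (\<And>i. x $ i = g + Y i + C i) \<Longrightarrow> (\<And>i. block_upper \<mu> (Y i)) \<Longrightarrow> (\<And>i. stab i (C i)) \<Longrightarrow> thesis" for x thesis
    using that unfolding W_def by blast
  have bu0: "block_upper \<mu> 0" and st0: "stab i 0" for i
    by (simp_all add: block_upper_def stab_def)
  have bu_add: "block_upper \<mu> (X + Y)" if "block_upper \<mu> X" "block_upper \<mu> Y" for X Y
    using that unfolding block_upper_def by (metis add.right_neutral vector_add_component)
  have "subspace W"
  proof (rule subspaceI)
    show "0 \<in> W"
      by (rule WI[of _ 0 "\<lambda>_. 0" "\<lambda>_. 0"]) (simp_all add: bu0 st0)
  next
    fix x y assume "x \<in> W" "y \<in> W"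
    show "x + y \<in> W"
    proof (rule WE[OF \<open>x \<in> W\<close>], rule WE[OF \<open>y \<in> W\<close>])
      fix g Y C g' Y' C'
      assume "\<And>i. x $ i = g + Y i + C i" "\<And>i. block_upper \<mu> (Y i)" "\<And>i. stab i (C i)"
        and "\<And>i. y $ i = g' + Y' i + C' i" "\<And>i. block_upper \<mu> (Y' i)" "\<And>i. stab i (C' i)"
      then show ?thesis
        by (intro WI[of _ "g + g'" "\<lambda>i. Y i + Y' i" "\<lambda>i. C i + C' i"] bu_add)
           (auto simp: stab_def mm.add_left mm.add_right)
    qed
  next
    fix r :: real and x assume "x \<in> W"
    show "r *\<^sub>R x \<in> W"
    proof (rule WE[OF \<open>x \<in> W\<close>])
      fix g Y C
      assume "\<And>i. x $ i = g + Y i + C i" "\<And>i. block_upper \<mu> (Y i)" "\<And>i. stab i (C i)"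
      then show ?thesis
        by (intro WI[of _ "r *\<^sub>R g" "\<lambda>i. r *\<^sub>R Y i" "\<lambda>i. r *\<^sub>R C i"])
           (auto simp: stab_def mm.scaleR_left mm.scaleR_right scaleR_add_right block_upper_def)
    qed
  qed
  then have spanW: "span W = W" by (simp add: span_eq_iff)
  \<comment> \<open>\<open>Z\<close> is the part of the target orthogonal to the image. Testing it
    against constant families, block triangular matrices and stabilisers yields, in turn, zero sum,
    support where \<open>\<mu> k < \<mu> l\<close>, and the form of a graph direction.\<close>
  obtain a Z where a: "a \<in> span W" and Z: "\<And>w. w \<in> span W \<Longrightarrow> orthogonal Z w" and T: "(\<chi> i. T i) = a + Z"
    using orthogonal_subspace_decomp_exists[of W "\<chi> i. T i"] by metis
  have Z_orth: "(\<Sum>i\<in>UNIV. Z $ i \<bullet> w $ i) = 0" if "w \<in> W" for w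
    using Z[of w] that spanW by (simp add: orthogonal_def inner_vec_def[of Z])
  have Z_orth1: "Z $ i \<bullet> X = 0" if "block_upper \<mu> X \<or> stab i X" for i X
  proof -
    have "(\<chi> j. if j = i then X else 0) \<in> W"
    proof (cases "block_upper \<mu> X")
      case True
      then show ?thesis
        by (intro WI[of _ 0 "\<lambda>j. if j = i then X else 0" "\<lambda>_. 0"]) (auto simp: bu0 st0)
    next
      case False
      with that show ?thesis
        by (intro WI[of _ 0 "\<lambda>_. 0" "\<lambda>j. if j = i then X else 0"]) (auto simp: bu0 st0)
    qed
    from Z_orth[OF this] show ?thesis
      by (subst (asm) sum.remove[of _ i]) simp_all
  qed
  have "(\<Sum>i\<in>UNIV. Z $ i) = 0"
  proof -
    have "(\<chi> i. \<Sum>i\<in>UNIV. Z $ i) \<in> W"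
      by (rule WI[of _ "\<Sum>i\<in>UNIV. Z $ i" "\<lambda>_. 0" "\<lambda>_. 0"]) (simp_all add: bu0 st0)
    from Z_orth[OF this] have "(\<Sum>i\<in>UNIV. Z $ i) \<bullet> (\<Sum>i\<in>UNIV. Z $ i) = 0"
      by (simp add: inner_sum_left)
    then show ?thesis by simp
  qed
  moreover have low: "\<mu> k < \<mu> l" if nz: "Z $ i $ k $ l \<noteq> 0" for i k l
  proof (rule ccontr)
    assume "\<not> \<mu> k < \<mu> l"
    then have "block_upper \<mu> (\<chi> p q. if p = k \<and> q = l then Z $ i $ k $ l else 0)"
      by (auto simp: block_upper_def)
    then have "Z $ i \<bullet> (\<chi> p q. if p = k \<and> q = l then Z $ i $ k $ l else 0) = 0"
      using Z_orth1 by blast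
    also have "Z $ i \<bullet> (\<chi> p q. if p = k \<and> q = l then Z $ i $ k $ l else 0) = Z $ i $ k $ l \<bullet> Z $ i $ k $ l"
    proof -
      have "Z $ i $ p \<bullet> (\<chi> q. if p = k \<and> q = l then Z $ i $ k $ l else 0)
          = (if p = k then Z $ i $ k $ l \<bullet> Z $ i $ k $ l else 0)" for p
      proof -
        have "Z $ i $ p \<bullet> (\<chi> q. if p = k \<and> q = l then Z $ i $ k $ l else 0)
            = (\<Sum>q\<in>UNIV. if q = l then (if p = k then Z $ i $ k $ l \<bullet> Z $ i $ k $ l else 0) else 0)"
          unfolding inner_vec_def by (rule sum.cong) auto
        then show ?thesis by simp
      qed
      then show ?thesis
        unfolding inner_vec_def[of "Z $ i"] by simp
    qed
    finally show False using nz by simp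
  qed
  moreover have ZP: "(mat 1 - P i) ** Z $ i ** P i = Z $ i" for i
  proof -
    let ?B = "(mat 1 - P i) ** Z $ i ** P i"
    note P' = hproj_simps[OF hproj_compl[OF conf(2)[of i]]]
    have "stab i (Z $ i - ?B)"
      by (simp add: stab_def mm.diff_left mm.diff_right matrix_mul_assoc[symmetric] hproj_simps[OF conf(2)])
    then have 1: "Z $ i \<bullet> (Z $ i - ?B) = 0"
      using Z_orth1 by blast
    have "?B \<bullet> ?B = (Z $ i ** P i) \<bullet> (adj (mat 1 - P i) ** ?B)"
      using inner_mult_left[of "mat 1 - P i" "Z $ i ** P i" ?B] by (simp add: matrix_mul_assoc)
    also have "adj (mat 1 - P i) ** ?B = ?B"
      using P'(1) by (simp add: matrix_mul_assoc P'(2))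
    also have "(Z $ i ** P i) \<bullet> ?B = Z $ i \<bullet> (?B ** adj (P i))"
      by (rule inner_mult_right)
    also have "?B ** adj (P i) = ?B"
      by (simp add: matrix_mul_assoc[symmetric] hproj_simps[OF conf(2)])
    finally have "(Z $ i - ?B) \<bullet> (Z $ i - ?B) = 0"
      using 1 by (simp add: inner_diff_right inner_diff_left inner_commute[of ?B "Z $ i"])
    then show ?thesis by simp
  qed
  \<comment> \<open>Division by the weight turns the plain sum condition on \<open>Z\<close> into
    the weighted one for graph directions.\<close>
  ultimately have "inverse (c i) *\<^sub>R Z $ i = 0" for i
  proof (intro loc_min_no_descent[OF min S, of "\<lambda>i. inverse (c i) *\<^sub>R Z $ i"])
    fix i
    have "Z $ i ** P i = Z $ i"
      by (subst (1 2) ZP[of i, symmetric]) (simp add: matrix_mul_assoc[symmetric] hproj_simps[OF conf(2)])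
    then show "(inverse (c i) *\<^sub>R Z $ i) ** P i = inverse (c i) *\<^sub>R Z $ i"
      by (simp add: mm.scaleR_left)
    have "P i ** Z $ i = 0"
      by (subst ZP[of i, symmetric]) (simp add: mm.diff_right mm.diff_left matrix_mul_assoc hproj_simps[OF conf(2)])
    then show "P i ** (inverse (c i) *\<^sub>R Z $ i) = 0"
      by (simp add: mm.scaleR_right)
  next
    show "(\<Sum>i\<in>UNIV. c i *\<^sub>R (inverse (c i) *\<^sub>R Z $ i)) = 0" if "(\<Sum>i\<in>UNIV. Z $ i) = 0"
    proof -
      have "c i *\<^sub>R (inverse (c i) *\<^sub>R Z $ i) = Z $ i" for i
        using conf(1)[of i] by simp
      then show ?thesis using that by simp
    qed
  qed (auto dest: low)
  then have "Z $ i = 0" for i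
    using conf(1)[of i] by (metis inverse_nonzero_iff_nonzero less_irrefl scaleR_eq_0_iff)
  then have "(\<chi> i. T i) \<in> W"
    using T a spanW by (simp add: vec_eq_iff[of Z]) (metis add.right_neutral vec_eq_iff zero_index)
  then obtain g Y C where "\<forall>i. (\<chi> i. T i) $ i = g + Y i + C i \<and> block_upper \<mu> (Y i) \<and> stab i (C i)"
    unfolding W_def by blast
  then show ?thesis
    unfolding stab_def by auto
qed

text \<open>An affine family through the identity keeps all entries polynomial in \<open>x\<close>.
  The conditions on \<open>Y\<close> and \<open>C\<close> are linear and hold for the identity, so
  they pass from the directions \<open>B k\<close> to the whole family.\<close>

definition aff :: "('k \<Rightarrow> complex ^ 'n ^ 'n) \<Rightarrow> complex ^ 'k \<Rightarrow> complex ^ 'n ^ 'n"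
  where "aff B x = mat 1 + (\<chi> r s. \<Sum>k\<in>UNIV. x $ k * B k $ r $ s)"

lemma aff_0 [simp]: "aff B 0 = mat 1"
  by (simp add: aff_def vec_eq_iff)

lemma aff_has_derivative: "(aff B has_derivative (\<lambda>h. \<chi> r s. \<Sum>k\<in>UNIV. h $ k * B k $ r $ s)) (at x)"
proof -
  have "linear (\<lambda>h. \<chi> r s. \<Sum>k\<in>UNIV. h $ k * B k $ r $ s)"
    by (rule linearI) (simp_all add: vec_eq_iff distrib_right sum.distrib scaleR_sum_right)
  then have "((\<lambda>h. \<chi> r s. \<Sum>k\<in>UNIV. h $ k * B k $ r $ s) has_derivative (\<lambda>h. \<chi> r s. \<Sum>k\<in>UNIV. h $ k * B k $ r $ s)) (at x)"
    by (intro bounded_linear_imp_has_derivative) (simp add: linear_conv_bounded_linear)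
  from has_derivative_add[OF has_derivative_const this, of "mat 1"] show ?thesis
    unfolding aff_def[abs_def] by simp
qed

lemma polyfun_aff: "polyfun (\<lambda>x. aff B x $ r $ s)"
proof -
  have "polyfun (\<lambda>x. mat 1 $ r $ s + (\<Sum>k\<in>UNIV. x $ k * B k $ r $ s))"
    by (rule polyfun.add, rule polyfun.const, rule polyfun_sum, rule polyfun.mult, rule polyfun.coord, rule polyfun.const)
  then show ?thesis by (simp add: aff_def)
qed

lemma polyfun_matrix_mult:
  assumes "\<And>r s. polyfun (\<lambda>x. X x $ r $ s)" "\<And>r s. polyfun (\<lambda>x. Y x $ r $ s)"
  shows "polyfun (\<lambda>x. (X x ** Y x) $ r $ s)"
proof -
  have "polyfun (\<lambda>x. \<Sum>k\<in>UNIV. X x $ r $ k * Y x $ k $ s)"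
    by (rule polyfun_sum, rule polyfun.mult, rule assms, rule assms)
  then show ?thesis by (simp add: matrix_matrix_mult_def)
qed

lemma block_upper_aff:
  assumes "\<And>k. block_upper \<mu> (B k)" shows "block_upper \<mu> (aff B x)"
proof -
  have "aff B x $ r $ s = 0" if "\<not> \<mu> s \<le> \<mu> r" for r s
  proof -
    have "B k $ r $ s = 0" for k
      using assms[of k] that unfolding block_upper_def by blast
    moreover have "r \<noteq> s" using that by auto
    ultimately show ?thesis by (simp add: aff_def mat_def)
  qed
  then show ?thesis unfolding block_upper_def by blast
qed

lemma stabilizer_aff:
  assumes P: "hproj P" and B: "\<And>k. B k ** P = P ** (B k ** P)"
  shows "aff B x ** P = P ** (aff B x ** P)"
proof -
  define L where "L = (\<chi> r s. \<Sum>k\<in>UNIV. x $ k * B k $ r $ s)"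
  have L_mult: "(L ** X) $ r $ s = (\<Sum>k\<in>UNIV. x $ k * (B k ** X) $ r $ s)" for X r s
    by (simp add: L_def matrix_matrix_mult_def sum_distrib_right sum_distrib_left mult.assoc)
      (rule sum.swap)
  have "(P ** (L ** P)) $ r $ s = (\<Sum>k\<in>UNIV. x $ k * (P ** (B k ** P)) $ r $ s)" for r s
  proof -
    have "(P ** (L ** P)) $ r $ s = (\<Sum>j\<in>UNIV. \<Sum>k\<in>UNIV. x $ k * (P $ r $ j * (B k ** P) $ j $ s))"
      unfolding matrix_matrix_mult_def[of P] by (simp add: L_mult sum_distrib_left mult.left_commute)
    also have "\<dots> = (\<Sum>k\<in>UNIV. \<Sum>j\<in>UNIV. x $ k * (P $ r $ j * (B k ** P) $ j $ s))"
      by (rule sum.swap)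
    finally show ?thesis
      unfolding matrix_matrix_mult_def[of P] by (simp add: sum_distrib_left)
  qed
  then have "L ** P = P ** (L ** P)"
    using B by (simp add: vec_eq_iff L_mult)
  then show ?thesis
    by (simp add: aff_def L_def[symmetric] mm.add_left mm.add_right hproj_simps[OF P])
qed

text \<open>Each elementary family \<open>T k\<close>, with a single unit entry in one of the
  matrices, is decomposed by the surjective differential. With these decompositions as directions,
  one coordinate per entry, the product map has the identity as derivative at 0.\<close>

lemma loc_min_generic:
  fixes P h :: "'m::finite \<Rightarrow> complex ^ 'n ^ 'n"
  assumes min: "loc_min d c P" and S: "fop c P = rdiag \<mu>" and \<delta>: "\<delta> > 0"
  obtains g Y C where "\<And>i. block_upper \<mu> (Y i)" "\<And>i. C i ** P i = P i ** (C i ** P i)"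
    "\<And>i. norm (h i - g ** Y i ** C i) < \<delta>"
proof -
  define T where "T k i = (\<chi> r s. if k = (i, r, s) then 1 else (0::complex))" for k :: "'m \<times> 'n \<times> 'n" and i
  have "\<exists>g Y C. (\<forall>i. T k i = g + Y i + C i \<and> block_upper \<mu> (Y i) \<and> C i ** P i = P i ** (C i ** P i))" for k
    by (rule loc_min_spanning[OF min S])
  then obtain g Y C where T: "\<And>k i. T k i = g k + Y k i + C k i"
    and Y: "\<And>k i. block_upper \<mu> (Y k i)" and C: "\<And>k i. C k i ** P i = P i ** (C k i ** P i)"
    by metis
  define X where "X i x = aff g x ** aff (\<lambda>k. Y k i) x ** aff (\<lambda>k. C k i) x" for i x
  define F where "F x = (\<chi> p. X (fst p) x $ fst (snd p) $ snd (snd p))" for x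
  let ?lin = "\<lambda>B h. \<chi> r s. \<Sum>k\<in>UNIV. h $ k * B k $ r $ s"
  have X': "(X i has_derivative (\<lambda>h. ?lin g h + ?lin (\<lambda>k. Y k i) h + ?lin (\<lambda>k. C k i) h)) (at 0)" for i
    unfolding X_def
    by (rule has_derivative_eq_rhs, rule mm.FDERIV, rule mm.FDERIV, rule aff_has_derivative, rule aff_has_derivative,
        rule aff_has_derivative) (simp add: add_ac)
  have "closure (range F) = UNIV"
  proof (rule polynomial_map_dense_range)
    show "polyfun (\<lambda>x. F x $ p)" for p
      unfolding F_def X_def using polyfun_matrix_mult[OF polyfun_matrix_mult[OF polyfun_aff polyfun_aff] polyfun_aff] by simp
    show "(F has_derivative (\<lambda>h. h)) (at 0)"
    proof (rule has_derivative_vec)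
      fix p :: "'m \<times> 'n \<times> 'n"
      obtain i r s where p: "p = (i, r, s)" by (cases p)
      have "((\<lambda>x. X i x $ r $ s) has_derivative (\<lambda>h. (?lin g h + ?lin (\<lambda>k. Y k i) h + ?lin (\<lambda>k. C k i) h) $ r $ s)) (at 0)"
        by (rule bounded_linear.has_derivative[OF bounded_linear_vec_nth bounded_linear.has_derivative[OF bounded_linear_vec_nth X']])
      moreover have "(?lin g h + ?lin (\<lambda>k. Y k i) h + ?lin (\<lambda>k. C k i) h) $ r $ s = h $ p" for h
      proof -
        have "(?lin g h + ?lin (\<lambda>k. Y k i) h + ?lin (\<lambda>k. C k i) h) $ r $ s = (\<Sum>k\<in>UNIV. h $ k * T k i $ r $ s)"
          by (simp add: T sum.distrib[symmetric] distrib_left)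
        also have "\<dots> = (\<Sum>k\<in>UNIV. if k = p then h $ k else 0)"
          by (rule sum.cong) (auto simp: T_def p)
        finally show ?thesis by simp
      qed
      ultimately show "((\<lambda>x. F x $ p) has_derivative (\<lambda>h. h $ p)) (at 0)"
        by (simp add: F_def p)
    qed
  qed
  moreover define H where "H = (\<chi> p. h (fst p) $ fst (snd p) $ snd (snd p))"
  \<comment> \<open>Passing from an entrywise error to the Frobenius norm costs the number of
    entries; the factor 2 makes the final bound strict.\<close>
  moreover define \<delta>' where "\<delta>' = \<delta> / (2 * (real CARD('n) * real CARD('n)))"
  have "\<delta>' > 0" using \<delta> by (simp add: \<delta>'_def)
  ultimately obtain x where x: "dist (F x) H < \<delta>'"
    using closure_approachable[of H "range F"] by auto
  have "norm (h i - X i x) < \<delta>" for i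
  proof -
    have "norm ((h i - X i x) $ r $ s) \<le> \<delta>'" for r s
    proof -
      have "norm ((H - F x) $ (i, r, s)) \<le> norm (H - F x)"
        by (rule Finite_Cartesian_Product.norm_nth_le)
      then show ?thesis
        using x by (simp add: H_def F_def dist_norm norm_minus_commute)
    qed
    then have "norm (h i - X i x) \<le> of_nat (CARD('n) * CARD('n)) * \<delta>'"
      by (rule norm_le_entries)
    also have "\<dots> < \<delta>"
      using \<delta> by (simp add: \<delta>'_def)
    finally show ?thesis .
  qed
  then show thesis
    using Y C configD(2)[OF loc_min_config[OF min]]
    by (intro that[of "\<lambda>i. aff (\<lambda>k. Y k i) x" "\<lambda>i. aff (\<lambda>k. C k i) x" "aff g x"])
       (auto intro: block_upper_aff stabilizer_aff simp: X_def)
qed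

text \<open>A matrix at distance less than 1 from a unitary is invertible, whence
  \<open>\<delta> \<le> 1\<close>, and then so are the three factors of \<open>H i\<close>. Since
  \<open>C i\<close> does not move the range of \<open>P i\<close>, \<open>R i\<close> projects onto
  its image under \<open>g ** Y i\<close>. The unitary from the QR decomposition of \<open>g\<close>
  makes \<open>U ** g ** Y i\<close> block triangular for all \<open>i\<close> at once.\<close>

lemma loc_min_align_approx:
  fixes P h :: "'m::finite \<Rightarrow> complex ^ 'n ^ 'n"
  assumes min: "loc_min d c P" and S: "fop c P = rdiag \<mu>" and h: "\<And>i. unitary (h i)" and \<delta>: "0 < \<delta>" "\<delta> \<le> 1"
  obtains U R H where "unitary U" "\<And>i. hproj (R i)" "\<And>i. trace (R i) = trace (P i)"
    "\<And>i. R i ** (H i ** P i) = H i ** P i" "\<And>i. norm (h i - H i) < \<delta>"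
    "\<And>i. rdiag \<mu> \<bullet> P i \<le> rdiag \<mu> \<bullet> (U ** R i ** adj U)"
proof -
  note conf = configD[OF loc_min_config[OF min]]
  obtain g Y C where Y: "\<And>i. block_upper \<mu> (Y i)" and C: "\<And>i. C i ** P i = P i ** (C i ** P i)"
    and close: "\<And>i. norm (h i - g ** Y i ** C i) < \<delta>"
    by (rule loc_min_generic[OF min S \<delta>(1), where h = h]) (rule that)
  define H where "H i = g ** Y i ** C i" for i
  have H_inv: "invertible (H i)" for i
  proof -
    have "x = 0" if "H i *v x = 0" for x
    proof (rule ccontr)
      assume "x \<noteq> 0"
      have "norm (h i *v x) = norm x"
        using unitary_simps(1)[OF h[of i]]
        by (simp add: norm_eq_sqrt_inner inner_adj matrix_vector_mul_assoc)
      moreover have "h i *v x = (h i - H i) *v x"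
        using that by (simp add: matrix_vector_mult_diff_rdistrib)
      ultimately have "norm x \<le> norm (h i - H i) * norm x"
        using norm_matrix_vector_mult_le[of "h i - H i" x] by simp
      also have "\<dots> < 1 * norm x"
        using close[of i] \<delta>(2) \<open>x \<noteq> 0\<close> by (intro mult_strict_right_mono) (auto simp: H_def)
      finally show False by simp
    qed
    then have "\<exists>B. B ** H i = mat 1"
      unfolding matrix_left_invertible_ker by blast
    then show ?thesis
      unfolding invertible_def using matrix_left_right_inverse by blast
  qed
  have "det g \<noteq> 0" "det (Y i) \<noteq> 0" "det (C i) \<noteq> 0" for i
    using H_inv[of i] unfolding H_def invertible_det_nz det_mul by auto
  then have g: "invertible g" and Yi: "\<And>i. invertible (Y i)" and Ci: "\<And>i. invertible (C i)"
    by (simp_all add: invertible_det_nz)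
  obtain U where U: "unitary U" "\<And>k l. (U ** g) $ k $ l \<noteq> 0 \<Longrightarrow> \<mu> l \<le> \<mu> k"
    using Gram_Schmidt[OF g, of \<mu>] by metis
  have Ug: "block_upper \<mu> (U ** g)"
    unfolding block_upper_def using U(2) by blast
  have "\<exists>R. hproj R \<and> trace R = trace (P i) \<and> R ** (H i ** P i) = H i ** P i \<and>
      rdiag \<mu> \<bullet> P i \<le> rdiag \<mu> \<bullet> (U ** R ** adj U)" for i
  proof -
    note Pi = hproj_simps[OF conf(2)[of i]]
    obtain R K where R: "hproj R" "R ** (H i ** P i) = H i ** P i" "R = H i ** P i ** K"
      by (rule range_hproj_exists)
    obtain H' where "H' ** H i = mat 1" "H i ** H' = mat 1"
      using H_inv[of i] by (auto simp: invertible_def)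
    then have trR: "trace R = trace (P i)"
      using trace_hproj_transport[OF conf(2) _ _ R] by blast
    obtain D where D: "C i ** P i ** D = P i"
    proof -
      \<comment> \<open>\<open>C'\<close> is invertible and commutes with \<open>P i\<close>, so \<open>C i\<close> maps the range of \<open>P i\<close> onto itself.\<close>
      define C' where "C' = C i ** P i + (mat 1 - P i)"
      have PC': "P i ** C' = C i ** P i" and C'P: "C' ** P i = C i ** P i"
        using C[of i] by (simp_all add: C'_def mm.add_left mm.add_right mm.diff_left mm.diff_right Pi
            matrix_mul_assoc[symmetric])
      obtain Ci' where Ci': "Ci' ** C i = mat 1"
        using Ci[of i] by (auto simp: invertible_def)
      have "x = 0" if "C' *v x = 0" for x
      proof -
        have "C i *v (P i *v x) = P i *v (C' *v x)"
          by (simp add: matrix_vector_mul_assoc PC')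
        then have "C i *v (P i *v x) = 0"
          using that by simp
        moreover have "Ci' *v (C i *v (P i *v x)) = P i *v x"
          by (simp only: matrix_vector_mul_assoc matrix_mul_assoc Ci' matrix_mul_lid)
        ultimately have Px: "P i *v x = 0" by simp
        have "C' *v x = C i *v (P i *v x) + (x - P i *v x)"
          by (simp add: C'_def matrix_vector_mult_add_rdistrib matrix_vector_mult_diff_rdistrib matrix_vector_mul_assoc)
        then show ?thesis using that Px by simp
      qed
      then obtain D where "D ** C' = mat 1"
        using matrix_left_invertible_ker[of C'] by blast
      then have "C' ** D = mat 1"
        using matrix_left_right_inverse by blast
      have "C i ** P i ** D = P i ** (C' ** D)"
        by (simp add: matrix_mul_assoc PC')
      then show thesis
        using that \<open>C' ** D = mat 1\<close> by simp
    qed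
    have "H i ** P i ** D = g ** Y i ** P i"
      unfolding H_def using D by (simp add: matrix_mul_assoc[symmetric])
    moreover have "R ** (H i ** P i ** D) = H i ** P i ** D"
      using arg_cong[OF R(2), of "\<lambda>X. X ** D"] by (simp add: matrix_mul_assoc)
    ultimately have Rg: "R ** (g ** Y i ** P i) = g ** Y i ** P i" by simp
    have "rdiag \<mu> \<bullet> P i \<le> rdiag \<mu> \<bullet> (U ** R ** adj U)"
    proof (rule block_upper_trace_ge[OF conf(2)])
      show "rdiag \<mu> ** P i = P i ** rdiag \<mu>"
        using loc_min_commute[OF min, of i] by (simp add: S)
      show "block_upper \<mu> (U ** g ** Y i)"
        by (rule block_upper_mult[OF Ug Y])
      have "det U \<noteq> 0"
        using unitary_simps(1)[OF U(1)] by (metis det_I det_mul mult_zero_right zero_neq_one)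
      then show "invertible (U ** g ** Y i)"
        using g Yi[of i] by (simp add: invertible_det_nz det_mul)
      show "hproj (U ** R ** adj U)"
        by (rule hproj_unitary_conj[OF U(1) R(1)])
      have "U ** R ** adj U ** (U ** g ** Y i ** P i) = U ** (R ** (g ** Y i ** P i))"
        by (simp add: matrix_mul_assoc[symmetric] unitary_simps[OF U(1)])
      then show "U ** R ** adj U ** (U ** g ** Y i ** P i) = U ** g ** Y i ** P i"
        unfolding Rg by (simp add: matrix_mul_assoc)
      show "trace (U ** R ** adj U) = trace (P i)"
        by (simp add: trace_unitary_conj[OF U(1)] trR)
    qed
    then show ?thesis
      using R(1,2) trR by blast
  qed
  then obtain R where "\<And>i. hproj (R i) \<and> trace (R i) = trace (P i) \<and> R i ** (H i ** P i) = H i ** P i \<and>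
      rdiag \<mu> \<bullet> P i \<le> rdiag \<mu> \<bullet> (U ** R i ** adj U)"
    by metis
  then show thesis
    using that[of U R H] U(1) close by (simp add: H_def)
qed

lemma tendsto_trace: "(f \<longlongrightarrow> A) F \<Longrightarrow> ((\<lambda>x. trace (f x)) \<longlongrightarrow> trace A) F" for A :: "complex ^ 'n ^ 'n"
  unfolding trace_def by (intro tendsto_intros)

text \<open>The limit of approximate alignments with errors \<open>1 / (n + 1)\<close>. The factors
  \<open>g\<close>, \<open>Y i\<close>, \<open>C i\<close> may diverge, so a convergent subsequence
  is extracted only from the bounded data \<open>U\<close> and \<open>R\<close>.\<close>

lemma loc_min_align:
  fixes P h :: "'m::finite \<Rightarrow> complex ^ 'n ^ 'n"
  assumes min: "loc_min d c P" and S: "fop c P = rdiag \<mu>" and h: "\<And>i. unitary (h i)"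
  obtains U where "unitary U" "\<And>i. rdiag \<mu> \<bullet> P i \<le> rdiag \<mu> \<bullet> (U ** (h i ** P i ** adj (h i)) ** adj U)"
proof -
  note conf = configD[OF loc_min_config[OF min]]
  define good where "good \<delta> U R H \<longleftrightarrow> unitary U \<and> (\<forall>i. hproj (R $ i) \<and> trace (R $ i) = trace (P i) \<and>
      R $ i ** (H i ** P i) = H i ** P i \<and> norm (h i - H i) < \<delta> \<and>
      rdiag \<mu> \<bullet> P i \<le> rdiag \<mu> \<bullet> (U ** R $ i ** adj U))"
    for \<delta> :: real and U :: "complex ^ 'n ^ 'n" and R :: "complex ^ 'n ^ 'n ^ 'm" and H
  have "\<exists>U R H. good (inverse (real (Suc n))) U R H" for n
  proof -
    have n: "0 < inverse (real (Suc n))" "inverse (real (Suc n)) \<le> 1"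
      by (simp_all add: divide_simps)
    obtain U R H where "unitary U" "\<And>i. hproj (R i)" "\<And>i. trace (R i) = trace (P i)"
      "\<And>i. R i ** (H i ** P i) = H i ** P i" "\<And>i. norm (h i - H i) < inverse (real (Suc n))"
      "\<And>i. rdiag \<mu> \<bullet> P i \<le> rdiag \<mu> \<bullet> (U ** R i ** adj U)"
      by (rule loc_min_align_approx[where h = h, OF min S h n]) (rule that)
    then have "good (inverse (real (Suc n))) U (\<chi> i. R i) H"
      by (simp add: good_def)
    then show ?thesis by blast
  qed
  then obtain U R H where good: "\<And>n. good (inverse (real (Suc n))) (U n) (R n) (H n)"
    by metis
  have U: "unitary (U n)" and R: "hproj (R n $ i)" "trace (R n $ i) = trace (P i)"
    and RH: "R n $ i ** (H n i ** P i) = H n i ** P i" and H: "norm (h i - H n i) < inverse (real (Suc n))"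
    and ineq: "rdiag \<mu> \<bullet> P i \<le> rdiag \<mu> \<bullet> (U n ** R n $ i ** adj (U n))" for n i
    using good[of n] unfolding good_def by blast+
  have H_lim: "(\<lambda>n. H n i) \<longlonglongrightarrow> h i" for i
  proof (rule LIMSEQ_I)
    fix r :: real assume "0 < r"
    then obtain N where N: "inverse (real (Suc N)) < r"
      using reals_Archimedean by blast
    have "norm (H n i - h i) < r" if "N \<le> n" for n
    proof -
      have "inverse (real (Suc n)) \<le> inverse (real (Suc N))"
        using that by (intro le_imp_inverse_le) auto
      then show ?thesis
        using H[of i n] N unfolding norm_minus_commute[of "H n i"] by linarith
    qed
    then show "\<exists>N. \<forall>n\<ge>N. norm (H n i - h i) < r" by blast
  qed
  have "bounded (range (\<lambda>n. (U n, R n)))"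
  proof -
    have "norm (U n) \<le> sqrt CARD('n)" for n
      using unitary_simps(2)[OF U[of n]] by (simp add: norm_eq_sqrt_inner inner_matrix trace_I)
    moreover have "norm (R n) \<le> (\<Sum>i\<in>UNIV. sqrt (d i))" for n
      unfolding norm_vec_def[of "R n"]
      by (rule order_trans[OF L2_set_le_sum])
         (auto intro!: sum_mono simp: norm_eq_sqrt_inner inner_hproj[OF R(1)] R(2) conf(3))
    ultimately have "norm (U n, R n) \<le> sqrt CARD('n) + (\<Sum>i\<in>UNIV. sqrt (d i))" for n
      by (intro order_trans[OF norm_Pair_le] add_mono)
    then show ?thesis by (auto simp: bounded_iff)
  qed
  then obtain Z \<sigma> where \<sigma>: "strict_mono \<sigma>" "((\<lambda>n. (U n, R n)) \<circ> \<sigma>) \<longlonglongrightarrow> Z"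
    using bounded_imp_convergent_subsequence by blast
  obtain V Q where Z: "Z = (V, Q)" by fastforce
  have V: "(\<lambda>n. U (\<sigma> n)) \<longlonglongrightarrow> V" and Q: "(\<lambda>n. R (\<sigma> n) $ i) \<longlonglongrightarrow> Q $ i" for i
    using tendsto_fst[OF \<sigma>(2)] tendsto_vec_nth[OF tendsto_snd[OF \<sigma>(2)]] by (simp_all add: o_def Z)
  have H': "(\<lambda>n. H (\<sigma> n) i) \<longlonglongrightarrow> h i" for i
    using LIMSEQ_subseq_LIMSEQ[OF H_lim \<sigma>(1)] by (simp add: o_def)
  have "(\<lambda>n. adj (U (\<sigma> n)) ** U (\<sigma> n)) \<longlonglongrightarrow> adj V ** V"
    by (intro mm.tendsto tendsto_adj V)
  then have V_unitary: "unitary V"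
    unfolding unitary_def using unitary_simps(1)[OF U] by (simp add: LIMSEQ_const_iff)
  \<comment> \<open>The limit is identified algebraically: it is a projection of the right trace
    that fixes \<open>h i ** P i\<close>.\<close>
  have Q_eq: "Q $ i = h i ** P i ** adj (h i)" for i
  proof -
    let ?P = "h i ** P i ** adj (h i)"
    have "(\<lambda>n. adj (R (\<sigma> n) $ i)) \<longlonglongrightarrow> adj (Q $ i)"
      by (intro tendsto_adj Q)
    then have "adj (Q $ i) = Q $ i"
      unfolding hproj_simps(1)[OF R(1)] by (rule LIMSEQ_unique[OF _ Q])
    moreover have "(\<lambda>n. R (\<sigma> n) $ i ** R (\<sigma> n) $ i) \<longlonglongrightarrow> Q $ i ** Q $ i"
      by (intro mm.tendsto Q)
    then have "Q $ i ** Q $ i = Q $ i"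
      unfolding hproj_simps(2)[OF R(1)] by (rule LIMSEQ_unique[OF _ Q])
    ultimately have "hproj (Q $ i)"
      by (simp add: hproj_def)
    moreover have "trace (Q $ i) = trace (P i)"
      using tendsto_trace[OF Q[of i]] by (simp add: R(2) LIMSEQ_const_iff)
    moreover have "Q $ i ** (h i ** P i) = h i ** P i"
    proof (rule LIMSEQ_unique)
      show "(\<lambda>n. R (\<sigma> n) $ i ** (H (\<sigma> n) i ** P i)) \<longlonglongrightarrow> Q $ i ** (h i ** P i)"
        by (intro mm.tendsto Q H' tendsto_const)
      show "(\<lambda>n. R (\<sigma> n) $ i ** (H (\<sigma> n) i ** P i)) \<longlonglongrightarrow> h i ** P i"
        unfolding RH by (intro mm.tendsto H' tendsto_const)
    qed
    then have "Q $ i ** ?P = ?P"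
      by (simp add: matrix_mul_assoc)
    ultimately show ?thesis
      using hproj_eqI[of ?P "Q $ i"] hproj_unitary_conj[OF h conf(2)] trace_unitary_conj[OF h] by simp
  qed
  have "rdiag \<mu> \<bullet> P i \<le> rdiag \<mu> \<bullet> (V ** (h i ** P i ** adj (h i)) ** adj V)" for i
  proof (rule LIMSEQ_le_const)
    show "(\<lambda>n. rdiag \<mu> \<bullet> (U (\<sigma> n) ** R (\<sigma> n) $ i ** adj (U (\<sigma> n)))) \<longlonglongrightarrow>
        rdiag \<mu> \<bullet> (V ** (h i ** P i ** adj (h i)) ** adj V)"
      unfolding Q_eq[symmetric] by (intro tendsto_inner tendsto_const mm.tendsto tendsto_adj V Q)
    show "\<exists>N. \<forall>n\<ge>N. rdiag \<mu> \<bullet> P i \<le> rdiag \<mu> \<bullet> (U (\<sigma> n) ** R (\<sigma> n) $ i ** adj (U (\<sigma> n)))"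
      using ineq by blast
  qed
  with V_unitary show thesis by (rule that)
qed

section \<open>Local minimizers of the frame potential\<close>

lemma loc_min_optimal:
  fixes P Q :: "'m::finite \<Rightarrow> complex ^ 'n ^ 'n"
  assumes min: "loc_min d c P" and Q: "config d c' Q"
  shows "norm (fop c P) \<le> norm (fop c' Q)"
    and "norm (fop c' Q) = norm (fop c P) \<Longrightarrow> \<exists>U. unitary U \<and> fop c P = U ** fop c' Q ** adj U"
proof -
  obtain V \<mu> where V: "unitary V" and S: "fop c P = V ** rdiag \<mu> ** adj V"
    by (rule hermitian_spectral[OF fop_hermitian[OF loc_min_config[OF min]]])
  define P' where "P' i = adj V ** P i ** adj (adj V)" for i
  have min': "loc_min d c P'"
    unfolding P'_def by (rule loc_min_unitary_conj[OF unitary_adj[OF V] min])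
  have S': "fop c P' = rdiag \<mu>"
    unfolding P'_def fop_conj S by (simp add: matrix_mul_assoc[symmetric] unitary_simps[OF V])
  let ?D = "rdiag \<mu> :: complex ^ 'n ^ 'n"
  have normD: "norm (fop c P) = norm ?D"
    unfolding S by (rule norm_unitary_conj[OF V])
  note conf = configD[OF loc_min_config[OF min']] and confQ = configD[OF Q]
  have "\<exists>h. unitary h \<and> Q i = h ** P' i ** adj h" for i
  proof -
    have "trace (P' i) = trace (Q i)" by (simp add: conf(3) confQ(3))
    from hproj_unitary_equiv[OF conf(2) confQ(2) this] show ?thesis by metis
  qed
  then obtain h where h: "\<And>i. unitary (h i)" and Q_eq: "\<And>i. Q i = h i ** P' i ** adj (h i)"
    by metis
  obtain U where U: "unitary U"
    and ineq: "\<And>i. ?D \<bullet> P' i \<le> ?D \<bullet> (U ** (h i ** P' i ** adj (h i)) ** adj U)"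
    by (rule loc_min_align[where h = h, OF min' S' h]) (rule that)
  define T where "T = U ** fop c' Q ** adj U"
  have normT: "norm T = norm (fop c' Q)"
    unfolding T_def by (rule norm_unitary_conj[OF U])
  \<comment> \<open>At the minimizer \<open>?D \<bullet> P' i\<close> is proportional to
    \<open>d i\<close>, so it can be summed with the competitor's weights \<open>c'\<close>, whose
    normalisation then gives \<open>?D \<bullet> ?D\<close>.\<close>
  have DT: "?D \<bullet> ?D \<le> ?D \<bullet> T"
  proof -
    have "?D \<bullet> ?D = (\<Sum>i\<in>UNIV. c' i * ((?D \<bullet> ?D) * d i))"
      using confQ(4) by (simp add: mult.left_commute[of "c' _"] sum_distrib_left[symmetric])
    also have "\<dots> = (\<Sum>i\<in>UNIV. c' i * (?D \<bullet> P' i))"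
      using loc_min_weights[OF min'] by (simp add: S')
    also have "\<dots> \<le> (\<Sum>i\<in>UNIV. c' i * (?D \<bullet> (U ** Q i ** adj U)))"
      unfolding Q_eq by (intro sum_mono mult_left_mono ineq less_imp_le[OF confQ(1)])
    also have "\<dots> = ?D \<bullet> T"
      unfolding T_def fop_conj[symmetric] by (simp add: fop_def inner_sum_right)
    finally show ?thesis .
  qed
  have "norm ?D * norm ?D \<le> norm ?D * norm T"
    using DT norm_cauchy_schwarz[of ?D T] by (simp add: power2_norm_eq_inner[symmetric] power2_eq_square)
  then show "norm (fop c P) \<le> norm (fop c' Q)"
    by (cases "norm ?D = 0") (simp_all add: normD normT)
  assume "norm (fop c' Q) = norm (fop c P)"
  then have "T \<bullet> T = ?D \<bullet> ?D"
    by (simp add: normD normT dot_square_norm)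
  then have "(?D - T) \<bullet> (?D - T) \<le> 0"
    using DT by (simp add: inner_diff_left inner_diff_right inner_commute[of T ?D])
  then have "?D - T = 0"
    by (metis inner_eq_zero_iff inner_ge_zero order_antisym)
  then have "?D = T" by simp
  then have "fop c P = (V ** U) ** fop c' Q ** adj (V ** U)"
    by (simp add: S T_def adj_mult matrix_mul_assoc)
  then show "\<exists>U. unitary U \<and> fop c P = U ** fop c' Q ** adj U"
    using unitary_mult[OF V U] by blast
qed

lemma loc_min_invertible:
  fixes P :: "'m::finite \<Rightarrow> complex ^ 'n ^ 'n"
  assumes min: "loc_min d c P" and dims: "(\<Sum>i\<in>UNIV. d i) \<ge> CARD('n)"
  shows "invertible (fop c P)"
proof -
  obtain V \<mu> where V: "unitary V" and S: "fop c P = V ** rdiag \<mu> ** adj V"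
    by (rule hermitian_spectral[OF fop_hermitian[OF loc_min_config[OF min]]])
  have "fop c (\<lambda>i. adj V ** P i ** adj (adj V)) = rdiag \<mu>"
    unfolding fop_conj S by (simp add: matrix_mul_assoc[symmetric] unitary_simps[OF V])
  then have "\<mu> k > 0" for k
    by (rule loc_min_eigenvalues_pos[OF loc_min_unitary_conj[OF unitary_adj[OF V] min] _ dims])
  then have "of_real (\<mu> k) * of_real (inverse (\<mu> k)) = (1 :: complex)" for k
    by (metis less_irrefl of_real_1 of_real_mult right_inverse)
  moreover define E where "E = (rdiag (\<lambda>k. inverse (\<mu> k)) :: complex ^ 'n ^ 'n)"
  ultimately have DE: "rdiag \<mu> ** E = mat 1"
    by (simp only: diagm_mult) (simp add: diagm_def mat_def)
  have "fop c P ** (V ** E ** adj V) = V ** (rdiag \<mu> ** E) ** adj V"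
    by (simp add: S matrix_mul_assoc[symmetric] unitary_simps[OF V])
  then have "fop c P ** (V ** E ** adj V) = mat 1"
    by (simp add: DE unitary_simps[OF V])
  then show ?thesis
    unfolding invertible_def using matrix_left_right_inverse by blast
qed

section \<open>Translation between weighted families and configurations\<close>

lemma frame_op_eq_fop: "frame_op \<W> = fop (\<lambda>i. (fst (\<W> i))\<^sup>2) (\<lambda>i. orth_proj (snd (\<W> i)))"
  by (simp add: frame_op_def fop_def)

lemma bessel1_config:
  assumes "\<W> \<in> bessel1 d"
  shows "config d (\<lambda>i. (fst (\<W> i))\<^sup>2) (\<lambda>i. orth_proj (snd (\<W> i)))"
proof -
  have W: "fst (\<W> i) > 0" "vec.subspace (snd (\<W> i))" "vec.dim (snd (\<W> i)) = d i" for i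
    using assms by (auto simp: bessel1_def)
  have tr: "trace (orth_proj (snd (\<W> i))) = of_nat (d i)" for i
    using dim_range_hproj[OF hproj_orth_proj[OF W(2)[of i]]] by (simp add: range_orth_proj[OF W(2)] W(3))
  have "trace (frame_op \<W>) = of_real (\<Sum>i\<in>UNIV. (fst (\<W> i))\<^sup>2 * d i)"
    by (simp add: frame_op_def trace_sum trace_scaleR tr) (simp add: scaleR_conv_of_real)
  moreover have "trace (frame_op \<W>) = of_real 1"
    using assms by (simp add: bessel1_def)
  ultimately have "(\<Sum>i\<in>UNIV. (fst (\<W> i))\<^sup>2 * d i) = 1"
    by (simp only: of_real_eq_iff)
  then show ?thesis
    using W by (simp add: config_def tr hproj_orth_proj less_imp_neq[symmetric])
qed

lemma config_bessel1:
  assumes "config d c P"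
  obtains \<W> where "\<W> \<in> bessel1 d" "frame_op \<W> = fop c P"
proof -
  note conf = configD[OF assms]
  define \<W> where "\<W> i = (sqrt (c i), range ((*v) (P i)))" for i
  have S: "frame_op \<W> = fop c P"
    using conf(1) by (simp add: frame_op_eq_fop \<W>_def orth_proj_range conf(2) less_imp_le)
  have "of_nat (vec.dim (range ((*v) (P i)))) = (of_nat (d i) :: complex)" for i
    using dim_range_hproj[OF conf(2)[of i]] conf(3)[of i] by simp
  then have "vec.dim (range ((*v) (P i))) = d i" for i
    by (simp only: of_nat_eq_iff)
  moreover have "trace (fop c P) = of_real (\<Sum>i\<in>UNIV. c i * d i)"
    by (simp add: fop_def trace_sum trace_scaleR conf(3)) (simp add: scaleR_conv_of_real)
  ultimately have "\<W> \<in> bessel1 d"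
    using conf(1,4) by (simp add: bessel1_def S) (simp add: \<W>_def range_matrix_subspace)
  with S show thesis using that by blast
qed

lemma FFP_eq_norm:
  assumes "\<W> \<in> bessel1 d" shows "FFP \<W> = (norm (frame_op \<W>))\<^sup>2"
proof -
  have "adj (frame_op \<W>) = frame_op \<W>"
    unfolding frame_op_eq_fop by (rule fop_hermitian[OF bessel1_config[OF assms]])
  then show ?thesis
    by (simp add: FFP_def power2_norm_eq_inner inner_matrix)
qed

text \<open>The spectral norm is at most the Frobenius norm, so a Frobenius ball lies in the
  \<open>d_S\<close> ball of the same radius; each configuration in it is realised by a family
  weighted with the square roots of the coefficients.\<close>

lemma FFP_local_minimizer_loc_min:
  assumes "FFP_local_minimizer d \<W>"
  shows "loc_min d (\<lambda>i. (fst (\<W> i))\<^sup>2) (\<lambda>i. orth_proj (snd (\<W> i)))"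
proof -
  obtain \<epsilon> where W: "\<W> \<in> bessel1 d" and \<epsilon>: "\<epsilon> > 0"
    "\<And>\<V>. \<V> \<in> bessel1 d \<Longrightarrow> d_S \<W> \<V> < \<epsilon> \<Longrightarrow> FFP \<W> \<le> FFP \<V>"
    using assms unfolding FFP_local_minimizer_def by blast
  have "norm (frame_op \<W>) \<le> norm (fop c' P')"
    if conf: "config d c' P'" and close: "norm (frame_op \<W> - fop c' P') < \<epsilon>" for c' P'
  proof -
    obtain \<V> where V: "\<V> \<in> bessel1 d" "frame_op \<V> = fop c' P'"
      by (rule config_bessel1[OF conf])
    have "d_S \<W> \<V> \<le> norm (frame_op \<W> - fop c' P')"
      unfolding d_S_def V(2) by (intro onorm_le norm_matrix_vector_mult_le)
    then have "FFP \<W> \<le> FFP \<V>"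
      using \<epsilon>(2)[OF V(1)] close by simp
    then show ?thesis
      by (simp add: FFP_eq_norm[OF W] FFP_eq_norm[OF V(1)] V(2))
  qed
  then show ?thesis
    unfolding loc_min_def frame_op_eq_fop[symmetric] using bessel1_config[OF W] \<epsilon>(1) by blast
qed

text \<open>Lifting entries to constant polynomials respects matrix products, and
  \<open>mat [:0, 1:]\<close> is central. The characteristic matrices are therefore conjugate over
  the polynomial ring, and the determinant cancels the conjugation.\<close>

lemma spectrum_mset_unitary_conj:
  assumes U: "unitary U" shows "spectrum_mset (U ** A ** adj U) = spectrum_mset A"
proof -
  define p where "p B = map_matrix (\<lambda>a::complex. [:a:]) B" for B :: "complex ^ 'a ^ 'a"
  have p_sum: "[:sum f I:] = (\<Sum>i\<in>I. [:f i :: complex:])" for f :: "'a \<Rightarrow> complex" and I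
  proof (induction I rule: infinite_finite_induct)
    case (insert i I)
    have "[:f i + sum f I:] = [:f i:] + [:sum f I:]" by simp
    also have "[:sum f I:] = (\<Sum>i\<in>I. [:f i:])" by (rule insert.IH)
    finally show ?case by (simp only: sum.insert[OF insert.hyps])
  qed simp_all
  have p_mult: "p (B ** C) = p B ** p C" for B C
    by (simp add: p_def vec_eq_iff map_matrix_def matrix_matrix_mult_def p_sum mult.commute)
  have "p (mat 1) = mat 1"
    by (simp add: p_def vec_eq_iff map_matrix_def mat_def one_pCons)
  then have pU: "p U ** p (adj U) = mat 1"
    using p_mult[of U "adj U"] unitary_simps(2)[OF U] by simp
  have "mat [:0, 1:] - p (U ** A ** adj U) = p U ** (mat [:0, 1:] - p A) ** p (adj U)"
  proof -
    have "p U ** mat [:0, 1:] ** p (adj U) = mat [:0, 1:] ** (p U ** p (adj U))"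
    proof -
      have "p U ** mat [:0, 1:] = mat [:0, 1:] ** p U"
        by (simp add: vec_eq_iff matrix_matrix_mult_def mat_def mult_delta_left mult_delta_right mult.commute)
      then show ?thesis by (simp add: matrix_mul_assoc)
    qed
    then have "mat [:0, 1:] = p U ** mat [:0, 1:] ** p (adj U)"
      by (simp add: pU)
    moreover have "p U ** (mat [:0, 1:] - p A) ** p (adj U) = p U ** mat [:0, 1:] ** p (adj U) - p U ** p A ** p (adj U)"
      by (simp add: vec_eq_iff matrix_matrix_mult_def right_diff_distrib left_diff_distrib sum_subtractf)
    ultimately show ?thesis
      by (simp add: p_mult)
  qed
  then have "det (mat [:0, 1:] - p (U ** A ** adj U)) = det (mat [:0, 1:] - p A) * det (p U ** p (adj U))"
    by (simp add: det_mul)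
  then show ?thesis
    by (simp add: spectrum_mset_def char_matrix_poly_def p_def[symmetric] pU)
qed

theorem theorem4p3p6:
  fixes d :: "'m::finite \<Rightarrow> nat"
  assumes "(\<Sum>i\<in>UNIV. d i) \<ge> CARD('n::finite)"
  shows "(\<forall>\<W> :: ('m, 'n) weighted_family. FFP_local_minimizer d \<W> \<longrightarrow>
            \<W> \<in> fusion_frames1 d \<and> FFP_global_minimizer d \<W>) \<and>
         (\<forall>(\<W> :: ('m, 'n) weighted_family) (\<V> :: ('m, 'n) weighted_family).
            FFP_local_minimizer d \<W> \<longrightarrow> FFP_local_minimizer d \<V> \<longrightarrow>
            spectrum_mset (frame_op \<W>) = spectrum_mset (frame_op \<V>))"
proof (intro conjI allI impI)
  fix \<W> :: "('m, 'n) weighted_family"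
  assume W: "FFP_local_minimizer d \<W>"
  then have W_bessel: "\<W> \<in> bessel1 d"
    by (simp add: FFP_local_minimizer_def)
  note min = FFP_local_minimizer_loc_min[OF W]
  have "invertible (frame_op \<W>)"
    unfolding frame_op_eq_fop by (rule loc_min_invertible[OF min assms])
  then show "\<W> \<in> fusion_frames1 d"
    using W_bessel by (simp add: fusion_frames1_def)
  have "FFP \<W> \<le> FFP \<V>" if V: "\<V> \<in> bessel1 d" for \<V> :: "('m, 'n) weighted_family"
    using loc_min_optimal(1)[OF min bessel1_config[OF V]]
    by (simp add: FFP_eq_norm[OF W_bessel] FFP_eq_norm[OF V] frame_op_eq_fop power_mono)
  then show "FFP_global_minimizer d \<W>"
    using W_bessel by (simp add: FFP_global_minimizer_def)
next
  fix \<W> \<V> :: "('m, 'n) weighted_family"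
  assume W: "FFP_local_minimizer d \<W>" and V: "FFP_local_minimizer d \<V>"
  note minW = FFP_local_minimizer_loc_min[OF W] and minV = FFP_local_minimizer_loc_min[OF V]
  \<comment> \<open>Each local minimizer is compared with the other as competitor, which leads into
    the equality case.\<close>
  have "norm (frame_op \<V>) = norm (frame_op \<W>)"
    unfolding frame_op_eq_fop
    by (intro order_antisym loc_min_optimal(1)[OF minW] loc_min_optimal(1)[OF minV]
        loc_min_config[OF minV] loc_min_config[OF minW])
  then obtain U where "unitary U" "frame_op \<W> = U ** frame_op \<V> ** adj U"
    using loc_min_optimal(2)[OF minW loc_min_config[OF minV]] unfolding frame_op_eq_fop by blast
  then show "spectrum_mset (frame_op \<W>) = spectrum_mset (frame_op \<V>)"
    by (simp add: spectrum_mset_unitary_conj)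
qed

end
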